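(* Let $H\subseteq G$ be an inclusion of finite groups, let $\rho:H\to\Sigma_n$ be a homomorphism with corresponding $H$-set $S=\{1,\dots,n\}$, and let $c:H\times H\to(\mathbb{C}^\times)^S$ be a 2-cocycle; consider the 2-representation of $H$ in $2Vect_{\mathbb{C}}$ given by $(\rho,c)$. Let $\mathcal R=\{r_1,\dots,r_m\}$ be a system of representatives of the left cosets of $H$ in $G$. Then the induced 2-representation $\operatorname{ind}|_H^G(\rho)$ of $G$ is given by the $G$-set $\operatorname{ind}|_H^G S=G\times_H S\cong\mathcal R\times S$ and the 2-cocycle $\operatorname{ind}|_H^G c:G\times G\to(\mathbb{C}^\times)^{G\times_H S}$ with $$(\operatorname{ind}|_H^G c)_{(r_i,s)}(g_1,g_2)=c_s(h_1,h_2),$$ where $r_j,r_k\in\mathcal R$ and $h_1,h_2\in H$ are the unique elements with $g_1r_j=r_ih_1$ and $g_2r_k=r_jh_2$. Moreover the class $[\operatorname{ind}|_H^G c]$ is the image of $[c]$ under the Shapiro isomorphism $$H^2(H;(\mathbb{C}^\times)^S)\;\cong\; H^2\bigl(G;\operatorname{ind}|_H^G[(\mathbb{C}^\times)^S]\bigr)\;\cong\; H^2\bigl(G;(\mathbb{C}^\times)^{G\times_H S}\bigr).$$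
   Context: **2-vector spaces.** For a field $k$, the 2-category $2Vect_k$ has objects $[n]$, $n\in\{0,1,2,\dots\}$; 1-morphisms are 2-matrices, i.e. matrices whose entries are $k$-vector spaces (an endomorphism of $[n]$ is an $n\times n$ 2-matrix), composed by matrix multiplication using $\oplus$ and $\otimes$ (with the usual canonical isomorphisms treated as identities); 2-morphisms $A\Rightarrow B$ between 2-matrices of the same size are matrices of linear maps $A_{ij}\to B_{ij}$. The identity $\mathbf 1_{[n]}$ has $k$ on the diagonal and $0$ elsewhere. **2-representations.** A 2-representation of a group $K$ in $2Vect_k$ consists of an object $[n]$, 1-morphisms $\rho_g:[n]\to[n]$ for $g\in K$, a 2-isomorphism $\phi_1:\rho_1\Rightarrow\mathbf 1_{[n]}$, and 2-isomorphisms $\phi_{g,h}:\rho_g\circ\rho_h\Rightarrow\rho_{gh}$ for $g,h\in K$, such that $\phi_{gh,l}(\phi_{g,h}\circ\rho_l)=\phi_{g,hl}(\rho_g\circ\phi_{h,l})$ for all $g,h,l\in K$, and $\phi_{1,g}=\phi_1\circ\rho_g$, $\phi_{g,1}=\rho_g\circ\phi_1$ for all $g\in K$. **The 2-representation given by a set and a cocycle.** For a finite $K$-set $S$, $(\mathbb{C}^\times)^S$ is the $K$-module with $(g\cdot a)_s=a_{g^{-1}s}$. A 2-cocycle $c:K\times K\to(\mathbb{C}^\times)^S$ satisfies $c_{g^{-1}s}(h,l)\,c_s(g,hl)=c_s(gh,l)\,c_s(g,h)$. Given $S$ (with an ordering of its elements, equivalently a homomorphism $\rho:K\to\Sigma_{|S|}$)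 and $c$, the 2-representation given by $(S,c)$, or $(\rho,c)$, has $\rho_g$ the permutation 2-matrix with entry $\mathbb{C}$ in position $(gs,s)$ for each $s\in S$ and $0$ elsewhere; $\phi_{g,h}$ is multiplication by $c_s(g,h)$ on the unique nonzero entry of row $s$; and $\phi_1$ is multiplication by $c_s(1,1)$ on row $s$. **Induced 2-representation.** For a 2-representation $(\rho_h,\phi_{h_1,h_2},\phi_1)$ of $H$ of dimension $n$ and coset representatives $r_1,\dots,r_m$ of $G/H$, $\operatorname{ind}|_H^G(\rho)$ is the 2-representation of $G$ of dimension $nm$ for which $\operatorname{ind}|_H^G\rho_g$ is the block 2-matrix whose $(i,j)$-th $n\times n$ block is $\rho_h$ if $gr_j=r_ih$ with $h\in H$, and $0$ otherwise. The $(i,k)$-th block of $(\operatorname{ind}|_H^G\rho_{g_1})\circ(\operatorname{ind}|_H^G\rho_{g_2})$ is $\rho_{h_1}\circ\rho_{h_2}$ if $g_1r_j=r_ih_1$ and $g_2r_k=r_jh_2$ for some $j$ and $h_1,h_2\in H$ (and $0$ otherwise), and on this block $(\operatorname{ind}|_H^G\phi_{g_1,g_2})_{ik}=\phi_{h_1,h_2}$. The unit 2-isomorphism is the one determined by these data through the unit conditions. **$G\times_HS$ and Shapiro.** $G\times_H S$ is the quotient of $G\times S$ by $(gh,s)\sim(g,hs)$ for $h\in H$, with $G$ acting by left multiplication; $(r_i,s)\in\mathcal R\times S$ corresponds to the class of $(r_i,s)$. The $G$-module $(\mathbb{C}^\times)^{G\times_H S}$ is identified with the module $\operatorname{ind}|_H^G[(\mathbb{C}^\times)^S]$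 induced (equivalently, coinduced, the index being finite) from $(\mathbb{C}^\times)^S$. The Shapiro isomorphism is the standard one: its inverse $H^2(G;(\mathbb{C}^\times)^{G\times_H S})\to H^2(H;(\mathbb{C}^\times)^S)$ is restriction to $H$ followed by the map on coefficients induced by the $H$-equivariant inclusion $S\to G\times_HS$, $s\mapsto[1,s]$. *)

theory Defs
  imports "HOL-Algebra.Algebra" "HOL-Algebra.Algebraic_Closure_Type"
begin

section \<open>Complex vector spaces\<close>

abbreviation CC :: "complex ring"
  where "CC \<equiv> ring_of_type_algebra"

text \<open>The fields \<open>mult\<close> and \<open>one\<close> of the record type \<open>module\<close> play no role.\<close>

type_synonym 'v vec_space = "(complex, 'v) module"

abbreviation vec_space :: "'v vec_space \<Rightarrow> bool"
  where "vec_space V \<equiv> module CC V"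

definition lin :: "'v vec_space \<Rightarrow> 'w vec_space \<Rightarrow> ('v \<Rightarrow> 'w) set"
  where "lin V W =
    {f \<in> carrier V \<rightarrow>\<^sub>E carrier W.
       (\<forall>x\<in>carrier V. \<forall>y\<in>carrier V. f (x \<oplus>\<^bsub>V\<^esub> y) = f x \<oplus>\<^bsub>W\<^esub> f y) \<and>
       (\<forall>a. \<forall>x\<in>carrier V. f (a \<odot>\<^bsub>V\<^esub> x) = a \<odot>\<^bsub>W\<^esub> f x)}"

definition ground_space :: "complex vec_space"
  where "ground_space =
    \<lparr>carrier = UNIV, monoid.mult = (*), one = 1, ring.zero = 0, ring.add = (+), module.smult = (*)\<rparr>"

text \<open>The zero space, realised on an arbitrary point of any given type.\<close>

definition zero_space :: "'v vec_space"
  where "zero_space =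
    \<lparr>carrier = {undefined}, monoid.mult = (\<lambda>_ _. undefined), one = undefined,
     ring.zero = undefined, ring.add = (\<lambda>_ _. undefined), module.smult = (\<lambda>_ _. undefined)\<rparr>"

definition direct_sum :: "nat set \<Rightarrow> (nat \<Rightarrow> 'v vec_space) \<Rightarrow> (nat \<Rightarrow> 'v) vec_space"
  where "direct_sum I V =
    \<lparr>carrier = (\<Pi>\<^sub>E j\<in>I. carrier (V j)), monoid.mult = undefined, one = undefined,
     ring.zero = (\<lambda>j\<in>I. \<zero>\<^bsub>V j\<^esub>),
     ring.add = (\<lambda>x y. \<lambda>j\<in>I. x j \<oplus>\<^bsub>V j\<^esub> y j),
     module.smult = (\<lambda>a x. \<lambda>j\<in>I. a \<odot>\<^bsub>V j\<^esub> x j)\<rparr>"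

definition summand_inj :: "nat set \<Rightarrow> (nat \<Rightarrow> 'v vec_space) \<Rightarrow> nat \<Rightarrow> 'v \<Rightarrow> (nat \<Rightarrow> 'v)"
  where "summand_inj I V k x = (\<lambda>j\<in>I. if j = k then x else \<zero>\<^bsub>V j\<^esub>)"

text \<open>
  The tensor product is the free vector space on \<open>carrier V \<times> carrier W\<close> (finitely supported
  functions) modulo the subspace generated by the bilinearity relations; its elements are the
  cosets of that subspace.
\<close>

definition free_space :: "'v set \<Rightarrow> 'w set \<Rightarrow> ('v \<times> 'w \<Rightarrow> complex) set"
  where "free_space A B = {f. finite {p. f p \<noteq> 0} \<and> {p. f p \<noteq> 0} \<subseteq> A \<times> B}"

definition free_gen :: "'v \<Rightarrow> 'w \<Rightarrow> ('v \<times> 'w \<Rightarrow> complex)"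
  where "free_gen v w = (\<lambda>p. if p = (v, w) then 1 else 0)"

inductive_set tensor_null :: "'v vec_space \<Rightarrow> 'w vec_space \<Rightarrow> ('v \<times> 'w \<Rightarrow> complex) set"
  for V :: "'v vec_space" and W :: "'w vec_space"
  where
    null_zero: "(\<lambda>p. 0) \<in> tensor_null V W"
  | null_add: "f \<in> tensor_null V W \<Longrightarrow> g \<in> tensor_null V W \<Longrightarrow> (\<lambda>p. f p + g p) \<in> tensor_null V W"
  | null_smult: "f \<in> tensor_null V W \<Longrightarrow> (\<lambda>p. a * f p) \<in> tensor_null V W"
  | add_left: "v \<in> carrier V \<Longrightarrow> v' \<in> carrier V \<Longrightarrow> w \<in> carrier W \<Longrightarrow>
      (\<lambda>p. free_gen (v \<oplus>\<^bsub>V\<^esub> v') w p - free_gen v w p - free_gen v' w p) \<in> tensor_null V W"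
  | add_right: "v \<in> carrier V \<Longrightarrow> w \<in> carrier W \<Longrightarrow> w' \<in> carrier W \<Longrightarrow>
      (\<lambda>p. free_gen v (w \<oplus>\<^bsub>W\<^esub> w') p - free_gen v w p - free_gen v w' p) \<in> tensor_null V W"
  | smult_left: "v \<in> carrier V \<Longrightarrow> w \<in> carrier W \<Longrightarrow>
      (\<lambda>p. free_gen (a \<odot>\<^bsub>V\<^esub> v) w p - a * free_gen v w p) \<in> tensor_null V W"
  | smult_right: "v \<in> carrier V \<Longrightarrow> w \<in> carrier W \<Longrightarrow>
      (\<lambda>p. free_gen v (a \<odot>\<^bsub>W\<^esub> w) p - a * free_gen v w p) \<in> tensor_null V W"

definition null_coset ::
    "'v vec_space \<Rightarrow> 'w vec_space \<Rightarrow> ('v \<times> 'w \<Rightarrow> complex) \<Rightarrow> ('v \<times> 'w \<Rightarrow> complex) set"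
  where "null_coset V W f = {(\<lambda>p. f p + n p) | n. n \<in> tensor_null V W}"

definition tensor :: "'v vec_space \<Rightarrow> 'w vec_space \<Rightarrow> (('v \<times> 'w \<Rightarrow> complex) set) vec_space"
  where "tensor V W =
    \<lparr>carrier = null_coset V W ` free_space (carrier V) (carrier W),
     monoid.mult = undefined, one = undefined,
     ring.zero = tensor_null V W,
     ring.add = (\<lambda>P Q. {(\<lambda>p. f p + g p) | f g. f \<in> P \<and> g \<in> Q}),
     module.smult = (\<lambda>a P. {(\<lambda>p. a * f p + n p) | f n. f \<in> P \<and> n \<in> tensor_null V W})\<rparr>"

definition tens ::
    "'v vec_space \<Rightarrow> 'w vec_space \<Rightarrow> 'v \<Rightarrow> 'w \<Rightarrow> ('v \<times> 'w \<Rightarrow> complex) set"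
  where "tens V W v w = null_coset V W (free_gen v w)"

text \<open>The linear map \<open>V \<otimes> W \<rightarrow> U\<close> determined by a bilinear map \<open>b\<close>.\<close>

definition tensor_lift ::
    "'v vec_space \<Rightarrow> 'w vec_space \<Rightarrow> 'x vec_space \<Rightarrow> ('v \<Rightarrow> 'w \<Rightarrow> 'x) \<Rightarrow>
     (('v \<times> 'w \<Rightarrow> complex) set \<Rightarrow> 'x)"
  where "tensor_lift V W U b =
    (THE F. F \<in> lin (tensor V W) U \<and>
       (\<forall>v\<in>carrier V. \<forall>w\<in>carrier W. F (tens V W v w) = b v w))"

definition tensor_map ::
    "'v vec_space \<Rightarrow> 'w vec_space \<Rightarrow> 'x vec_space \<Rightarrow> 'y vec_space \<Rightarrow>
     ('v \<Rightarrow> 'x) \<Rightarrow> ('w \<Rightarrow> 'y) \<Rightarrow> (('v \<times> 'w \<Rightarrow> complex) set \<Rightarrow> ('x \<times> 'y \<Rightarrow> complex) set)"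
  where "tensor_map V W V' W' f g =
    tensor_lift V W (tensor V' W') (\<lambda>v w. tens V' W' (f v) (g w))"

section \<open>Endomorphisms of the object \<open>[n]\<close> of the 2-category of 2-vector spaces\<close>

text \<open>
  Rows and columns are indexed by \<open>{1..n}\<close>.  All families and maps are extensional
  (\<open>undefined\<close> outside their domain), so that equality of data is equality in HOL.
\<close>

type_synonym 'v two_mat = "nat \<Rightarrow> nat \<Rightarrow> 'v vec_space"
type_synonym ('v, 'w) two_mor = "nat \<Rightarrow> nat \<Rightarrow> 'v \<Rightarrow> 'w"
type_synonym ('v, 'w) comp_elt = "nat \<Rightarrow> ('v \<times> 'w \<Rightarrow> complex) set"

definition two_mats :: "nat \<Rightarrow> 'v two_mat set"
  where "two_mats n = ({1..n} \<rightarrow>\<^sub>E {1..n} \<rightarrow>\<^sub>E {V. vec_space V})"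

definition id_mat :: "nat \<Rightarrow> complex two_mat"
  where "id_mat n = (\<lambda>i\<in>{1..n}. \<lambda>j\<in>{1..n}. if i = j then ground_space else zero_space)"

definition comp_mat :: "nat \<Rightarrow> 'v two_mat \<Rightarrow> 'w two_mat \<Rightarrow> ('v, 'w) comp_elt two_mat"
  where "comp_mat n A B =
    (\<lambda>i\<in>{1..n}. \<lambda>k\<in>{1..n}. direct_sum {1..n} (\<lambda>j. tensor (A i j) (B j k)))"

text \<open>The vector \<open>a \<otimes> b\<close> in the \<open>j\<close>-th summand of the \<open>(i, k)\<close>-entry of \<open>A \<circ> B\<close>.\<close>

definition comp_gen ::
    "nat \<Rightarrow> 'v two_mat \<Rightarrow> 'w two_mat \<Rightarrow> nat \<Rightarrow> nat \<Rightarrow> nat \<Rightarrow> 'v \<Rightarrow> 'w \<Rightarrow> ('v, 'w) comp_elt"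
  where "comp_gen n A B i j k a b =
    summand_inj {1..n} (\<lambda>j. tensor (A i j) (B j k)) j (tens (A i j) (B j k) a b)"

definition two_mors :: "nat \<Rightarrow> 'v two_mat \<Rightarrow> 'w two_mat \<Rightarrow> ('v, 'w) two_mor set"
  where "two_mors n A B = (\<Pi>\<^sub>E i\<in>{1..n}. \<Pi>\<^sub>E j\<in>{1..n}. lin (A i j) (B i j))"

definition id_mor :: "nat \<Rightarrow> 'v two_mat \<Rightarrow> ('v, 'v) two_mor"
  where "id_mor n A = (\<lambda>i\<in>{1..n}. \<lambda>j\<in>{1..n}. \<lambda>x\<in>carrier (A i j). x)"

text \<open>Vertical composition \<open>\<beta> \<alpha>\<close>; \<open>A\<close> is the source of \<open>\<alpha>\<close>.\<close>

definition vcomp ::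
    "nat \<Rightarrow> 'v two_mat \<Rightarrow> ('w, 'x) two_mor \<Rightarrow> ('v, 'w) two_mor \<Rightarrow> ('v, 'x) two_mor"
  where "vcomp n A \<beta> \<alpha> =
    (\<lambda>i\<in>{1..n}. \<lambda>j\<in>{1..n}. compose (carrier (A i j)) (\<beta> i j) (\<alpha> i j))"

text \<open>Horizontal composition of \<open>\<alpha> : A \<Rightarrow> A'\<close> and \<open>\<beta> : B \<Rightarrow> B'\<close>.\<close>

definition hcomp ::
    "nat \<Rightarrow> 'v two_mat \<Rightarrow> 'w two_mat \<Rightarrow> 'x two_mat \<Rightarrow> 'y two_mat \<Rightarrow>
     ('v, 'x) two_mor \<Rightarrow> ('w, 'y) two_mor \<Rightarrow> (('v, 'w) comp_elt, ('x, 'y) comp_elt) two_mor"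
  where "hcomp n A B A' B' \<alpha> \<beta> =
    (\<lambda>i\<in>{1..n}. \<lambda>k\<in>{1..n}. \<lambda>x\<in>carrier (comp_mat n A B i k). \<lambda>j\<in>{1..n}.
       tensor_map (A i j) (B j k) (A' i j) (B' j k) (\<alpha> i j) (\<beta> j k) (x j))"

definition two_iso :: "nat \<Rightarrow> 'v two_mat \<Rightarrow> 'w two_mat \<Rightarrow> ('v, 'w) two_mor \<Rightarrow> bool"
  where "two_iso n A B \<alpha> \<longleftrightarrow>
    \<alpha> \<in> two_mors n A B \<and>
    (\<exists>\<beta>\<in>two_mors n B A. vcomp n A \<beta> \<alpha> = id_mor n A \<and> vcomp n B \<alpha> \<beta> = id_mor n B)"

text \<open>
  The canonical isomorphisms \<open>(A \<circ> B) \<circ> C \<Rightarrow> A \<circ> (B \<circ> C)\<close>, \<open>1 \<circ> A \<Rightarrow> A\<close> and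
  \<open>A \<circ> 1 \<Rightarrow> A\<close>, which are usually treated as identities.
\<close>

definition assoc_mor ::
    "nat \<Rightarrow> 'v two_mat \<Rightarrow> 'w two_mat \<Rightarrow> 'x two_mat \<Rightarrow>
     ((('v, 'w) comp_elt, 'x) comp_elt, ('v, ('w, 'x) comp_elt) comp_elt) two_mor"
  where "assoc_mor n A B C =
    (\<lambda>i\<in>{1..n}. \<lambda>l\<in>{1..n}.
       THE F. F \<in> lin (comp_mat n (comp_mat n A B) C i l) (comp_mat n A (comp_mat n B C) i l) \<and>
         (\<forall>j\<in>{1..n}. \<forall>k\<in>{1..n}.
            \<forall>a\<in>carrier (A i j). \<forall>b\<in>carrier (B j k). \<forall>c\<in>carrier (C k l).
              F (comp_gen n (comp_mat n A B) C i k l (comp_gen n A B i j k a b) c)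
              = comp_gen n A (comp_mat n B C) i j l a (comp_gen n B C j k l b c)))"

definition lunit_mor :: "nat \<Rightarrow> 'v two_mat \<Rightarrow> ((complex, 'v) comp_elt, 'v) two_mor"
  where "lunit_mor n A =
    (\<lambda>i\<in>{1..n}. \<lambda>j\<in>{1..n}. \<lambda>x\<in>carrier (comp_mat n (id_mat n) A i j).
       tensor_lift ground_space (A i j) (A i j) (\<lambda>z v. z \<odot>\<^bsub>A i j\<^esub> v) (x i))"

definition runit_mor :: "nat \<Rightarrow> 'v two_mat \<Rightarrow> (('v, complex) comp_elt, 'v) two_mor"
  where "runit_mor n A =
    (\<lambda>i\<in>{1..n}. \<lambda>j\<in>{1..n}. \<lambda>x\<in>carrier (comp_mat n A (id_mat n) i j).
       tensor_lift (A i j) ground_space (A i j) (\<lambda>v z. z \<odot>\<^bsub>A i j\<^esub> v) (x j))"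

section \<open>2-representations\<close>

record ('g, 'v) two_rep =
  dim :: nat
  rho :: "'g \<Rightarrow> 'v two_mat"
  phi1 :: "('v, complex) two_mor"
  phi :: "'g \<Rightarrow> 'g \<Rightarrow> (('v, 'v) comp_elt, 'v) two_mor"

text \<open>The conditions \<open>\<phi>\<^sub>1\<^sub>,\<^sub>g = \<phi>\<^sub>1 \<circ> \<rho>\<^sub>g\<close> and \<open>\<phi>\<^sub>g\<^sub>,\<^sub>1 = \<rho>\<^sub>g \<circ> \<phi>\<^sub>1\<close>.\<close>

definition unit_conditions ::
    "('g, 'm) monoid_scheme \<Rightarrow> nat \<Rightarrow> ('g \<Rightarrow> 'v two_mat) \<Rightarrow>
     ('g \<Rightarrow> 'g \<Rightarrow> (('v, 'v) comp_elt, 'v) two_mor) \<Rightarrow> ('v, complex) two_mor \<Rightarrow> bool"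
  where "unit_conditions K n \<rho> \<phi> u \<longleftrightarrow>
    (\<forall>g\<in>carrier K.
       \<phi> \<one>\<^bsub>K\<^esub> g =
         vcomp n (comp_mat n (\<rho> \<one>\<^bsub>K\<^esub>) (\<rho> g)) (lunit_mor n (\<rho> g))
           (hcomp n (\<rho> \<one>\<^bsub>K\<^esub>) (\<rho> g) (id_mat n) (\<rho> g) u (id_mor n (\<rho> g))) \<and>
       \<phi> g \<one>\<^bsub>K\<^esub> =
         vcomp n (comp_mat n (\<rho> g) (\<rho> \<one>\<^bsub>K\<^esub>)) (runit_mor n (\<rho> g))
           (hcomp n (\<rho> g) (\<rho> \<one>\<^bsub>K\<^esub>) (\<rho> g) (id_mat n) (id_mor n (\<rho> g)) u))"

definition is_two_rep :: "('g, 'm) monoid_scheme \<Rightarrow> ('g, 'v) two_rep \<Rightarrow> bool"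
  where "is_two_rep K \<R> \<longleftrightarrow>
    (let n = dim \<R>; \<rho> = rho \<R>; \<phi> = phi \<R> in
       group K \<and>
       \<rho> \<in> carrier K \<rightarrow>\<^sub>E two_mats n \<and>
       \<phi> \<in> (\<Pi>\<^sub>E g\<in>carrier K. \<Pi>\<^sub>E h\<in>carrier K.
              {\<alpha>. two_iso n (comp_mat n (\<rho> g) (\<rho> h)) (\<rho> (g \<otimes>\<^bsub>K\<^esub> h)) \<alpha>}) \<and>
       two_iso n (\<rho> \<one>\<^bsub>K\<^esub>) (id_mat n) (phi1 \<R>) \<and>
       (\<forall>g\<in>carrier K. \<forall>h\<in>carrier K. \<forall>l\<in>carrier K.
          let S = comp_mat n (comp_mat n (\<rho> g) (\<rho> h)) (\<rho> l) in
          vcomp n S (\<phi> (g \<otimes>\<^bsub>K\<^esub> h) l)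
            (hcomp n (comp_mat n (\<rho> g) (\<rho> h)) (\<rho> l) (\<rho> (g \<otimes>\<^bsub>K\<^esub> h)) (\<rho> l)
               (\<phi> g h) (id_mor n (\<rho> l)))
          = vcomp n S (\<phi> g (h \<otimes>\<^bsub>K\<^esub> l))
              (vcomp n S
                 (hcomp n (\<rho> g) (comp_mat n (\<rho> h) (\<rho> l)) (\<rho> g) (\<rho> (h \<otimes>\<^bsub>K\<^esub> l))
                    (id_mor n (\<rho> g)) (\<phi> h l))
                 (assoc_mor n (\<rho> g) (\<rho> h) (\<rho> l)))) \<and>
       unit_conditions K n \<rho> \<phi> (phi1 \<R>))"

text \<open>
  The 2-representation given by a finite \<open>K\<close>-set \<open>S\<close>, ordered by a bijection
  \<open>e : {1..card S} \<rightarrow> S\<close>, and a 2-cocycle \<open>c\<close>, where \<open>c (g, h) s\<close> stands for \<open>c\<^sub>s(g, h)\<close>.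
  The multiplication of \<open>CC\<close> identifies \<open>CC \<otimes> CC\<close> with \<open>CC\<close>.
\<close>

definition set_rho ::
    "('g, 'm) monoid_scheme \<Rightarrow> 's set \<Rightarrow> (nat \<Rightarrow> 's) \<Rightarrow> ('g \<Rightarrow> 's \<Rightarrow> 's) \<Rightarrow> 'g \<Rightarrow> complex two_mat"
  where "set_rho K S e act =
    (\<lambda>g\<in>carrier K. \<lambda>i\<in>{1..card S}. \<lambda>j\<in>{1..card S}.
       if e i = act g (e j) then ground_space else zero_space)"

definition set_two_rep ::
    "('g, 'm) monoid_scheme \<Rightarrow> 's set \<Rightarrow> (nat \<Rightarrow> 's) \<Rightarrow> ('g \<Rightarrow> 's \<Rightarrow> 's) \<Rightarrow>
     ('g \<times> 'g \<Rightarrow> 's \<Rightarrow> complex) \<Rightarrow> ('g, complex) two_rep"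
  where "set_two_rep K S e act c =
    \<lparr>dim = card S,
     rho = set_rho K S e act,
     phi1 = (\<lambda>i\<in>{1..card S}. \<lambda>j\<in>{1..card S}.
       \<lambda>x\<in>carrier (set_rho K S e act \<one>\<^bsub>K\<^esub> i j).
         if i = j then c (\<one>\<^bsub>K\<^esub>, \<one>\<^bsub>K\<^esub>) (e i) * x else \<zero>\<^bsub>id_mat (card S) i j\<^esub>),
     phi = (\<lambda>g\<in>carrier K. \<lambda>h\<in>carrier K. \<lambda>i\<in>{1..card S}. \<lambda>k\<in>{1..card S}.
       \<lambda>x\<in>carrier (comp_mat (card S) (set_rho K S e act g) (set_rho K S e act h) i k).
         if e i = act (g \<otimes>\<^bsub>K\<^esub> h) (e k)
         then c (g, h) (e i) *
           tensor_lift ground_space ground_space ground_space (*)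
             (x (THE j. j \<in> {1..card S} \<and> e j = act h (e k)))
         else \<zero>\<^bsub>set_rho K S e act (g \<otimes>\<^bsub>K\<^esub> h) i k\<^esub>)\<rparr>"

section \<open>Induced 2-representations\<close>

text \<open>
  Coset representatives are \<open>r 1, \<dots>, r m\<close>.  An index in \<open>{1..n * m}\<close> is split into a block
  number in \<open>{1..m}\<close> and a position in \<open>{1..n}\<close> inside that block.
\<close>

definition coset_reps :: "('g, 'm) monoid_scheme \<Rightarrow> 'g set \<Rightarrow> nat \<Rightarrow> (nat \<Rightarrow> 'g) \<Rightarrow> bool"
  where "coset_reps G H m r \<longleftrightarrow>
    r ` {1..m} \<subseteq> carrier G \<and> bij_betw (\<lambda>i. r i <#\<^bsub>G\<^esub> H) {1..m} (lcosets\<^bsub>G\<^esub> H)"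

definition block :: "nat \<Rightarrow> nat \<Rightarrow> nat"
  where "block n I = (I - 1) div n + 1"

definition inner :: "nat \<Rightarrow> nat \<Rightarrow> nat"
  where "inner n I = (I - 1) mod n + 1"

definition index :: "nat \<Rightarrow> nat \<Rightarrow> nat \<Rightarrow> nat"
  where "index n i s = (i - 1) * n + s"

text \<open>The only element \<open>h\<close> of \<open>G\<close> with \<open>g r\<^sub>j = r\<^sub>i h\<close>.\<close>

definition transfer_elt :: "('g, 'm) monoid_scheme \<Rightarrow> (nat \<Rightarrow> 'g) \<Rightarrow> 'g \<Rightarrow> nat \<Rightarrow> nat \<Rightarrow> 'g"
  where "transfer_elt G r g i j = inv\<^bsub>G\<^esub> (r i) \<otimes>\<^bsub>G\<^esub> g \<otimes>\<^bsub>G\<^esub> r j"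

definition ind_rho ::
    "('g, 'm) monoid_scheme \<Rightarrow> 'g set \<Rightarrow> nat \<Rightarrow> (nat \<Rightarrow> 'g) \<Rightarrow> ('g, 'v) two_rep \<Rightarrow>
     'g \<Rightarrow> 'v two_mat"
  where "ind_rho G H m r \<R> =
    (\<lambda>g\<in>carrier G. \<lambda>I\<in>{1..dim \<R> * m}. \<lambda>J\<in>{1..dim \<R> * m}.
       let n = dim \<R>; h = transfer_elt G r g (block n I) (block n J) in
       if h \<in> H then rho \<R> h (inner n I) (inner n J) else zero_space)"

text \<open>
  A vector \<open>x\<close> in the \<open>(I, K)\<close>-entry of the composite has one component for each
  \<open>J \<in> {1..n * m}\<close>; only those \<open>J\<close> in the block \<open>j\<close> with \<open>g\<^sub>1 r\<^sub>j = r\<^sub>i h\<^sub>1\<close> and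
  \<open>g\<^sub>2 r\<^sub>k = r\<^sub>j h\<^sub>2\<close> contribute, and they form an entry of \<open>\<rho>\<^bsub>h\<^sub>1\<^esub> \<circ> \<rho>\<^bsub>h\<^sub>2\<^esub>\<close>.
\<close>

definition ind_phi ::
    "('g, 'm) monoid_scheme \<Rightarrow> 'g set \<Rightarrow> nat \<Rightarrow> (nat \<Rightarrow> 'g) \<Rightarrow> ('g, 'v) two_rep \<Rightarrow>
     'g \<Rightarrow> 'g \<Rightarrow> (('v, 'v) comp_elt, 'v) two_mor"
  where "ind_phi G H m r \<R> =
    (\<lambda>g1\<in>carrier G. \<lambda>g2\<in>carrier G. \<lambda>I\<in>{1..dim \<R> * m}. \<lambda>K\<in>{1..dim \<R> * m}.
       \<lambda>x\<in>carrier (comp_mat (dim \<R> * m) (ind_rho G H m r \<R> g1) (ind_rho G H m r \<R> g2) I K).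
         let n = dim \<R>; i = block n I; k = block n K;
           P = (\<lambda>j. j \<in> {1..m} \<and> transfer_elt G r g1 i j \<in> H \<and> transfer_elt G r g2 j k \<in> H)
         in if \<exists>j. P j
            then let j = (THE j. P j) in
              phi \<R> (transfer_elt G r g1 i j) (transfer_elt G r g2 j k) (inner n I) (inner n K)
                (\<lambda>t\<in>{1..n}. x (index n j t))
            else \<zero>\<^bsub>ind_rho G H m r \<R> (g1 \<otimes>\<^bsub>G\<^esub> g2) I K\<^esub>)"

definition ind_two_rep ::
    "('g, 'm) monoid_scheme \<Rightarrow> 'g set \<Rightarrow> nat \<Rightarrow> (nat \<Rightarrow> 'g) \<Rightarrow> ('g, 'v) two_rep \<Rightarrow>
     ('g, 'v) two_rep"
  where "ind_two_rep G H m r \<R> =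
    \<lparr>dim = dim \<R> * m,
     rho = ind_rho G H m r \<R>,
     phi1 = (THE u.
       two_iso (dim \<R> * m) (ind_rho G H m r \<R> \<one>\<^bsub>G\<^esub>) (id_mat (dim \<R> * m)) u \<and>
       unit_conditions G (dim \<R> * m) (ind_rho G H m r \<R>) (ind_phi G H m r \<R>) u),
     phi = ind_phi G H m r \<R>\<rparr>"

section \<open>The \<open>G\<close>-set \<open>G \<times>\<^sub>H S\<close>\<close>

definition balanced_rel ::
    "('g, 'm) monoid_scheme \<Rightarrow> 'g set \<Rightarrow> 's set \<Rightarrow> ('g \<Rightarrow> 's \<Rightarrow> 's) \<Rightarrow> (('g \<times> 's) \<times> ('g \<times> 's)) set"
  where "balanced_rel G H S act =
    {((g \<otimes>\<^bsub>G\<^esub> h, s), (g, act h s)) | g h s. g \<in> carrier G \<and> h \<in> H \<and> s \<in> S}"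

definition balanced ::
    "('g, 'm) monoid_scheme \<Rightarrow> 'g set \<Rightarrow> 's set \<Rightarrow> ('g \<Rightarrow> 's \<Rightarrow> 's) \<Rightarrow> ('g \<times> 's) set set"
  where "balanced G H S act = (carrier G \<times> S) // balanced_rel G H S act"

definition balanced_class ::
    "('g, 'm) monoid_scheme \<Rightarrow> 'g set \<Rightarrow> 's set \<Rightarrow> ('g \<Rightarrow> 's \<Rightarrow> 's) \<Rightarrow> 'g \<Rightarrow> 's \<Rightarrow> ('g \<times> 's) set"
  where "balanced_class G H S act g s = balanced_rel G H S act `` {(g, s)}"

definition balanced_act ::
    "('g, 'm) monoid_scheme \<Rightarrow> 'g set \<Rightarrow> 's set \<Rightarrow> ('g \<Rightarrow> 's \<Rightarrow> 's) \<Rightarrow>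
     'g \<Rightarrow> ('g \<times> 's) set \<Rightarrow> ('g \<times> 's) set"
  where "balanced_act G H S act g =
    (\<lambda>t\<in>balanced G H S act. (\<lambda>(x, s). (g \<otimes>\<^bsub>G\<^esub> x, s)) ` t)"

section \<open>Second cohomology\<close>

text \<open>The \<open>K\<close>-module of functions from a \<open>K\<close>-set \<open>S\<close> to the group of units of \<open>CC\<close>.\<close>

definition unit_funs :: "'s set \<Rightarrow> ('s \<Rightarrow> complex) monoid"
  where "unit_funs S = product_group S (\<lambda>_. units_of CC)"

definition unit_funs_act ::
    "('g, 'm) monoid_scheme \<Rightarrow> 's set \<Rightarrow> ('g \<Rightarrow> 's \<Rightarrow> 's) \<Rightarrow> 'g \<Rightarrow> ('s \<Rightarrow> complex) \<Rightarrow> ('s \<Rightarrow> complex)"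
  where "unit_funs_act K S act g a = (\<lambda>s\<in>S. a (act (inv\<^bsub>K\<^esub> g) s))"

definition cocycles2 ::
    "('g, 'm) monoid_scheme \<Rightarrow> 'a monoid \<Rightarrow> ('g \<Rightarrow> 'a \<Rightarrow> 'a) \<Rightarrow> ('g \<times> 'g \<Rightarrow> 'a) monoid"
  where "cocycles2 K A act =
    (product_group (carrier K \<times> carrier K) (\<lambda>_. A))
      \<lparr>carrier := {c \<in> carrier K \<times> carrier K \<rightarrow>\<^sub>E carrier A.
         \<forall>g\<in>carrier K. \<forall>h\<in>carrier K. \<forall>l\<in>carrier K.
           act g (c (h, l)) \<otimes>\<^bsub>A\<^esub> c (g, h \<otimes>\<^bsub>K\<^esub> l) = c (g \<otimes>\<^bsub>K\<^esub> h, l) \<otimes>\<^bsub>A\<^esub> c (g, h)}\<rparr>"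

definition coboundaries2 ::
    "('g, 'm) monoid_scheme \<Rightarrow> 'a monoid \<Rightarrow> ('g \<Rightarrow> 'a \<Rightarrow> 'a) \<Rightarrow> ('g \<times> 'g \<Rightarrow> 'a) set"
  where "coboundaries2 K A act =
    (\<lambda>b. \<lambda>(g, h)\<in>carrier K \<times> carrier K.
        act g (b h) \<otimes>\<^bsub>A\<^esub> inv\<^bsub>A\<^esub> (b (g \<otimes>\<^bsub>K\<^esub> h)) \<otimes>\<^bsub>A\<^esub> b g)
      ` (carrier K \<rightarrow>\<^sub>E carrier A)"

definition H2 ::
    "('g, 'm) monoid_scheme \<Rightarrow> 'a monoid \<Rightarrow> ('g \<Rightarrow> 'a \<Rightarrow> 'a) \<Rightarrow> ('g \<times> 'g \<Rightarrow> 'a) set monoid"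
  where "H2 K A act = cocycles2 K A act Mod coboundaries2 K A act"

definition H2_class ::
    "('g, 'm) monoid_scheme \<Rightarrow> 'a monoid \<Rightarrow> ('g \<Rightarrow> 'a \<Rightarrow> 'a) \<Rightarrow> ('g \<times> 'g \<Rightarrow> 'a) \<Rightarrow>
     ('g \<times> 'g \<Rightarrow> 'a) set"
  where "H2_class K A act c = coboundaries2 K A act #>\<^bsub>cocycles2 K A act\<^esub> c"

text \<open>
  The map on cohomology induced by restriction from \<open>K\<close> to a subgroup \<open>K'\<close> followed by a map
  \<open>f\<close> of coefficients: the image of the coset of \<open>c\<close> is the coset of \<open>f \<circ> c\<close> on \<open>K'\<close>.
\<close>

definition H2_map ::
    "('g, 'm) monoid_scheme \<Rightarrow> 'a monoid \<Rightarrow> ('g \<Rightarrow> 'a \<Rightarrow> 'a) \<Rightarrow>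
     ('g, 'l) monoid_scheme \<Rightarrow> 'b monoid \<Rightarrow> ('g \<Rightarrow> 'b \<Rightarrow> 'b) \<Rightarrow>
     ('a \<Rightarrow> 'b) \<Rightarrow> ('g \<times> 'g \<Rightarrow> 'a) set \<Rightarrow> ('g \<times> 'g \<Rightarrow> 'b) set"
  where "H2_map K A act K' B act' f =
    (\<lambda>u\<in>carrier (H2 K A act).
       coboundaries2 K' B act' <#>\<^bsub>cocycles2 K' B act'\<^esub>
         ((\<lambda>c. \<lambda>p\<in>carrier K' \<times> carrier K'. f (c p)) ` u))"

text \<open>
  The module induced (equivalently, coinduced) from an \<open>H\<close>-module: functions \<open>f : G \<rightarrow> A\<close> with
  \<open>f (x h) = h\<^sup>-\<^sup>1 f x\<close>, where \<open>(g f) x = f (g\<^sup>-\<^sup>1 x)\<close>.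
\<close>

definition ind_module ::
    "('g, 'm) monoid_scheme \<Rightarrow> 'g set \<Rightarrow> 'a monoid \<Rightarrow> ('g \<Rightarrow> 'a \<Rightarrow> 'a) \<Rightarrow> ('g \<Rightarrow> 'a) monoid"
  where "ind_module G H A act =
    (product_group (carrier G) (\<lambda>_. A))
      \<lparr>carrier := {f \<in> carrier G \<rightarrow>\<^sub>E carrier A.
         \<forall>x\<in>carrier G. \<forall>h\<in>H. f (x \<otimes>\<^bsub>G\<^esub> h) = act (inv\<^bsub>G\<^esub> h) (f x)}\<rparr>"

definition ind_module_act ::
    "('g, 'm) monoid_scheme \<Rightarrow> 'g \<Rightarrow> ('g \<Rightarrow> 'a) \<Rightarrow> ('g \<Rightarrow> 'a)"
  where "ind_module_act G g f = (\<lambda>x\<in>carrier G. f (inv\<^bsub>G\<^esub> g \<otimes>\<^bsub>G\<^esub> x))"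

text \<open>
  The Shapiro isomorphism from \<open>H\<^sup>2(H; A)\<close> to \<open>H\<^sup>2(G; ind A)\<close>, inverse to restriction to \<open>H\<close>
  followed by evaluation at the neutral element.
\<close>

definition shapiro_ind ::
    "('g, 'm) monoid_scheme \<Rightarrow> 'g set \<Rightarrow> 'a monoid \<Rightarrow> ('g \<Rightarrow> 'a \<Rightarrow> 'a) \<Rightarrow>
     ('g \<times> 'g \<Rightarrow> 'a) set \<Rightarrow> ('g \<times> 'g \<Rightarrow> 'g \<Rightarrow> 'a) set"
  where "shapiro_ind G H A act =
    inv_into (carrier (H2 G (ind_module G H A act) (ind_module_act G)))
      (H2_map G (ind_module G H A act) (ind_module_act G) (G\<lparr>carrier := H\<rparr>) A act
         (\<lambda>f. f \<one>\<^bsub>G\<^esub>))"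

text \<open>
  A function on \<open>G \<times>\<^sub>H S\<close> is identified with an element of the module induced from the functions
  on \<open>S\<close>.  The resulting isomorphism on cohomology is used in the direction from the induced
  module to the functions on \<open>G \<times>\<^sub>H S\<close>.
\<close>

definition fun_to_ind ::
    "('g, 'm) monoid_scheme \<Rightarrow> 'g set \<Rightarrow> 's set \<Rightarrow> ('g \<Rightarrow> 's \<Rightarrow> 's) \<Rightarrow>
     (('g \<times> 's) set \<Rightarrow> complex) \<Rightarrow> ('g \<Rightarrow> 's \<Rightarrow> complex)"
  where "fun_to_ind G H S act a =
    (\<lambda>x\<in>carrier G. \<lambda>s\<in>S. a (balanced_class G H S act x s))"

definition H2_identification ::
    "('g, 'm) monoid_scheme \<Rightarrow> 'g set \<Rightarrow> 's set \<Rightarrow> ('g \<Rightarrow> 's \<Rightarrow> 's) \<Rightarrow>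
     ('g \<times> 'g \<Rightarrow> 'g \<Rightarrow> 's \<Rightarrow> complex) set \<Rightarrow> ('g \<times> 'g \<Rightarrow> ('g \<times> 's) set \<Rightarrow> complex) set"
  where "H2_identification G H S act =
    (let T = balanced G H S act; \<tau> = unit_funs_act G T (balanced_act G H S act);
         A = unit_funs S; \<alpha> = unit_funs_act (G\<lparr>carrier := H\<rparr>) S act
     in inv_into (carrier (H2 G (unit_funs T) \<tau>))
          (H2_map G (unit_funs T) \<tau> G (ind_module G H A \<alpha>) (ind_module_act G)
             (fun_to_ind G H S act)))"

text \<open>Restriction to \<open>H\<close> followed by the coefficient map of \<open>S \<rightarrow> G \<times>\<^sub>H S\<close>, \<open>s \<mapsto> [1, s]\<close>.\<close>

definition restrict_to_S ::
    "('g, 'm) monoid_scheme \<Rightarrow> 'g set \<Rightarrow> 's set \<Rightarrow> ('g \<Rightarrow> 's \<Rightarrow> 's) \<Rightarrow>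
     ('g \<times> 'g \<Rightarrow> ('g \<times> 's) set \<Rightarrow> complex) set \<Rightarrow> ('g \<times> 'g \<Rightarrow> 's \<Rightarrow> complex) set"
  where "restrict_to_S G H S act =
    (let T = balanced G H S act; \<tau> = unit_funs_act G T (balanced_act G H S act)
     in H2_map G (unit_funs T) \<tau>
          (G\<lparr>carrier := H\<rparr>) (unit_funs S) (unit_funs_act (G\<lparr>carrier := H\<rparr>) S act)
          (\<lambda>a. \<lambda>s\<in>S. a (balanced_class G H S act \<one>\<^bsub>G\<^esub> s)))"

section \<open>The induced cocycle\<close>

definition ind_cocycle ::
    "('g, 'm) monoid_scheme \<Rightarrow> 'g set \<Rightarrow> nat \<Rightarrow> (nat \<Rightarrow> 'g) \<Rightarrow> 's set \<Rightarrow> ('g \<Rightarrow> 's \<Rightarrow> 's) \<Rightarrow>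
     ('g \<times> 'g \<Rightarrow> 's \<Rightarrow> complex) \<Rightarrow> ('g \<times> 'g \<Rightarrow> ('g \<times> 's) set \<Rightarrow> complex)"
  where "ind_cocycle G H m r S act c =
    (\<lambda>(g1, g2)\<in>carrier G \<times> carrier G. \<lambda>t\<in>balanced G H S act.
       THE z. \<exists>i\<in>{1..m}. \<exists>j\<in>{1..m}. \<exists>k\<in>{1..m}. \<exists>s\<in>S. \<exists>h1\<in>H. \<exists>h2\<in>H.
         t = balanced_class G H S act (r i) s \<and>
         g1 \<otimes>\<^bsub>G\<^esub> r j = r i \<otimes>\<^bsub>G\<^esub> h1 \<and> g2 \<otimes>\<^bsub>G\<^esub> r k = r j \<otimes>\<^bsub>G\<^esub> h2 \<and>
         z = c (h1, h2) s)"

end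

theory Submission
  imports Defs "HOL-Library.Groups_Big_Fun"
begin

text \<open>
  All 2-matrices in sight are monomial: each entry is a line or zero.  A 2-morphism between two
  of them is therefore determined by its values on generators, and every coherence condition
  reduces to an identity of scalars, namely the cocycle identity of \<open>c\<close>.  The induced
  2-representation and the one given by \<open>G \<times>\<^sub>H S\<close> and \<open>ind c\<close> agree entry by entry, because
  \<open>g [r\<^sub>j, t] = [r\<^sub>i, s]\<close> holds if and only if \<open>g r\<^sub>j = r\<^sub>i h\<close> and \<open>s = h t\<close> for some \<open>h\<close> in \<open>H\<close>.

  For Shapiro's lemma, cochains are written homogeneously, as \<open>H\<close>-equivariant functions on tuples
  from \<open>G\<close> or from \<open>H\<close>.  Restriction and pullback along the \<open>H\<close>-equivariant map \<open>\<pi> : G \<rightarrow> H\<close>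
  with \<open>\<pi>(h r\<^sub>i\<^sup>-\<^sup>1) = h\<close> are inverse to each other on cohomology, by the prism homotopy
  \<open>f(x, \<pi> x, \<pi> y) f(x, y, \<pi> y)\<^sup>-\<^sup>1\<close>, and the pullback of \<open>c\<close> is \<open>ind c\<close>.
\<close>

section \<open>Lines and zero spaces\<close>

text \<open>Associators, maps out of tensor products (hence the unitors) and the unit of the induced
  2-representation are all given by \<open>THE\<close>, so existence and uniqueness must be settled
  before anything can be computed with them. General multilinear algebra is avoided: every entry
  that occurs, also in iterated composites, is a zero space or free on one explicit vector, and such
  spaces are closed under tensor products and under direct sums with at most one nonzero summand. A
  linear map out of such a space is fixed by at most one value, which settles each description. The
  two 2-representations are compared by literal equality, so the enumeration of
  \<open>G \<times>\<^sub>H S\<close> has to follow the block order of the induction, and the values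
  off the permutation pattern have to match as well. Shapiro's isomorphism is given as the inverse
  of restriction, so restriction must be shown bijective. The inverses
  \<open>r\<^sub>i\<^sup>-\<^sup>1\<close> in \<pi> arise because the left cosets
  \<open>r\<^sub>i H\<close> invert to the orbits \<open>H r\<^sub>i\<^sup>-\<^sup>1\<close> of left
  translation by \<open>H\<close>, on which \<open>H\<close> acts freely.\<close>

definition line :: "'v vec_space \<Rightarrow> 'v \<Rightarrow> bool"
  where "line V v \<longleftrightarrow>
    inj (\<lambda>a. a \<odot>\<^bsub>V\<^esub> v) \<and> carrier V = range (\<lambda>a. a \<odot>\<^bsub>V\<^esub> v) \<and> 1 \<odot>\<^bsub>V\<^esub> v = v \<and> 0 \<odot>\<^bsub>V\<^esub> v = \<zero>\<^bsub>V\<^esub> \<and>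
    (\<forall>a b. (a \<odot>\<^bsub>V\<^esub> v) \<oplus>\<^bsub>V\<^esub> (b \<odot>\<^bsub>V\<^esub> v) = (a + b) \<odot>\<^bsub>V\<^esub> v) \<and>
    (\<forall>a b. a \<odot>\<^bsub>V\<^esub> (b \<odot>\<^bsub>V\<^esub> v) = (a * b) \<odot>\<^bsub>V\<^esub> v)"

definition null_space :: "'v vec_space \<Rightarrow> bool"
  where "null_space V \<longleftrightarrow>
    carrier V = {\<zero>\<^bsub>V\<^esub>} \<and> \<zero>\<^bsub>V\<^esub> \<oplus>\<^bsub>V\<^esub> \<zero>\<^bsub>V\<^esub> = \<zero>\<^bsub>V\<^esub> \<and> (\<forall>a. a \<odot>\<^bsub>V\<^esub> \<zero>\<^bsub>V\<^esub> = \<zero>\<^bsub>V\<^esub>)"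

text \<open>The class in which all entries live. Zero spaces belong to it because entries off the
  permutation pattern, and all tensor products with them, are zero.\<close>

definition thin :: "'v vec_space \<Rightarrow> bool"
  where "thin V \<longleftrightarrow> null_space V \<or> (\<exists>v. line V v)"

lemma line_thin: "line V v \<Longrightarrow> thin V"
  and null_space_thin: "null_space V \<Longrightarrow> thin V"
  by (auto simp: thin_def)

lemma line_mem: "line V v \<Longrightarrow> a \<odot>\<^bsub>V\<^esub> v \<in> carrier V"
  by (auto simp: line_def)

lemma line_gen_mem: "line V v \<Longrightarrow> v \<in> carrier V"
  by (metis line_def line_mem)

lemma line_cases:
  assumes "line V v" "x \<in> carrier V"
  obtains a where "x = a \<odot>\<^bsub>V\<^esub> v"
  using assms unfolding line_def by blast

lemma line_inj: "line V v \<Longrightarrow> a \<odot>\<^bsub>V\<^esub> v = b \<odot>\<^bsub>V\<^esub> v \<longleftrightarrow> a = b"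
  by (auto simp: line_def inj_def)

lemma thin_closed:
  assumes "thin V" "x \<in> carrier V"
  shows thin_smult_closed: "a \<odot>\<^bsub>V\<^esub> x \<in> carrier V"
    and thin_zero_smult: "0 \<odot>\<^bsub>V\<^esub> x = \<zero>\<^bsub>V\<^esub>"
    and thin_one_smult: "1 \<odot>\<^bsub>V\<^esub> x = x"
    and thin_smult_smult: "a \<odot>\<^bsub>V\<^esub> (b \<odot>\<^bsub>V\<^esub> x) = (a * b) \<odot>\<^bsub>V\<^esub> x"
    and thin_smult_add: "(a \<odot>\<^bsub>V\<^esub> x) \<oplus>\<^bsub>V\<^esub> (b \<odot>\<^bsub>V\<^esub> x) = (a + b) \<odot>\<^bsub>V\<^esub> x"
  using assms unfolding thin_def
  by (auto simp: null_space_def line_def distrib_right mult.assoc)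

lemma thin_zero_closed: "thin V \<Longrightarrow> \<zero>\<^bsub>V\<^esub> \<in> carrier V"
  unfolding thin_def null_space_def line_def by (metis rangeI singletonI)

lemma thin_smult_zero: "thin V \<Longrightarrow> a \<odot>\<^bsub>V\<^esub> \<zero>\<^bsub>V\<^esub> = \<zero>\<^bsub>V\<^esub>"
  by (metis mult_zero_right thin_smult_smult thin_zero_closed thin_zero_smult)

lemma thin_add_closed:
  assumes "thin V" "x \<in> carrier V" "y \<in> carrier V"
  shows "x \<oplus>\<^bsub>V\<^esub> y \<in> carrier V"
  using assms unfolding thin_def
  by (auto simp: null_space_def line_def)

lemma thin_zero_add_zero: "thin V \<Longrightarrow> \<zero>\<^bsub>V\<^esub> \<oplus>\<^bsub>V\<^esub> \<zero>\<^bsub>V\<^esub> = \<zero>\<^bsub>V\<^esub>"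
  by (metis add_0 thin_smult_add thin_zero_closed thin_zero_smult)

lemma null_space_mem: "null_space V \<Longrightarrow> x \<in> carrier V \<longleftrightarrow> x = \<zero>\<^bsub>V\<^esub>"
  by (auto simp: null_space_def)

lemma line_ground_space: "line ground_space 1"
  by (auto simp: line_def ground_space_def inj_def algebra_simps)

lemma null_space_zero_space: "null_space zero_space"
  by (auto simp: null_space_def zero_space_def)

subsection \<open>Linear maps\<close>

lemma linI:
  assumes "f \<in> carrier V \<rightarrow>\<^sub>E carrier W"
    and "\<And>x y. x \<in> carrier V \<Longrightarrow> y \<in> carrier V \<Longrightarrow> f (x \<oplus>\<^bsub>V\<^esub> y) = f x \<oplus>\<^bsub>W\<^esub> f y"
    and "\<And>a x. x \<in> carrier V \<Longrightarrow> f (a \<odot>\<^bsub>V\<^esub> x) = a \<odot>\<^bsub>W\<^esub> f x"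
  shows "f \<in> lin V W"
  using assms by (auto simp: lin_def)

lemma lin_mem: "f \<in> lin V W \<Longrightarrow> x \<in> carrier V \<Longrightarrow> f x \<in> carrier W"
  and lin_add: "f \<in> lin V W \<Longrightarrow> x \<in> carrier V \<Longrightarrow> y \<in> carrier V \<Longrightarrow> f (x \<oplus>\<^bsub>V\<^esub> y) = f x \<oplus>\<^bsub>W\<^esub> f y"
  and lin_smult: "f \<in> lin V W \<Longrightarrow> x \<in> carrier V \<Longrightarrow> f (a \<odot>\<^bsub>V\<^esub> x) = a \<odot>\<^bsub>W\<^esub> f x"
  and lin_ext: "f \<in> lin V W \<Longrightarrow> f \<in> extensional (carrier V)"
  by (auto simp: lin_def PiE_def)

text \<open>\<open>lin\<close> asks for additivity and homogeneity only, so zero is reached as 0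
  times itself and the scalar 0 is pulled through \<open>f\<close>.\<close>

lemma lin_zero:
  assumes "f \<in> lin V W" "thin V" "thin W"
  shows "f \<zero>\<^bsub>V\<^esub> = \<zero>\<^bsub>W\<^esub>"
  using lin_smult[OF assms(1) thin_zero_closed[OF assms(2)], of 0]
    lin_mem[OF assms(1) thin_zero_closed[OF assms(2)]] assms
  by (simp add: thin_zero_smult thin_zero_closed)

lemma lin_compose:
  assumes "thin V" "f \<in> lin V W" "g \<in> lin W U"
  shows "compose (carrier V) g f \<in> lin V U"
  using assms by (intro linI)
    (auto simp: compose_def lin_mem lin_add lin_smult thin_add_closed thin_smult_closed)

lemma lin_id: "thin V \<Longrightarrow> (\<lambda>x\<in>carrier V. x) \<in> lin V V"
  by (intro linI) (auto simp: thin_add_closed thin_smult_closed)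

lemma lin_eqI_line:
  assumes "line V v" "f \<in> lin V W" "g \<in> lin V W" "f v = g v"
  shows "f = g"
proof (rule extensionalityI[OF lin_ext lin_ext])
  fix x assume "x \<in> carrier V"
  then obtain a where "x = a \<odot>\<^bsub>V\<^esub> v" by (rule line_cases[OF assms(1)])
  then show "f x = g x"
    using assms line_gen_mem[OF assms(1)] by (simp add: lin_smult[of _ V W])
qed (use assms in auto)

lemma lin_eqI_null:
  assumes "null_space V" "thin W" "f \<in> lin V W" "g \<in> lin V W"
  shows "f = g"
proof (rule extensionalityI[OF lin_ext lin_ext])
  show "f x = g x" if "x \<in> carrier V" for x
    using that lin_zero[OF assms(3) null_space_thin[OF assms(1)] assms(2)]
      lin_zero[OF assms(4) null_space_thin[OF assms(1)] assms(2)] assms(1)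
    by (simp add: null_space_mem)
qed (use assms in auto)

lemma lin_zero_map:
  assumes "thin V" "thin W"
  shows "(\<lambda>x\<in>carrier V. \<zero>\<^bsub>W\<^esub>) \<in> lin V W"
  using assms by (intro linI) (auto simp: thin_zero_closed thin_add_closed thin_smult_closed
      thin_zero_add_zero thin_smult_zero)

text \<open>This is the coordinate functional dual to \<open>v\<close>; injectivity of scaling makes
  the description \<open>THE k\<close> single-valued. It serves to define maps out of a line and, in
  pairs, a functional on a tensor product of two lines.\<close>

lemma line_coord:
  assumes v: "line V v"
  obtains a where "\<And>k. a (k \<odot>\<^bsub>V\<^esub> v) = k"
    and "\<And>x y. x \<in> carrier V \<Longrightarrow> y \<in> carrier V \<Longrightarrow> a (x \<oplus>\<^bsub>V\<^esub> y) = a x + a y"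
    and "\<And>k x. x \<in> carrier V \<Longrightarrow> a (k \<odot>\<^bsub>V\<^esub> x) = k * a x"
proof -
  define a where "a x = (THE k. x = k \<odot>\<^bsub>V\<^esub> v)" for x
  have a: "a (k \<odot>\<^bsub>V\<^esub> v) = k" for k
    by (auto simp: a_def line_inj[OF v])
  have "a (x \<oplus>\<^bsub>V\<^esub> y) = a x + a y" if xy: "x \<in> carrier V" "y \<in> carrier V" for x y
  proof -
    obtain k where k: "x = k \<odot>\<^bsub>V\<^esub> v" by (rule line_cases[OF v xy(1)])
    obtain l where l: "y = l \<odot>\<^bsub>V\<^esub> v" by (rule line_cases[OF v xy(2)])
    have "x \<oplus>\<^bsub>V\<^esub> y = (k + l) \<odot>\<^bsub>V\<^esub> v" unfolding k l using v by (simp add: line_def)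
    then show ?thesis by (simp only: k l a)
  qed
  moreover have "a (k \<odot>\<^bsub>V\<^esub> x) = k * a x" if x: "x \<in> carrier V" for k x
  proof -
    obtain l where l: "x = l \<odot>\<^bsub>V\<^esub> v" by (rule line_cases[OF v x])
    have "k \<odot>\<^bsub>V\<^esub> x = (k * l) \<odot>\<^bsub>V\<^esub> v" unfolding l using v by (simp add: line_def)
    then show ?thesis by (simp only: l a)
  qed
  ultimately show thesis using that a by blast
qed

text \<open>A line is free on its generator: a vector is sent to its coordinate times
  \<open>w\<close>.\<close>

lemma lin_line_ex:
  assumes v: "line V v" and W: "thin W" and w: "w \<in> carrier W"
  shows "\<exists>f\<in>lin V W. f v = w"
proof -
  obtain a where a: "\<And>k. a (k \<odot>\<^bsub>V\<^esub> v) = k"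
    and add: "\<And>x y. x \<in> carrier V \<Longrightarrow> y \<in> carrier V \<Longrightarrow> a (x \<oplus>\<^bsub>V\<^esub> y) = a x + a y"
    and smult: "\<And>k x. x \<in> carrier V \<Longrightarrow> a (k \<odot>\<^bsub>V\<^esub> x) = k * a x"
    using v by (rule line_coord) blast
  have "(\<lambda>x\<in>carrier V. a x \<odot>\<^bsub>W\<^esub> w) \<in> lin V W"
    using W w line_thin[OF v]
    by (intro linI) (auto simp: add smult thin_smult_closed thin_add_closed thin_smult_add thin_smult_smult)
  moreover have "a v = 1" using a[of 1] v by (simp add: line_def)
  ultimately show ?thesis
    using W w line_gen_mem[OF v] by (intro bexI) (auto simp: thin_one_smult)
qed

subsection \<open>Direct sums\<close>

lemma direct_sum_simps:
  "carrier (direct_sum I V) = (\<Pi>\<^sub>E j\<in>I. carrier (V j))"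
  "\<zero>\<^bsub>direct_sum I V\<^esub> = (\<lambda>j\<in>I. \<zero>\<^bsub>V j\<^esub>)"
  "x \<oplus>\<^bsub>direct_sum I V\<^esub> y = (\<lambda>j\<in>I. x j \<oplus>\<^bsub>V j\<^esub> y j)"
  "a \<odot>\<^bsub>direct_sum I V\<^esub> x = (\<lambda>j\<in>I. a \<odot>\<^bsub>V j\<^esub> x j)"
  by (auto simp: direct_sum_def)

lemma null_space_direct_sum:
  assumes "\<And>j. j \<in> I \<Longrightarrow> null_space (V j)"
  shows "null_space (direct_sum I V)"
  using assms unfolding null_space_def direct_sum_simps
  by (auto simp: fun_eq_iff PiE_def extensional_def Pi_def restrict_def)

lemma summand_inj_smult:
  assumes "\<And>j. j \<in> I \<Longrightarrow> thin (V j)"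
  shows "summand_inj I V k (a \<odot>\<^bsub>V k\<^esub> x) = a \<odot>\<^bsub>direct_sum I V\<^esub> summand_inj I V k x"
  using assms by (auto simp: summand_inj_def direct_sum_simps fun_eq_iff thin_smult_zero)

lemma summand_inj_mem:
  assumes "\<And>j. j \<in> I \<Longrightarrow> thin (V j)" "k \<in> I \<Longrightarrow> x \<in> carrier (V k)"
  shows "summand_inj I V k x \<in> carrier (direct_sum I V)"
  using assms by (auto simp: summand_inj_def direct_sum_simps thin_zero_closed)

text \<open>Zero summands contribute only their zero vector, so a vector of the sum is determined by
  its \<open>k\<close>-th component and the inclusion of that summand is bijective.\<close>

lemma line_direct_sum:
  assumes k: "k \<in> I" "line (V k) v" and null: "\<And>j. j \<in> I \<Longrightarrow> j \<noteq> k \<Longrightarrow> null_space (V j)"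
  shows "line (direct_sum I V) (summand_inj I V k v)"
proof -
  let ?D = "direct_sum I V"
  have thin: "thin (V j)" if "j \<in> I" for j
    using that k null by (cases "j = k") (auto simp: thin_def)
  note sm = summand_inj_smult[of I V, OF thin, symmetric]
  have bij: "bij_betw (\<lambda>a. summand_inj I V k (a \<odot>\<^bsub>V k\<^esub> v)) UNIV (carrier ?D)"
  proof (rule bij_betwI')
    show "(summand_inj I V k (x \<odot>\<^bsub>V k\<^esub> v) = summand_inj I V k (y \<odot>\<^bsub>V k\<^esub> v)) = (x = y)" for x y
    proof
      assume "summand_inj I V k (x \<odot>\<^bsub>V k\<^esub> v) = summand_inj I V k (y \<odot>\<^bsub>V k\<^esub> v)"
      then have "summand_inj I V k (x \<odot>\<^bsub>V k\<^esub> v) k = summand_inj I V k (y \<odot>\<^bsub>V k\<^esub> v) k" by simp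
      then show "x = y" using k by (simp add: summand_inj_def line_inj)
    qed simp
    show "summand_inj I V k (x \<odot>\<^bsub>V k\<^esub> v) \<in> carrier ?D" for x
      using k thin by (auto intro!: summand_inj_mem line_mem)
    show "\<exists>a\<in>UNIV. y = summand_inj I V k (a \<odot>\<^bsub>V k\<^esub> v)" if y: "y \<in> carrier ?D" for y
    proof -
      have "y k \<in> carrier (V k)" using y k by (auto simp: direct_sum_simps)
      then obtain a where a: "y k = a \<odot>\<^bsub>V k\<^esub> v" using line_cases[OF k(2)] by metis
      have "y j = \<zero>\<^bsub>V j\<^esub>" if "j \<in> I" "j \<noteq> k" for j
        using y null that by (auto simp: direct_sum_simps null_space_mem PiE_def Pi_def)
      then have "y = summand_inj I V k (a \<odot>\<^bsub>V k\<^esub> v)"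
        using y a k by (auto simp: direct_sum_simps summand_inj_def fun_eq_iff PiE_def extensional_def)
      then show ?thesis by blast
    qed
  qed
  have "0 \<odot>\<^bsub>?D\<^esub> summand_inj I V k v = \<zero>\<^bsub>?D\<^esub>"
    using k thin by (auto simp: sm) (auto simp: summand_inj_def direct_sum_simps line_def)
  moreover have "1 \<odot>\<^bsub>?D\<^esub> summand_inj I V k v = summand_inj I V k v"
    using k by (simp add: sm line_def)
  moreover have "(a \<odot>\<^bsub>?D\<^esub> summand_inj I V k v) \<oplus>\<^bsub>?D\<^esub> (b \<odot>\<^bsub>?D\<^esub> summand_inj I V k v)
      = (a + b) \<odot>\<^bsub>?D\<^esub> summand_inj I V k v" for a b
    using k thin by (auto simp: sm)
      (auto simp: summand_inj_def direct_sum_simps line_def fun_eq_iff thin_zero_add_zero)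
  moreover have "a \<odot>\<^bsub>?D\<^esub> (b \<odot>\<^bsub>?D\<^esub> summand_inj I V k v) = (a * b) \<odot>\<^bsub>?D\<^esub> summand_inj I V k v" for a b
    using k by (auto simp: sm line_def)
  ultimately show ?thesis
    using bij by (simp add: line_def sm bij_betw_def)
qed

lemma lin_direct_sum_map:
  assumes "\<And>j. j \<in> I \<Longrightarrow> thin (V j)" and f: "\<And>j. j \<in> I \<Longrightarrow> f j \<in> lin (V j) (W j)"
  shows "(\<lambda>x\<in>carrier (direct_sum I V). \<lambda>j\<in>I. f j (x j)) \<in> lin (direct_sum I V) (direct_sum I W)"
  using assms(1)
  by (intro linI)
    (auto simp: direct_sum_simps PiE_def Pi_def fun_eq_iff extensional_def thin_add_closed
      thin_smult_closed lin_add[OF f] lin_smult[OF f] lin_mem[OF f])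

lemma lin_direct_sum_proj:
  assumes "\<And>j. j \<in> I \<Longrightarrow> thin (V j)" and k: "k \<in> I" and f: "f \<in> lin (V k) W"
  shows "(\<lambda>x\<in>carrier (direct_sum I V). f (x k)) \<in> lin (direct_sum I V) W"
  using assms(1) k
  by (intro linI)
    (auto simp: direct_sum_simps PiE_def Pi_def fun_eq_iff extensional_def thin_add_closed
      thin_smult_closed lin_add[OF f] lin_smult[OF f] lin_mem[OF f])

subsection \<open>Tensor products\<close>

lemma tensor_null_minus:
  "f \<in> tensor_null V W \<Longrightarrow> g \<in> tensor_null V W \<Longrightarrow> (\<lambda>p. f p - g p) \<in> tensor_null V W"
  using null_add[OF _ null_smult[of g V W "- 1"], of f] by simp

lemma null_coset_eq_iff:
  "null_coset V W f = null_coset V W g \<longleftrightarrow> (\<lambda>p. f p - g p) \<in> tensor_null V W"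
proof
  assume "null_coset V W f = null_coset V W g"
  moreover have "f \<in> null_coset V W f"
    using null_zero by (force simp: null_coset_def)
  ultimately obtain n where n: "n \<in> tensor_null V W" "f = (\<lambda>p. g p + n p)"
    by (auto simp: null_coset_def)
  then show "(\<lambda>p. f p - g p) \<in> tensor_null V W" by simp
next
  assume d: "(\<lambda>p. f p - g p) \<in> tensor_null V W"
  have "\<exists>n'\<in>tensor_null V W. (\<lambda>p. f p + n p) = (\<lambda>p. g p + n' p)" if "n \<in> tensor_null V W" for n
    using null_add[OF d that] by (intro bexI[of _ "\<lambda>p. f p - g p + n p"]) auto
  moreover have "\<exists>n'\<in>tensor_null V W. (\<lambda>p. g p + n p) = (\<lambda>p. f p + n' p)"
    if "n \<in> tensor_null V W" for n
    using tensor_null_minus[OF that d] by (intro bexI[of _ "\<lambda>p. n p - (f p - g p)"]) auto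
  ultimately show "null_coset V W f = null_coset V W g"
    unfolding null_coset_def by blast
qed

lemma tensor_carrier:
  "carrier (tensor V W) = null_coset V W ` free_space (carrier V) (carrier W)"
  by (simp add: tensor_def)

lemma tensor_zero: "\<zero>\<^bsub>tensor V W\<^esub> = null_coset V W (\<lambda>p. 0)"
  by (simp add: tensor_def null_coset_def)

lemma tensor_add:
  "null_coset V W f \<oplus>\<^bsub>tensor V W\<^esub> null_coset V W g = null_coset V W (\<lambda>p. f p + g p)"
proof (intro Set.set_eqI iffI)
  fix x assume "x \<in> null_coset V W f \<oplus>\<^bsub>tensor V W\<^esub> null_coset V W g"
  then obtain n n' where n: "n \<in> tensor_null V W" "n' \<in> tensor_null V W"
      "x = (\<lambda>p. (f p + n p) + (g p + n' p))"
    by (auto simp: tensor_def null_coset_def)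
  then have "x = (\<lambda>p. (f p + g p) + (n p + n' p))" by (simp add: algebra_simps)
  then show "x \<in> null_coset V W (\<lambda>p. f p + g p)"
    using null_add[OF n(1,2)] by (auto simp: null_coset_def)
next
  fix x assume "x \<in> null_coset V W (\<lambda>p. f p + g p)"
  then obtain n where n: "n \<in> tensor_null V W" "x = (\<lambda>p. (f p + n p) + (g p + 0))"
    by (auto simp: null_coset_def algebra_simps)
  then have "(\<lambda>p. f p + n p) \<in> null_coset V W f" "(\<lambda>p. g p + 0) \<in> null_coset V W g"
    using null_zero by (force simp: null_coset_def)+
  then show "x \<in> null_coset V W f \<oplus>\<^bsub>tensor V W\<^esub> null_coset V W g"
    unfolding n(2)
    by (simp add: tensor_def) (rule exI[of _ "\<lambda>p. f p + n p"], rule exI[of _ g], simp)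
qed

lemma tensor_smult:
  "a \<odot>\<^bsub>tensor V W\<^esub> null_coset V W f = null_coset V W (\<lambda>p. a * f p)"
proof (intro Set.set_eqI iffI)
  fix x assume "x \<in> a \<odot>\<^bsub>tensor V W\<^esub> null_coset V W f"
  then obtain n n' where n: "n \<in> tensor_null V W" "n' \<in> tensor_null V W"
      "x = (\<lambda>p. a * (f p + n p) + n' p)"
    by (auto simp: tensor_def null_coset_def)
  then have "x = (\<lambda>p. a * f p + (a * n p + n' p))" by (simp add: algebra_simps)
  then show "x \<in> null_coset V W (\<lambda>p. a * f p)"
    using null_add[OF null_smult[OF n(1)] n(2)] by (auto simp: null_coset_def)
next
  fix x assume "x \<in> null_coset V W (\<lambda>p. a * f p)"
  then obtain n where n: "n \<in> tensor_null V W" "x = (\<lambda>p. a * (f p + 0) + n p)"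
    by (auto simp: null_coset_def algebra_simps)
  then have "(\<lambda>p. f p + 0) \<in> null_coset V W f"
    using null_zero by (force simp: null_coset_def)
  then show "x \<in> a \<odot>\<^bsub>tensor V W\<^esub> null_coset V W f"
    unfolding n(2) using n(1)
    by (simp add: tensor_def) (rule exI[of _ f], rule exI[of _ n], simp)
qed

lemma free_gen_mem: "v \<in> A \<Longrightarrow> w \<in> B \<Longrightarrow> free_gen v w \<in> free_space A B"
  by (auto simp: free_gen_def free_space_def)

lemma tens_mem: "v \<in> carrier V \<Longrightarrow> w \<in> carrier W \<Longrightarrow> tens V W v w \<in> carrier (tensor V W)"
  by (auto simp: tens_def tensor_carrier free_gen_mem)

lemma tens_smult_left:
  "v \<in> carrier V \<Longrightarrow> w \<in> carrier W \<Longrightarrow>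
    tens V W (a \<odot>\<^bsub>V\<^esub> v) w = a \<odot>\<^bsub>tensor V W\<^esub> tens V W v w"
  unfolding tens_def tensor_smult null_coset_eq_iff by (rule smult_left)

lemma tens_smult_right:
  "v \<in> carrier V \<Longrightarrow> w \<in> carrier W \<Longrightarrow>
    tens V W v (a \<odot>\<^bsub>W\<^esub> w) = a \<odot>\<^bsub>tensor V W\<^esub> tens V W v w"
  unfolding tens_def tensor_smult null_coset_eq_iff by (rule smult_right)

text \<open>Induction on the finite support: removing a point \<open>q\<close> leaves
  \<open>f(q := 0)\<close>, and the difference is \<open>f q\<close> times the generator at
  \<open>q\<close>.\<close>

lemma free_space_induct [consumes 1, case_names zero add gen]:
  assumes f: "f \<in> free_space A B"
    and zero: "Q (\<lambda>p. 0)"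
    and add: "\<And>f g. Q f \<Longrightarrow> Q g \<Longrightarrow> Q (\<lambda>p. f p + g p)"
    and gen: "\<And>a v w. v \<in> A \<Longrightarrow> w \<in> B \<Longrightarrow> Q (\<lambda>p. a * free_gen v w p)"
  shows "Q f"
proof -
  have "Q f" if "finite S" "{p. f p \<noteq> 0} = S" "S \<subseteq> A \<times> B" for S f
    using that
  proof (induction S arbitrary: f rule: finite_induct)
    case empty
    then have "f = (\<lambda>p. 0)" by auto
    then show ?case using zero by simp
  next
    case (insert q S)
    let ?g = "f(q := 0)"
    have "Q ?g"
      using insert by (intro insert.IH) (auto split: if_splits)
    moreover have "Q (\<lambda>p. f q * free_gen (fst q) (snd q) p)"
      using insert by (intro gen) auto
    moreover have "f = (\<lambda>p. ?g p + f q * free_gen (fst q) (snd q) p)"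
      by (auto simp: free_gen_def)
    ultimately show ?case using add by metis
  qed
  then show ?thesis using f by (auto simp: free_space_def)
qed

text \<open>Pure tensors span: if every generator lies in the subspace of relations, so does every
  finitely supported function.\<close>

lemma tensor_elt_eq_zero:
  assumes "\<And>v w. v \<in> carrier V \<Longrightarrow> w \<in> carrier W \<Longrightarrow> tens V W v w = \<zero>\<^bsub>tensor V W\<^esub>"
    and "x \<in> carrier (tensor V W)"
  shows "x = \<zero>\<^bsub>tensor V W\<^esub>"
proof -
  obtain f where f: "f \<in> free_space (carrier V) (carrier W)" "x = null_coset V W f"
    using assms(2) by (auto simp: tensor_carrier)
  have "f \<in> tensor_null V W"
    using f(1)
  proof (induction rule: free_space_induct)
    case (gen a v w)
    then have "free_gen v w \<in> tensor_null V W"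
      using assms(1)[of v w] by (simp add: tens_def tensor_zero null_coset_eq_iff)
    then show ?case by (rule null_smult)
  qed (auto intro: null_zero null_add)
  then show ?thesis by (simp add: f(2) tensor_zero null_coset_eq_iff)
qed

lemma null_space_tensorI:
  assumes "carrier V \<noteq> {}" "carrier W \<noteq> {}"
    and "\<And>v w. v \<in> carrier V \<Longrightarrow> w \<in> carrier W \<Longrightarrow> tens V W v w = \<zero>\<^bsub>tensor V W\<^esub>"
  shows "null_space (tensor V W)"
proof -
  have "carrier (tensor V W) = {\<zero>\<^bsub>tensor V W\<^esub>}"
    using assms tens_mem[of _ V _ W] tensor_elt_eq_zero[OF assms(3)] by fastforce
  then show ?thesis
    by (auto simp: null_space_def tensor_zero tensor_add tensor_smult)
qed

lemma tens_zero:
  "v \<in> carrier V \<Longrightarrow> w \<in> carrier W \<Longrightarrow> 0 \<odot>\<^bsub>tensor V W\<^esub> tens V W v w = \<zero>\<^bsub>tensor V W\<^esub>"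
  by (simp add: tens_def tensor_smult tensor_zero)

text \<open>In a zero space \<open>v\<close> equals 0 times \<open>v\<close>, and the scalar 0 moves
  out of the pure tensor.\<close>

lemma null_space_tensor_left:
  assumes "null_space V" "thin W"
  shows "null_space (tensor V W)"
proof (rule null_space_tensorI)
  fix v w assume "v \<in> carrier V" "w \<in> carrier W"
  then show "tens V W v w = \<zero>\<^bsub>tensor V W\<^esub>"
    using assms tens_smult_left[of v V w W 0] tens_zero[of v V w W]
    by (simp add: null_space_def)
qed (use assms in \<open>auto simp: null_space_def dest: thin_zero_closed\<close>)

lemma null_space_tensor_right:
  assumes "thin V" "null_space W"
  shows "null_space (tensor V W)"
proof (rule null_space_tensorI)
  fix v w assume "v \<in> carrier V" "w \<in> carrier W"
  then show "tens V W v w = \<zero>\<^bsub>tensor V W\<^esub>"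
    using assms tens_smult_right[of v V w W 0] tens_zero[of v V w W]
    by (simp add: null_space_def)
qed (use assms in \<open>auto simp: null_space_def dest: thin_zero_closed\<close>)

text \<open>Bilinearity shows that the tensor of the generators spans. It is nonzero because the
  product of the two coordinate functionals extends to a functional \<open>L\<close> on the free
  space which kills every bilinearity relation but takes the value 1 on this generator.\<close>

lemma line_tensor:
  assumes v: "line V v" and w: "line W w"
  shows "line (tensor V W) (tens V W v w)"
proof -
  let ?T = "tensor V W" and ?t = "tens V W v w"
  obtain a where a: "\<And>k. a (k \<odot>\<^bsub>V\<^esub> v) = k"
    and aadd: "\<And>x y. x \<in> carrier V \<Longrightarrow> y \<in> carrier V \<Longrightarrow> a (x \<oplus>\<^bsub>V\<^esub> y) = a x + a y"
    and asm: "\<And>k x. x \<in> carrier V \<Longrightarrow> a (k \<odot>\<^bsub>V\<^esub> x) = k * a x"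
    using v by (rule line_coord) blast
  obtain b where b: "\<And>k. b (k \<odot>\<^bsub>W\<^esub> w) = k"
    and badd: "\<And>x y. x \<in> carrier W \<Longrightarrow> y \<in> carrier W \<Longrightarrow> b (x \<oplus>\<^bsub>W\<^esub> y) = b x + b y"
    and bsm: "\<And>k x. x \<in> carrier W \<Longrightarrow> b (k \<odot>\<^bsub>W\<^esub> x) = k * b x"
    using w by (rule line_coord) blast
  define L where "L f = Sum_any (\<lambda>p. f p * (a (fst p) * b (snd p)))" for f
  define fin where "fin f \<longleftrightarrow> finite {p. f p \<noteq> (0::complex)}" for f :: "'a \<times> 'b \<Rightarrow> complex"
  have fin_gen: "fin (free_gen x y)" for x y
    by (auto simp: fin_def free_gen_def)
  have fin_add: "fin (\<lambda>p. f p + g p)" if "fin f" "fin g" for f g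
    using that unfolding fin_def
    by (auto intro: finite_subset[of _ "{p. f p \<noteq> 0} \<union> {p. g p \<noteq> 0}"])
  have fin_smult: "fin (\<lambda>p. k * f p)" if "fin f" for k f
    using that unfolding fin_def by (auto elim: finite_subset[rotated])
  have fin_minus: "fin (\<lambda>p. f p - g p)" if "fin f" "fin g" for f g
    using fin_add[OF that(1) fin_smult[OF that(2), of "-1"]] by simp
  have fin_mult: "finite {p. f p * h p \<noteq> 0}" if "fin f" for f h
    using that unfolding fin_def by (auto elim: finite_subset[rotated])
  have L_add: "L (\<lambda>p. f p + g p) = L f + L g" if "fin f" "fin g" for f g
    unfolding L_def distrib_right using that by (intro Sum_any.distrib fin_mult)
  have L_smult: "L (\<lambda>p. k * f p) = k * L f" if "fin f" for f k
    unfolding L_def mult.assoc using that by (intro Sum_any_right_distrib[symmetric] fin_mult)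
  have L_minus: "L (\<lambda>p. f p - g p) = L f - L g" if "fin f" "fin g" for f g
    using L_add[OF that(1) fin_smult[OF that(2), of "-1"]] L_smult[OF that(2), of "-1"] by simp
  have L_gen: "L (free_gen x y) = a x * b y" for x y
  proof -
    have "L (free_gen x y) = Sum_any (\<lambda>p. if p = (x, y) then a x * b y else 0)"
      unfolding L_def free_gen_def by (rule arg_cong[of _ _ Sum_any]) auto
    then show ?thesis by simp
  qed
  \<comment> \<open>Finiteness of the support is carried through the induction together with
    \<open>L f = 0\<close>, since \<open>Sum_any\<close> is additive only on functions of finite
    support.\<close>
  have L_null: "fin f \<and> L f = 0" if "f \<in> tensor_null V W" for f
    using that
  proof induction
    case null_zero
    then show ?case by (simp add: fin_def L_def)
  qed (auto simp: fin_add fin_smult fin_minus fin_gen L_add L_smult L_minus L_gen aadd badd asm bsm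
      algebra_simps)
  have mem: "v \<in> carrier V" "w \<in> carrier W" using v w by (auto simp: line_gen_mem)
  have smt: "k \<odot>\<^bsub>?T\<^esub> ?t = null_coset V W (\<lambda>p. k * free_gen v w p)" for k
    by (simp add: tens_def tensor_smult)
  have span: "\<exists>k. (\<lambda>p. f p - k * free_gen v w p) \<in> tensor_null V W"
    if "f \<in> free_space (carrier V) (carrier W)" for f
    using that
  proof (induction rule: free_space_induct)
    case zero
    show ?case by (rule exI[of _ 0]) (simp add: null_zero)
  next
    case (add f g)
    then obtain k l where "(\<lambda>p. f p - k * free_gen v w p) \<in> tensor_null V W"
        "(\<lambda>p. g p - l * free_gen v w p) \<in> tensor_null V W" by blast
    from null_add[OF this] show ?case
      by (intro exI[of _ "k + l"]) (simp add: algebra_simps)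
  next
    case (gen c x y)
    obtain k where k: "x = k \<odot>\<^bsub>V\<^esub> v" by (rule line_cases[OF v gen(1)])
    obtain l where l: "y = l \<odot>\<^bsub>W\<^esub> w" by (rule line_cases[OF w gen(2)])
    have "c \<odot>\<^bsub>?T\<^esub> tens V W x y = (c * (k * l)) \<odot>\<^bsub>?T\<^esub> ?t"
      unfolding k l using mem
      by (simp add: tens_smult_left tens_smult_right line_mem[OF w])
        (simp add: tens_def tensor_smult mult.assoc)
    then show ?case
      by (intro exI[of _ "c * (k * l)"]) (simp add: tens_def tensor_smult null_coset_eq_iff)
  qed
  have bij: "bij_betw (\<lambda>k. k \<odot>\<^bsub>?T\<^esub> ?t) UNIV (carrier ?T)"
  proof (rule bij_betwI')
    show "(k \<odot>\<^bsub>?T\<^esub> ?t = l \<odot>\<^bsub>?T\<^esub> ?t) = (k = l)" for k l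
    proof
      assume "k \<odot>\<^bsub>?T\<^esub> ?t = l \<odot>\<^bsub>?T\<^esub> ?t"
      then have "(\<lambda>p. k * free_gen v w p - l * free_gen v w p) \<in> tensor_null V W"
        by (simp add: smt null_coset_eq_iff)
      then have "L (\<lambda>p. (k - l) * free_gen v w p) = 0"
        using L_null by (simp add: left_diff_distrib)
      moreover have "a v = 1" "b w = 1" using a[of 1] b[of 1] v w by (auto simp: line_def)
      ultimately show "k = l" by (simp add: L_smult fin_gen L_gen)
    qed simp
    show "k \<odot>\<^bsub>?T\<^esub> ?t \<in> carrier ?T" for k
      using tens_mem[OF line_mem[OF v, of k] mem(2)] tens_smult_left[OF mem] by simp
    show "\<exists>k\<in>UNIV. x = k \<odot>\<^bsub>?T\<^esub> ?t" if "x \<in> carrier ?T" for x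
      using that span by (auto simp: tensor_carrier smt null_coset_eq_iff)
  qed
  moreover have "a \<odot>\<^bsub>?T\<^esub> (b \<odot>\<^bsub>?T\<^esub> ?t) = (a * b) \<odot>\<^bsub>?T\<^esub> ?t"
      "(a \<odot>\<^bsub>?T\<^esub> ?t) \<oplus>\<^bsub>?T\<^esub> (b \<odot>\<^bsub>?T\<^esub> ?t) = (a + b) \<odot>\<^bsub>?T\<^esub> ?t" "1 \<odot>\<^bsub>?T\<^esub> ?t = ?t" for a b
    unfolding smt tensor_add tensor_smult by (simp_all add: algebra_simps tens_def)
  ultimately show ?thesis
    using tens_zero[OF mem] unfolding line_def bij_betw_def by metis
qed

lemma thin_tensor: "thin V \<Longrightarrow> thin W \<Longrightarrow> thin (tensor V W)"
  using line_tensor null_space_tensor_left null_space_tensor_right unfolding thin_def by metis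

text \<open>If one factor is zero, homogeneity forces \<open>b\<close> to vanish and the zero map is
  the only candidate. If both are lines, homogeneity in each variable recovers \<open>b\<close> from
  its value on the two generators, and that value may be prescribed on the generator of the tensor
  product.\<close>

lemma tensor_lift_ex1:
  assumes V: "thin V" and W: "thin W" and U: "thin U"
    and b: "\<And>v w. v \<in> carrier V \<Longrightarrow> w \<in> carrier W \<Longrightarrow> b v w \<in> carrier U"
    and bl: "\<And>a v w. v \<in> carrier V \<Longrightarrow> w \<in> carrier W \<Longrightarrow> b (a \<odot>\<^bsub>V\<^esub> v) w = a \<odot>\<^bsub>U\<^esub> b v w"
    and br: "\<And>a v w. v \<in> carrier V \<Longrightarrow> w \<in> carrier W \<Longrightarrow> b v (a \<odot>\<^bsub>W\<^esub> w) = a \<odot>\<^bsub>U\<^esub> b v w"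
  shows "\<exists>!F. F \<in> lin (tensor V W) U \<and> (\<forall>v\<in>carrier V. \<forall>w\<in>carrier W. F (tens V W v w) = b v w)"
proof (cases "null_space V \<or> null_space W")
  case True
  then have null: "null_space (tensor V W)"
    using V W null_space_tensor_left null_space_tensor_right by blast
  have "b v w = \<zero>\<^bsub>U\<^esub>" if vw: "v \<in> carrier V" "w \<in> carrier W" for v w
    using True
  proof
    assume "null_space V"
    then show ?thesis using bl[OF vw, of 0] vw b[OF vw] U V
      by (simp add: thin_zero_smult) (metis null_space_mem)
  next
    assume "null_space W"
    then show ?thesis using br[OF vw, of 0] vw b[OF vw] U W
      by (simp add: thin_zero_smult) (metis null_space_mem)
  qed
  then show ?thesis
    using lin_zero_map[OF null_space_thin[OF null] U]
    by (intro ex1I[of _ "\<lambda>x\<in>carrier (tensor V W). \<zero>\<^bsub>U\<^esub>"])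
      (auto simp: tens_mem intro: lin_eqI_null[OF null U])
next
  case False
  then obtain v w where v: "line V v" and w: "line W w"
    using V W by (auto simp: thin_def)
  note l = line_tensor[OF v w] and mem = line_gen_mem[OF v] line_gen_mem[OF w]
  obtain F where F: "F \<in> lin (tensor V W) U" "F (tens V W v w) = b v w"
    using lin_line_ex[OF l U b] mem by blast
  have "F (tens V W x y) = b x y" if xy: "x \<in> carrier V" "y \<in> carrier W" for x y
  proof -
    obtain k where k: "x = k \<odot>\<^bsub>V\<^esub> v" by (rule line_cases[OF v xy(1)])
    obtain l where l: "y = l \<odot>\<^bsub>W\<^esub> w" by (rule line_cases[OF w xy(2)])
    show ?thesis
      unfolding k l using mem F
      by (simp add: tens_smult_left tens_smult_right bl br lin_smult tens_mem thin_smult_closed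
          thin_tensor V W)
  qed
  then show ?thesis
    using F mem by (intro ex1I[of _ F]) (auto intro: lin_eqI_line[OF l])
qed

lemma
  assumes "thin V" "thin W" "thin U"
    and "\<And>v w. v \<in> carrier V \<Longrightarrow> w \<in> carrier W \<Longrightarrow> b v w \<in> carrier U"
    and "\<And>a v w. v \<in> carrier V \<Longrightarrow> w \<in> carrier W \<Longrightarrow> b (a \<odot>\<^bsub>V\<^esub> v) w = a \<odot>\<^bsub>U\<^esub> b v w"
    and "\<And>a v w. v \<in> carrier V \<Longrightarrow> w \<in> carrier W \<Longrightarrow> b v (a \<odot>\<^bsub>W\<^esub> w) = a \<odot>\<^bsub>U\<^esub> b v w"
  shows tensor_lift_lin: "tensor_lift V W U b \<in> lin (tensor V W) U"
    and tensor_lift_tens: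
      "v \<in> carrier V \<Longrightarrow> w \<in> carrier W \<Longrightarrow> tensor_lift V W U b (tens V W v w) = b v w"
  using theI'[OF tensor_lift_ex1[of V W U b, OF assms]] unfolding tensor_lift_def by blast+

lemma
  assumes "thin V" "thin W" "thin V'" "thin W'" and f: "f \<in> lin V V'" and g: "g \<in> lin W W'"
  shows tensor_map_lin: "tensor_map V W V' W' f g \<in> lin (tensor V W) (tensor V' W')"
    and tensor_map_tens: "v \<in> carrier V \<Longrightarrow> w \<in> carrier W \<Longrightarrow>
      tensor_map V W V' W' f g (tens V W v w) = tens V' W' (f v) (g w)"
  unfolding tensor_map_def
  by (rule tensor_lift_lin tensor_lift_tens;
      simp add: assms thin_tensor tens_mem lin_mem[OF f] lin_mem[OF g] lin_smult[OF f] lin_smult[OF g]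
        tens_smult_left tens_smult_right)+

section \<open>Monomial 2-matrices\<close>

definition thin_mat :: "nat \<Rightarrow> 'v two_mat \<Rightarrow> bool"
  where "thin_mat n A \<longleftrightarrow> (\<forall>i\<in>{1..n}. \<forall>j\<in>{1..n}. thin (A i j))"

text \<open>The pattern is recorded by columns: the line of column \<open>j\<close> stands in row
  \<open>\<sigma> j\<close> and has generator \<open>a j\<close>. One nonzero entry per column is
  what makes composites computable, because in the sum over the middle index only one term
  survives.\<close>

definition mono_mat :: "nat \<Rightarrow> 'v two_mat \<Rightarrow> (nat \<Rightarrow> nat) \<Rightarrow> (nat \<Rightarrow> 'v) \<Rightarrow> bool"
  where "mono_mat n A \<sigma> a \<longleftrightarrow> \<sigma> \<in> {1..n} \<rightarrow> {1..n} \<and>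
    (\<forall>i\<in>{1..n}. \<forall>j\<in>{1..n}. if i = \<sigma> j then line (A i j) (a j) else null_space (A i j))"

lemma thin_matD: "thin_mat n A \<Longrightarrow> i \<in> {1..n} \<Longrightarrow> j \<in> {1..n} \<Longrightarrow> thin (A i j)"
  by (simp add: thin_mat_def)

lemma mono_mat_line: "mono_mat n A \<sigma> a \<Longrightarrow> j \<in> {1..n} \<Longrightarrow> line (A (\<sigma> j) j) (a j)"
  unfolding mono_mat_def Pi_def by (simp del: atLeastAtMost_iff)

lemma mono_mat_null:
  "mono_mat n A \<sigma> a \<Longrightarrow> i \<in> {1..n} \<Longrightarrow> j \<in> {1..n} \<Longrightarrow> i \<noteq> \<sigma> j \<Longrightarrow> null_space (A i j)"
  unfolding mono_mat_def by (simp del: atLeastAtMost_iff)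

lemma mono_mat_range: "mono_mat n A \<sigma> a \<Longrightarrow> j \<in> {1..n} \<Longrightarrow> \<sigma> j \<in> {1..n}"
  unfolding mono_mat_def by blast

lemma mono_mat_thin:
  assumes A: "mono_mat n A \<sigma> a"
  shows "thin_mat n A"
  unfolding thin_mat_def
proof (intro ballI)
  fix i j assume "i \<in> {1..n}" "j \<in> {1..n}"
  then show "thin (A i j)"
    using mono_mat_line[OF A] mono_mat_null[OF A]
    by (cases "i = \<sigma> j") (auto intro: line_thin null_space_thin)
qed

lemma two_mors_lin: "\<alpha> \<in> two_mors n A B \<Longrightarrow> i \<in> {1..n} \<Longrightarrow> j \<in> {1..n} \<Longrightarrow> \<alpha> i j \<in> lin (A i j) (B i j)"
  unfolding two_mors_def by (meson PiE_mem)

text \<open>On the lines a linear map is fixed by its value on the generator, and on zero spaces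
  there is only one linear map. The equations between 2-morphisms that enter the coherence
  conditions are checked through this criterion.\<close>

lemma two_mors_eqI:
  assumes A: "mono_mat n A \<sigma> a" and B: "thin_mat n B"
    and \<alpha>: "\<alpha> \<in> two_mors n A B" and \<beta>: "\<beta> \<in> two_mors n A B"
    and eq: "\<And>j. j \<in> {1..n} \<Longrightarrow> \<alpha> (\<sigma> j) j (a j) = \<beta> (\<sigma> j) j (a j)"
  shows "\<alpha> = \<beta>"
proof -
  have "\<alpha> i j = \<beta> i j" if ij: "i \<in> {1..n}" "j \<in> {1..n}" for i j
  proof (cases "i = \<sigma> j")
    case True
    then show ?thesis
      using lin_eqI_line[OF mono_mat_line[OF A ij(2)]] two_mors_lin[OF \<alpha> ij] two_mors_lin[OF \<beta> ij]
        eq[OF ij(2)] by blast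
  next
    case False
    then show ?thesis
      using lin_eqI_null[OF mono_mat_null[OF A ij] thin_matD[OF B ij]] two_mors_lin[OF \<alpha> ij]
        two_mors_lin[OF \<beta> ij] by blast
  qed
  then have "\<alpha> i = \<beta> i" if "i \<in> {1..n}" for i
    using that PiE_mem[OF \<alpha>[unfolded two_mors_def] that] PiE_mem[OF \<beta>[unfolded two_mors_def] that]
    by (intro PiE_ext[of _ "{1..n}"]) auto
  then show ?thesis
    using \<alpha> \<beta> unfolding two_mors_def by (intro PiE_ext[of _ "{1..n}"]) auto
qed

text \<open>The existence half of the freeness on column generators: off the pattern the zero map is
  taken.\<close>

lemma two_mors_ex:
  assumes A: "mono_mat n A \<sigma> a" and B: "thin_mat n B"
    and b: "\<And>j. j \<in> {1..n} \<Longrightarrow> b j \<in> carrier (B (\<sigma> j) j)"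
  shows "\<exists>\<alpha>\<in>two_mors n A B. \<forall>j\<in>{1..n}. \<alpha> (\<sigma> j) j (a j) = b j"
proof -
  have "\<exists>f\<in>lin (A i j) (B i j). i = \<sigma> j \<longrightarrow> f (a j) = b j" if ij: "i \<in> {1..n}" "j \<in> {1..n}" for i j
  proof (cases "i = \<sigma> j")
    case True
    then show ?thesis
      using lin_line_ex[OF mono_mat_line[OF A ij(2)] _ b[OF ij(2)]] thin_matD[OF B ij] by blast
  next
    case False
    then show ?thesis
      using lin_zero_map[OF thin_matD[OF mono_mat_thin[OF A] ij] thin_matD[OF B ij]] by blast
  qed
  then obtain f where f: "\<And>i j. i \<in> {1..n} \<Longrightarrow> j \<in> {1..n} \<Longrightarrow>
      f i j \<in> lin (A i j) (B i j) \<and> (i = \<sigma> j \<longrightarrow> f i j (a j) = b j)" by metis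
  have "f (\<sigma> j) j (a j) = b j" if "j \<in> {1..n}" for j
    using f[OF mono_mat_range[OF A that] that] by simp
  then show ?thesis
    using f mono_mat_range[OF A]
    by (intro bexI[of _ "\<lambda>i\<in>{1..n}. \<lambda>j\<in>{1..n}. f i j"]) (simp_all add: two_mors_def del: atLeastAtMost_iff)
qed

section \<open>Vertical composition, identities and inverses\<close>

lemma vcomp_apply:
  "i \<in> {1..n} \<Longrightarrow> j \<in> {1..n} \<Longrightarrow> x \<in> carrier (A i j) \<Longrightarrow> vcomp n A \<beta> \<alpha> i j x = \<beta> i j (\<alpha> i j x)"
  by (simp add: vcomp_def compose_def)

lemma vcomp_mem:
  assumes A: "thin_mat n A" and \<alpha>: "\<alpha> \<in> two_mors n A B" and \<beta>: "\<beta> \<in> two_mors n B C"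
  shows "vcomp n A \<beta> \<alpha> \<in> two_mors n A C"
  unfolding two_mors_def vcomp_def
  by (intro restrict_PiE_iff[THEN iffD2] ballI
      lin_compose[OF thin_matD[OF A] two_mors_lin[OF \<alpha>] two_mors_lin[OF \<beta>]])

lemma id_mor_apply:
  "i \<in> {1..n} \<Longrightarrow> j \<in> {1..n} \<Longrightarrow> x \<in> carrier (A i j) \<Longrightarrow> id_mor n A i j x = x"
  by (simp add: id_mor_def)

lemma id_mor_mem: "thin_mat n A \<Longrightarrow> id_mor n A \<in> two_mors n A A"
  unfolding id_mor_def two_mors_def by (simp add: lin_id thin_mat_def)

lemma line_smult_inverse: "line V v \<Longrightarrow> k \<noteq> 0 \<Longrightarrow> k \<odot>\<^bsub>V\<^esub> (inverse k \<odot>\<^bsub>V\<^esub> v) = v"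
  and line_inverse_smult: "line V v \<Longrightarrow> k \<noteq> 0 \<Longrightarrow> inverse k \<odot>\<^bsub>V\<^esub> (k \<odot>\<^bsub>V\<^esub> v) = v"
  by (simp_all add: line_def)

text \<open>The inverse scales the generator of column \<open>j\<close> by the inverse of
  \<open>k j\<close>. Source and target must have the same pattern \<sigma>, so that lines are
  matched with lines.\<close>

lemma two_isoI:
  assumes A: "mono_mat n A \<sigma> a" and B: "mono_mat n B \<sigma> b" and \<alpha>: "\<alpha> \<in> two_mors n A B"
    and eq: "\<And>j. j \<in> {1..n} \<Longrightarrow> \<alpha> (\<sigma> j) j (a j) = k j \<odot>\<^bsub>B (\<sigma> j) j\<^esub> b j"
    and k: "\<And>j. j \<in> {1..n} \<Longrightarrow> k j \<noteq> 0"
  shows "two_iso n A B \<alpha>"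
proof -
  note rng = mono_mat_range[OF A] and tA = mono_mat_thin[OF A] and tB = mono_mat_thin[OF B]
    and lA = mono_mat_line[OF A] and lB = mono_mat_line[OF B]
  note gA = lA[THEN line_gen_mem] and gB = lB[THEN line_gen_mem]
  have "inverse (k j) \<odot>\<^bsub>A (\<sigma> j) j\<^esub> a j \<in> carrier (A (\<sigma> j) j)" if "j \<in> {1..n}" for j
    using lA[OF that] by (rule line_mem)
  from two_mors_ex[where b = "\<lambda>j. inverse (k j) \<odot>\<^bsub>A (\<sigma> j) j\<^esub> a j", OF B tA this]
  obtain \<beta> where \<beta>: "\<beta> \<in> two_mors n B A"
      and \<beta>_eq: "\<And>j. j \<in> {1..n} \<Longrightarrow> \<beta> (\<sigma> j) j (b j) = inverse (k j) \<odot>\<^bsub>A (\<sigma> j) j\<^esub> a j"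
    by auto
  have "vcomp n A \<beta> \<alpha> = id_mor n A"
  proof (rule two_mors_eqI[OF A tA])
    fix j assume j: "j \<in> {1..n}"
    show "vcomp n A \<beta> \<alpha> (\<sigma> j) j (a j) = id_mor n A (\<sigma> j) j (a j)"
      unfolding vcomp_apply[where A = A, OF rng[OF j] j gA[OF j]] id_mor_apply[where A = A, OF rng[OF j] j gA[OF j]] eq[OF j]
        lin_smult[OF two_mors_lin[OF \<beta> rng[OF j] j] gB[OF j]] \<beta>_eq[OF j]
      using lA[OF j] k[OF j] by (rule line_smult_inverse)
  qed (rule vcomp_mem[OF tA \<alpha> \<beta>] id_mor_mem[OF tA])+
  moreover have "vcomp n B \<alpha> \<beta> = id_mor n B"
  proof (rule two_mors_eqI[OF B tB])
    fix j assume j: "j \<in> {1..n}"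
    show "vcomp n B \<alpha> \<beta> (\<sigma> j) j (b j) = id_mor n B (\<sigma> j) j (b j)"
      unfolding vcomp_apply[where A = B, OF rng[OF j] j gB[OF j]] id_mor_apply[where A = B, OF rng[OF j] j gB[OF j]] \<beta>_eq[OF j]
        lin_smult[OF two_mors_lin[OF \<alpha> rng[OF j] j] gA[OF j]] eq[OF j]
      using lB[OF j] k[OF j] by (rule line_inverse_smult)
  qed (rule vcomp_mem[OF tB \<beta> \<alpha>] id_mor_mem[OF tB])+
  ultimately show ?thesis using \<alpha> \<beta> unfolding two_iso_def by blast
qed

subsection \<open>Composites\<close>

lemma comp_mat_entry:
  "i \<in> {1..n} \<Longrightarrow> k \<in> {1..n} \<Longrightarrow>
    comp_mat n A B i k = direct_sum {1..n} (\<lambda>j. tensor (A i j) (B j k))"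
  by (simp add: comp_mat_def)

text \<open>In column \<open>k\<close> the factor \<open>B j k\<close> vanishes unless
  \<open>j = \<tau> k\<close>, so the direct sum reduces to a single tensor product; this is a line
  exactly when row \<open>i\<close> is the one that \<open>A\<close> pairs with column
  \<open>\<tau> k\<close>.\<close>

lemma mono_mat_comp:
  assumes A: "mono_mat n A \<sigma> a" and B: "mono_mat n B \<tau> b"
  shows "mono_mat n (comp_mat n A B) (\<sigma> \<circ> \<tau>)
    (\<lambda>k. comp_gen n A B (\<sigma> (\<tau> k)) (\<tau> k) k (a (\<tau> k)) (b k))"
  unfolding mono_mat_def
proof (intro conjI ballI)
  show "\<sigma> \<circ> \<tau> \<in> {1..n} \<rightarrow> {1..n}"
    using mono_mat_range[OF A] mono_mat_range[OF B] by auto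
next
  fix i k assume ik: "i \<in> {1..n}" "k \<in> {1..n}"
  note \<tau>k = mono_mat_range[OF B ik(2)]
  have null: "null_space (tensor (A i j) (B j k))" if "j \<in> {1..n}" "j \<noteq> \<tau> k" for j
    using that ik null_space_tensor_right mono_mat_null[OF B] thin_matD[OF mono_mat_thin[OF A]] by blast
  show "if i = (\<sigma> \<circ> \<tau>) k
    then line (comp_mat n A B i k) (comp_gen n A B (\<sigma> (\<tau> k)) (\<tau> k) k (a (\<tau> k)) (b k))
    else null_space (comp_mat n A B i k)"
  proof (cases "i = \<sigma> (\<tau> k)")
    case True
    have "line (tensor (A i (\<tau> k)) (B (\<tau> k) k)) (tens (A i (\<tau> k)) (B (\<tau> k) k) (a (\<tau> k)) (b k))"
      unfolding True by (rule line_tensor[OF mono_mat_line[OF A \<tau>k] mono_mat_line[OF B ik(2)]])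
    then have "line (comp_mat n A B i k) (comp_gen n A B i (\<tau> k) k (a (\<tau> k)) (b k))"
      unfolding comp_mat_entry[OF ik] comp_gen_def by (intro line_direct_sum[OF \<tau>k] null)
    then show ?thesis using True by simp
  next
    case False
    have "null_space (tensor (A i j) (B j k))" if "j \<in> {1..n}" for j
      using null[OF that] that ik False null_space_tensor_left[OF mono_mat_null[OF A ik(1) \<tau>k]]
        thin_matD[OF mono_mat_thin[OF B]] by metis
    then have "null_space (comp_mat n A B i k)"
      unfolding comp_mat_entry[OF ik] by (rule null_space_direct_sum)
    then show ?thesis using False by simp
  qed
qed

lemma thin_mat_tensor:
  "thin_mat n A \<Longrightarrow> thin_mat n B \<Longrightarrow> i \<in> {1..n} \<Longrightarrow> j \<in> {1..n} \<Longrightarrow> k \<in> {1..n} \<Longrightarrow>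
    thin (tensor (A i j) (B j k))"
  by (intro thin_tensor thin_matD)

lemma comp_gen_mem:
  assumes "thin_mat n A" "thin_mat n B" "i \<in> {1..n}" "j \<in> {1..n}" "k \<in> {1..n}"
    "x \<in> carrier (A i j)" "y \<in> carrier (B j k)"
  shows "comp_gen n A B i j k x y \<in> carrier (comp_mat n A B i k)"
  using assms unfolding comp_gen_def by (simp add: comp_mat_entry)
    (intro summand_inj_mem thin_mat_tensor[of n A B] tens_mem; simp)

lemma comp_gen_smult_left:
  assumes "thin_mat n A" "thin_mat n B" "i \<in> {1..n}" "j \<in> {1..n}" "k \<in> {1..n}"
    "x \<in> carrier (A i j)" "y \<in> carrier (B j k)"
  shows "comp_gen n A B i j k (z \<odot>\<^bsub>A i j\<^esub> x) y = z \<odot>\<^bsub>comp_mat n A B i k\<^esub> comp_gen n A B i j k x y"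
  unfolding comp_gen_def comp_mat_entry[OF assms(3,5)] tens_smult_left[OF assms(6,7)] using assms
  by (intro summand_inj_smult[of "{1..n}" "\<lambda>j. tensor (A i j) (B j k)"] thin_mat_tensor[of n A B])

lemma comp_gen_smult_right:
  assumes "thin_mat n A" "thin_mat n B" "i \<in> {1..n}" "j \<in> {1..n}" "k \<in> {1..n}"
    "x \<in> carrier (A i j)" "y \<in> carrier (B j k)"
  shows "comp_gen n A B i j k x (z \<odot>\<^bsub>B j k\<^esub> y) = z \<odot>\<^bsub>comp_mat n A B i k\<^esub> comp_gen n A B i j k x y"
  unfolding comp_gen_def comp_mat_entry[OF assms(3,5)] tens_smult_right[OF assms(6,7)] using assms
  by (intro summand_inj_smult[of "{1..n}" "\<lambda>j. tensor (A i j) (B j k)"] thin_mat_tensor[of n A B])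

lemma hcomp_mem:
  assumes "thin_mat n A" "thin_mat n B" "thin_mat n A'" "thin_mat n B'"
    and \<alpha>: "\<alpha> \<in> two_mors n A A'" and \<beta>: "\<beta> \<in> two_mors n B B'"
  shows "hcomp n A B A' B' \<alpha> \<beta> \<in> two_mors n (comp_mat n A B) (comp_mat n A' B')"
  unfolding two_mors_def hcomp_def
proof (intro restrict_PiE_iff[THEN iffD2] ballI)
  fix i k assume ik: "i \<in> {1..n}" "k \<in> {1..n}"
  show "(\<lambda>x\<in>carrier (comp_mat n A B i k). \<lambda>j\<in>{1..n}.
      tensor_map (A i j) (B j k) (A' i j) (B' j k) (\<alpha> i j) (\<beta> j k) (x j))
    \<in> lin (comp_mat n A B i k) (comp_mat n A' B' i k)"
    unfolding comp_mat_entry[OF ik] using assms ik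
    by (intro lin_direct_sum_map tensor_map_lin thin_mat_tensor[of n A B] two_mors_lin[OF \<alpha>]
        two_mors_lin[OF \<beta>]) (auto intro: thin_matD)
qed

lemma hcomp_apply:
  assumes t: "thin_mat n A" "thin_mat n B" "thin_mat n A'" "thin_mat n B'"
    and \<alpha>: "\<alpha> \<in> two_mors n A A'" and \<beta>: "\<beta> \<in> two_mors n B B'"
    and ijk: "i \<in> {1..n}" "j \<in> {1..n}" "k \<in> {1..n}"
    and xy: "x \<in> carrier (A i j)" "y \<in> carrier (B j k)"
  shows "hcomp n A B A' B' \<alpha> \<beta> i k (comp_gen n A B i j k x y)
    = comp_gen n A' B' i j k (\<alpha> i j x) (\<beta> j k y)"
proof -
  \<comment> \<open>A generator of the composite is zero in all components but one; linearity keeps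
    these components zero.\<close>
  have z: "tensor_map (A i l) (B l k) (A' i l) (B' l k) (\<alpha> i l) (\<beta> l k) \<zero>\<^bsub>tensor (A i l) (B l k)\<^esub>
      = \<zero>\<^bsub>tensor (A' i l) (B' l k)\<^esub>" if "l \<in> {1..n}" for l
    using t that ijk
    by (intro lin_zero[OF tensor_map_lin] thin_mat_tensor[of n A B] thin_mat_tensor[of n A' B']
        two_mors_lin[OF \<alpha>] two_mors_lin[OF \<beta>]) (auto intro: thin_matD)
  have "tensor_map (A i j) (B j k) (A' i j) (B' j k) (\<alpha> i j) (\<beta> j k) (tens (A i j) (B j k) x y)
      = tens (A' i j) (B' j k) (\<alpha> i j x) (\<beta> j k y)"
    using t ijk xy by (intro tensor_map_tens two_mors_lin[OF \<alpha>] two_mors_lin[OF \<beta>]) (auto intro: thin_matD)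
  then have "hcomp n A B A' B' \<alpha> \<beta> i k (comp_gen n A B i j k x y) =
      (\<lambda>l\<in>{1..n}. if l = j then tens (A' i j) (B' j k) (\<alpha> i j x) (\<beta> j k y)
        else \<zero>\<^bsub>tensor (A' i l) (B' l k)\<^esub>)"
    using comp_gen_mem[OF t(1,2) ijk xy] ijk
    by (simp only: hcomp_def restrict_apply if_True)
      (auto simp: comp_gen_def summand_inj_def z fun_eq_iff)
  then show ?thesis by (auto simp: comp_gen_def summand_inj_def)
qed

text \<open>The description in \<open>assoc_mor\<close> prescribes values on all triples of vectors,
  far more than a linear map on a line or zero space can be given freely. The map is fixed by the
  triple of generators; every other triple is a multiple of it, or contains a vector of a zero space
  and then both bracketings vanish.\<close>

lemma
  assumes A: "mono_mat n A \<sigma> a" and B: "mono_mat n B \<tau> b" and C: "mono_mat n C \<upsilon> c"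
  shows assoc_mor_mem: "assoc_mor n A B C \<in>
      two_mors n (comp_mat n (comp_mat n A B) C) (comp_mat n A (comp_mat n B C))"
    and assoc_mor_apply: "i \<in> {1..n} \<Longrightarrow> j \<in> {1..n} \<Longrightarrow> k \<in> {1..n} \<Longrightarrow> l \<in> {1..n} \<Longrightarrow>
      x \<in> carrier (A i j) \<Longrightarrow> y \<in> carrier (B j k) \<Longrightarrow> z \<in> carrier (C k l) \<Longrightarrow>
      assoc_mor n A B C i l (comp_gen n (comp_mat n A B) C i k l (comp_gen n A B i j k x y) z)
      = comp_gen n A (comp_mat n B C) i j l x (comp_gen n B C j k l y z)"
proof -
  note AB = mono_mat_comp[OF A B] and BC = mono_mat_comp[OF B C]
  note L = mono_mat_comp[OF AB C] and R = mono_mat_comp[OF A BC]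
  note t = A[THEN mono_mat_thin] B[THEN mono_mat_thin] C[THEN mono_mat_thin] AB[THEN mono_mat_thin]
    BC[THEN mono_mat_thin] L[THEN mono_mat_thin] R[THEN mono_mat_thin]
  let ?L = "comp_mat n (comp_mat n A B) C" and ?R = "comp_mat n A (comp_mat n B C)"
  let ?l = "\<lambda>i j k l x y z. comp_gen n (comp_mat n A B) C i k l (comp_gen n A B i j k x y) z"
  let ?r = "\<lambda>i j k l x y z. comp_gen n A (comp_mat n B C) i j l x (comp_gen n B C j k l y z)"
  let ?P = "\<lambda>i l F. F \<in> lin (?L i l) (?R i l) \<and> (\<forall>j\<in>{1..n}. \<forall>k\<in>{1..n}.
    \<forall>x\<in>carrier (A i j). \<forall>y\<in>carrier (B j k). \<forall>z\<in>carrier (C k l). F (?l i j k l x y z) = ?r i j k l x y z)"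
  have ex1: "\<exists>!F. ?P i l F" if il: "i \<in> {1..n}" "l \<in> {1..n}" for i l
  proof -
    define k0 j0 where "k0 = \<upsilon> l" and "j0 = \<tau> k0"
    have k0: "k0 \<in> {1..n}" and j0: "j0 \<in> {1..n}"
      using mono_mat_range[OF C il(2)] mono_mat_range[OF B] by (auto simp: k0_def j0_def)
    define g where "g = ?l i j0 k0 l (a j0) (b k0) (c l)"
    define h where "h = ?r i j0 k0 l (a j0) (b k0) (c l)"
    have lines: "line (B j0 k0) (b k0)" "line (C k0 l) (c l)"
      using mono_mat_line[OF B k0] mono_mat_line[OF C il(2)] by (auto simp: k0_def j0_def)
    have lineA: "line (A i j0) (a j0)" if "i = \<sigma> j0"
      using mono_mat_line[OF A j0] that by auto
    have gl: "line (?L i l) g" if "i = \<sigma> j0"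
      using mono_mat_line[OF L il(2)] that by (simp add: g_def k0_def j0_def)
    have gn: "null_space (?L i l)" if "i \<noteq> \<sigma> j0"
      using mono_mat_null[OF L il] that by (simp add: k0_def j0_def)
    have hm: "h \<in> carrier (?R i l)" if "i = \<sigma> j0"
      using mono_mat_line[OF R il(2)] that by (simp add: h_def k0_def j0_def line_gen_mem)
    note tL = thin_matD[OF t(6) il] and tR = thin_matD[OF t(7) il]
    obtain F where F: "F \<in> lin (?L i l) (?R i l)" "i = \<sigma> j0 \<Longrightarrow> F g = h"
      using lin_line_ex[OF gl tR hm] lin_zero_map[OF tL tR] by blast
    have Fz: "F \<zero>\<^bsub>?L i l\<^esub> = \<zero>\<^bsub>?R i l\<^esub>"
      by (rule lin_zero[OF F(1) tL tR])
    \<comment> \<open>Scalars on the three factors come out as their product in both bracketings.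
      This handles multiples of the generators and, with one scalar 0, also the vanishing
      triples.\<close>
    have scale: "?l i j k l (p \<odot>\<^bsub>A i j\<^esub> x) (q \<odot>\<^bsub>B j k\<^esub> y) (s \<odot>\<^bsub>C k l\<^esub> z) = (p * q * s) \<odot>\<^bsub>?L i l\<^esub> ?l i j k l x y z"
        "?r i j k l (p \<odot>\<^bsub>A i j\<^esub> x) (q \<odot>\<^bsub>B j k\<^esub> y) (s \<odot>\<^bsub>C k l\<^esub> z) = (p * q * s) \<odot>\<^bsub>?R i l\<^esub> ?r i j k l x y z"
        "?l i j k l x y z \<in> carrier (?L i l)" "?r i j k l x y z \<in> carrier (?R i l)"
      if jk: "j \<in> {1..n}" "k \<in> {1..n}" and x: "x \<in> carrier (A i j)" and y: "y \<in> carrier (B j k)"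
        and z: "z \<in> carrier (C k l)" for j k x y z p q s
    proof -
      note qy = thin_smult_closed[OF thin_matD[OF t(2) jk] y] and sz = thin_smult_closed[OF thin_matD[OF t(3) jk(2) il(2)] z]
      note xy = comp_gen_mem[OF t(1,2) il(1) jk x y] and yz = comp_gen_mem[OF t(2,3) jk il(2) y z]
      note tab = thin_matD[OF t(4) il(1) jk(2)] and tbc = thin_matD[OF t(5) jk(1) il(2)]
      show l: "?l i j k l x y z \<in> carrier (?L i l)" by (rule comp_gen_mem[OF t(4,3) il(1) jk(2) il(2) xy z])
      show r: "?r i j k l x y z \<in> carrier (?R i l)" by (rule comp_gen_mem[OF t(1,5) il(1) jk(1) il(2) x yz])
      show "?l i j k l (p \<odot>\<^bsub>A i j\<^esub> x) (q \<odot>\<^bsub>B j k\<^esub> y) (s \<odot>\<^bsub>C k l\<^esub> z) = (p * q * s) \<odot>\<^bsub>?L i l\<^esub> ?l i j k l x y z"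
        using comp_gen_smult_left[OF t(1,2) il(1) jk x qy] comp_gen_smult_right[OF t(1,2) il(1) jk x y]
          comp_gen_smult_right[OF t(4,3) il(1) jk(2) il(2) thin_smult_closed[OF tab xy] z]
          comp_gen_smult_left[OF t(4,3) il(1) jk(2) il(2) xy z]
        by (simp add: thin_smult_smult[OF tab xy] thin_smult_smult[OF tL l] mult_ac)
      show "?r i j k l (p \<odot>\<^bsub>A i j\<^esub> x) (q \<odot>\<^bsub>B j k\<^esub> y) (s \<odot>\<^bsub>C k l\<^esub> z) = (p * q * s) \<odot>\<^bsub>?R i l\<^esub> ?r i j k l x y z"
        using comp_gen_smult_left[OF t(2,3) jk il(2) y sz] comp_gen_smult_right[OF t(2,3) jk il(2) y z]
          comp_gen_smult_left[OF t(1,5) il(1) jk(1) il(2) x thin_smult_closed[OF tbc yz]]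
          comp_gen_smult_right[OF t(1,5) il(1) jk(1) il(2) x yz]
        by (simp add: thin_smult_smult[OF tbc yz] thin_smult_smult[OF tR r] mult_ac)
    qed
    have "F (?l i j k l x y z) = ?r i j k l x y z"
      if jk: "j \<in> {1..n}" "k \<in> {1..n}" and xyz: "x \<in> carrier (A i j)" "y \<in> carrier (B j k)" "z \<in> carrier (C k l)"
      for j k x y z
    proof (cases "k = k0 \<and> j = j0 \<and> i = \<sigma> j0")
      case True
      note la = lineA[OF conjunct2[OF conjunct2[OF True]]]
      obtain p where p: "x = p \<odot>\<^bsub>A i j0\<^esub> a j0" using line_cases[OF la] xyz(1) True by blast
      obtain q where q: "y = q \<odot>\<^bsub>B j0 k0\<^esub> b k0" using line_cases[OF lines(1)] xyz(2) True by blast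
      obtain s where s: "z = s \<odot>\<^bsub>C k0 l\<^esub> c l" using line_cases[OF lines(2)] xyz(3) True by blast
      note sc = scale[OF j0 k0 la[THEN line_gen_mem] lines[THEN line_gen_mem]]
      show ?thesis
        using True F(2) lin_smult[OF F(1) sc(3)] sc(1,2)[of p q s] by (simp add: p q s g_def h_def)
    next
      case False
      then have null: "null_space (A i j) \<or> null_space (B j k) \<or> null_space (C k l)"
        using mono_mat_null[OF A il(1) jk(1)] mono_mat_null[OF B jk] mono_mat_null[OF C jk(2) il(2)]
        unfolding k0_def j0_def by blast
      \<comment> \<open>Scaling by 0 on a zero space and by 1 elsewhere does not change the three
        vectors; since some factor is a zero space, the product of the scalars is 0.\<close>
      define p q s :: complex where "p = (if null_space (A i j) then 0 else 1)"
        and "q = (if null_space (B j k) then 0 else 1)" and "s = (if null_space (C k l) then 0 else 1)"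
      have "p \<odot>\<^bsub>A i j\<^esub> x = x" "q \<odot>\<^bsub>B j k\<^esub> y = y" "s \<odot>\<^bsub>C k l\<^esub> z = z"
        using xyz thin_one_smult[OF thin_matD[OF t(1) il(1) jk(1)]] thin_one_smult[OF thin_matD[OF t(2) jk]]
          thin_one_smult[OF thin_matD[OF t(3) jk(2) il(2)]]
        by (auto simp: p_def q_def s_def null_space_def)
      moreover have pqs: "p * q * s = 0" using null by (auto simp: p_def q_def s_def)
      ultimately have "?l i j k l x y z = 0 \<odot>\<^bsub>?L i l\<^esub> ?l i j k l x y z"
          "?r i j k l x y z = 0 \<odot>\<^bsub>?R i l\<^esub> ?r i j k l x y z"
        using scale(1,2)[OF jk xyz, of p q s] by (simp_all only: pqs)
      then have "?l i j k l x y z = \<zero>\<^bsub>?L i l\<^esub>" "?r i j k l x y z = \<zero>\<^bsub>?R i l\<^esub>"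
        unfolding thin_zero_smult[OF tL scale(3)[OF jk xyz]] thin_zero_smult[OF tR scale(4)[OF jk xyz]] .
      then show ?thesis using Fz by simp
    qed
    then have PF: "?P i l F" using F(1) by blast
    show ?thesis
    proof (rule ex1I[of "?P i l", OF PF])
      fix F' assume F': "?P i l F'"
      show "F' = F"
      proof (cases "i = \<sigma> j0")
        case True
        have "F' g = h"
          using F' j0 k0 line_gen_mem[OF lineA[OF True]] lines[THEN line_gen_mem] unfolding g_def h_def by blast
        then show ?thesis
          using lin_eqI_line[OF gl[OF True]] F' F True by blast
      next
        case False
        then show ?thesis using lin_eqI_null[OF gn tR] F' F by blast
      qed
    qed
  qed
  have P: "?P i l (assoc_mor n A B C i l)" if "i \<in> {1..n}" "l \<in> {1..n}" for i l
    using theI'[OF ex1[OF that]] that by (simp add: assoc_mor_def)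
  have "assoc_mor n A B C = (\<lambda>i\<in>{1..n}. \<lambda>l\<in>{1..n}. assoc_mor n A B C i l)"
    by (auto simp: assoc_mor_def fun_eq_iff)
  also have "\<dots> \<in> two_mors n ?L ?R"
    unfolding two_mors_def using P by (intro restrict_PiE_iff[THEN iffD2] ballI) blast
  finally show "assoc_mor n A B C \<in> two_mors n ?L ?R" .
  show "i \<in> {1..n} \<Longrightarrow> j \<in> {1..n} \<Longrightarrow> k \<in> {1..n} \<Longrightarrow> l \<in> {1..n} \<Longrightarrow>
      x \<in> carrier (A i j) \<Longrightarrow> y \<in> carrier (B j k) \<Longrightarrow> z \<in> carrier (C k l) \<Longrightarrow>
      assoc_mor n A B C i l (?l i j k l x y z) = ?r i j k l x y z"
    using P by blast
qed

subsection \<open>Identity 2-matrices\<close>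

lemma mono_mat_id_mat: "mono_mat n (id_mat n) id (\<lambda>_. 1)"
  by (auto simp: mono_mat_def id_mat_def line_ground_space null_space_zero_space)

lemma id_mat_diag: "i \<in> {1..n} \<Longrightarrow> id_mat n i i = ground_space"
  by (simp add: id_mat_def)

lemma
  assumes "thin V"
  shows scalar_lift_left_lin: "tensor_lift ground_space V V (\<lambda>z v. z \<odot>\<^bsub>V\<^esub> v) \<in> lin (tensor ground_space V) V"
    and scalar_lift_left_tens: "v \<in> carrier V \<Longrightarrow>
      tensor_lift ground_space V V (\<lambda>z v. z \<odot>\<^bsub>V\<^esub> v) (tens ground_space V z v) = z \<odot>\<^bsub>V\<^esub> v"
    and scalar_lift_right_lin: "tensor_lift V ground_space V (\<lambda>v z. z \<odot>\<^bsub>V\<^esub> v) \<in> lin (tensor V ground_space) V"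
    and scalar_lift_right_tens: "v \<in> carrier V \<Longrightarrow>
      tensor_lift V ground_space V (\<lambda>v z. z \<odot>\<^bsub>V\<^esub> v) (tens V ground_space v z) = z \<odot>\<^bsub>V\<^esub> v"
  using assms line_thin[OF line_ground_space]
  by (auto intro!: tensor_lift_lin tensor_lift_tens
      simp: thin_smult_closed thin_smult_smult mult_ac ground_space_def[THEN arg_cong[of _ _ carrier]]
        ground_space_def[THEN arg_cong[of _ _ "module.smult"]])

lemma lunit_mor_mem:
  assumes A: "thin_mat n A"
  shows "lunit_mor n A \<in> two_mors n (comp_mat n (id_mat n) A) A"
  unfolding two_mors_def lunit_mor_def
proof (intro restrict_PiE_iff[THEN iffD2] ballI)
  fix i j assume ij: "i \<in> {1..n}" "j \<in> {1..n}"
  note t = mono_mat_thin[OF mono_mat_id_mat]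
  show "(\<lambda>x\<in>carrier (comp_mat n (id_mat n) A i j).
      tensor_lift ground_space (A i j) (A i j) (\<lambda>z v. z \<odot>\<^bsub>A i j\<^esub> v) (x i))
    \<in> lin (comp_mat n (id_mat n) A i j) (A i j)"
    unfolding comp_mat_entry[OF ij]
    using scalar_lift_left_lin[OF thin_matD[OF A ij]] ij
    by (intro lin_direct_sum_proj thin_mat_tensor[OF t A]) (auto simp: id_mat_diag)
qed

lemma runit_mor_mem:
  assumes A: "thin_mat n A"
  shows "runit_mor n A \<in> two_mors n (comp_mat n A (id_mat n)) A"
  unfolding two_mors_def runit_mor_def
proof (intro restrict_PiE_iff[THEN iffD2] ballI)
  fix i j assume ij: "i \<in> {1..n}" "j \<in> {1..n}"
  note t = mono_mat_thin[OF mono_mat_id_mat]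
  show "(\<lambda>x\<in>carrier (comp_mat n A (id_mat n) i j).
      tensor_lift (A i j) ground_space (A i j) (\<lambda>v z. z \<odot>\<^bsub>A i j\<^esub> v) (x j))
    \<in> lin (comp_mat n A (id_mat n) i j) (A i j)"
    unfolding comp_mat_entry[OF ij]
    using scalar_lift_right_lin[OF thin_matD[OF A ij]] ij
    by (intro lin_direct_sum_proj thin_mat_tensor[OF A t]) (auto simp: id_mat_diag)
qed

lemma lunit_mor_apply:
  assumes A: "thin_mat n A" and ij: "i \<in> {1..n}" "j \<in> {1..n}" and v: "v \<in> carrier (A i j)"
  shows "lunit_mor n A i j (comp_gen n (id_mat n) A i i j z v) = z \<odot>\<^bsub>A i j\<^esub> v"
proof -
  have "comp_gen n (id_mat n) A i i j z v \<in> carrier (comp_mat n (id_mat n) A i j)"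
    using v ij by (intro comp_gen_mem mono_mat_thin[OF mono_mat_id_mat] A)
      (auto simp: id_mat_diag ground_space_def)
  then show ?thesis
    using ij scalar_lift_left_tens[OF thin_matD[OF A ij] v, of z]
    by (simp add: lunit_mor_def) (simp add: comp_gen_def summand_inj_def id_mat_diag)
qed

lemma runit_mor_apply:
  assumes A: "thin_mat n A" and ij: "i \<in> {1..n}" "j \<in> {1..n}" and v: "v \<in> carrier (A i j)"
  shows "runit_mor n A i j (comp_gen n A (id_mat n) i j j v z) = z \<odot>\<^bsub>A i j\<^esub> v"
proof -
  have "comp_gen n A (id_mat n) i j j v z \<in> carrier (comp_mat n A (id_mat n) i j)"
    using v ij by (intro comp_gen_mem mono_mat_thin[OF mono_mat_id_mat] A)
      (auto simp: id_mat_diag ground_space_def)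
  then show ?thesis
    using ij scalar_lift_right_tens[OF thin_matD[OF A ij] v, of z]
    by (simp add: runit_mor_def) (simp add: comp_gen_def summand_inj_def id_mat_diag)
qed

section \<open>The 2-representation of a set with a cocycle\<close>

lemma ground_space_simps [simp]:
  "carrier ground_space = UNIV" "a \<odot>\<^bsub>ground_space\<^esub> b = a * b" "a \<oplus>\<^bsub>ground_space\<^esub> b = a + b"
  "\<zero>\<^bsub>ground_space\<^esub> = 0"
  by (simp_all add: ground_space_def)

lemma vec_space_ground_space: "vec_space ground_space"
proof (rule moduleI)
  show "abelian_group ground_space"
    by (rule abelian_groupI) (auto simp: algebra_simps intro: exI[of _ "- x" for x])
qed (auto simp: cring_from_type_algebra, auto simp: ring_of_type_algebra_def algebra_simps)

lemma vec_space_zero_space: "vec_space zero_space"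
proof (rule moduleI)
  show "abelian_group zero_space"
    by (rule abelian_groupI) (auto simp: zero_space_def)
qed (auto simp: cring_from_type_algebra zero_space_def)

lemma
  shows mult_lift_lin: "tensor_lift ground_space ground_space ground_space (*)
      \<in> lin (tensor ground_space ground_space) ground_space"
    and mult_lift_tens: "tensor_lift ground_space ground_space ground_space (*)
      (tens ground_space ground_space z w) = z * w"
  by (rule tensor_lift_lin tensor_lift_tens; simp add: line_thin[OF line_ground_space])+

lemma two_morsI:
  assumes "\<alpha> = (\<lambda>i\<in>{1..n}. \<lambda>j\<in>{1..n}. \<alpha> i j)"
    and "\<And>i j. i \<in> {1..n} \<Longrightarrow> j \<in> {1..n} \<Longrightarrow> \<alpha> i j \<in> lin (A i j) (B i j)"
  shows "\<alpha> \<in> two_mors n A B"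
  unfolding two_mors_def by (subst assms(1)) (simp add: assms(2) del: One_nat_def atLeastAtMost_iff)

lemma mono_mat_cong:
  assumes "mono_mat n A \<sigma> a" "\<And>j. j \<in> {1..n} \<Longrightarrow> \<sigma> j = \<tau> j"
  shows "mono_mat n A \<tau> a"
  using assms unfolding mono_mat_def by (auto simp: Pi_def simp del: atLeastAtMost_iff)

text \<open>The laws are imposed only on \<open>S\<close>. Permutations of \<open>{1..n}\<close> in
  \<open>sym_group\<close> are the identity outside that set rather than extensional, so they are
  not elements of \<open>BijGroup\<close> and \<open>group_action\<close> would not apply to
  them.\<close>

locale set_action = group K for K :: "('g, 'm) monoid_scheme" (structure) +
  fixes S :: "'s set" and act :: "'g \<Rightarrow> 's \<Rightarrow> 's"
  assumes act_closed: "g \<in> carrier K \<Longrightarrow> s \<in> S \<Longrightarrow> act g s \<in> S"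
    and act_one: "s \<in> S \<Longrightarrow> act \<one> s = s"
    and act_mult: "g \<in> carrier K \<Longrightarrow> h \<in> carrier K \<Longrightarrow> s \<in> S \<Longrightarrow> act (g \<otimes> h) s = act g (act h s)"
begin

lemma act_inv_cancel: "g \<in> carrier K \<Longrightarrow> s \<in> S \<Longrightarrow> act (inv g) (act g s) = s"
  by (metis act_mult act_one inv_closed l_inv)

lemma act_cancel_inv: "g \<in> carrier K \<Longrightarrow> s \<in> S \<Longrightarrow> act g (act (inv g) s) = s"
  by (metis act_mult act_one inv_closed r_inv)

end

locale set_cocycle = set_action K S act
  for K :: "('g, 'm) monoid_scheme" (structure) and S :: "'s set" and act +
  fixes e :: "nat \<Rightarrow> 's" and c :: "'g \<times> 'g \<Rightarrow> 's \<Rightarrow> complex"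
  assumes e: "bij_betw e {1..card S} S"
    and c_nonzero: "g \<in> carrier K \<Longrightarrow> h \<in> carrier K \<Longrightarrow> s \<in> S \<Longrightarrow> c (g, h) s \<noteq> 0"
    and c_cocycle: "g \<in> carrier K \<Longrightarrow> h \<in> carrier K \<Longrightarrow> l \<in> carrier K \<Longrightarrow> s \<in> S \<Longrightarrow>
      c (h, l) (act (inv g) s) * c (g, h \<otimes> l) s = c (g \<otimes> h, l) s * c (g, h) s"
begin

context
  notes One_nat_def [simp del] and atLeastAtMost_iff [simp del]
begin

definition perm :: "'g \<Rightarrow> nat \<Rightarrow> nat"
  where "perm g j = inv_into {1..card S} e (act g (e j))"

abbreviation "N \<equiv> {1..card S}"
abbreviation "R \<equiv> set_rho K S e act"
abbreviation "R2 g h \<equiv> comp_mat (card S) (R g) (R h)"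
abbreviation "gen g h \<equiv> comp_gen (card S) (R g) (R h)"
abbreviation "lunit g u \<equiv> vcomp (card S) (R2 \<one> g) (lunit_mor (card S) (R g))
  (hcomp (card S) (R \<one>) (R g) (id_mat (card S)) (R g) u (id_mor (card S) (R g)))"
abbreviation "runit g u \<equiv> vcomp (card S) (R2 g \<one>) (runit_mor (card S) (R g))
  (hcomp (card S) (R g) (R \<one>) (R g) (id_mat (card S)) (id_mor (card S) (R g)) u)"
abbreviation "\<Phi> \<equiv> phi (set_two_rep K S e act c)"
abbreviation "U \<equiv> phi1 (set_two_rep K S e act c)"

section \<open>The permutation of indices belonging to a group element\<close>

lemma e_mem: "j \<in> N \<Longrightarrow> e j \<in> S"
  using e by (rule bij_betw_apply)

lemma perm_mem: "g \<in> carrier K \<Longrightarrow> j \<in> N \<Longrightarrow> perm g j \<in> N"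
  unfolding perm_def using e act_closed e_mem by (metis bij_betw_def inv_into_into)

lemma e_perm: "g \<in> carrier K \<Longrightarrow> j \<in> N \<Longrightarrow> e (perm g j) = act g (e j)"
  unfolding perm_def using e act_closed e_mem by (metis bij_betw_inv_into_right)

lemma eq_perm_iff: "g \<in> carrier K \<Longrightarrow> i \<in> N \<Longrightarrow> j \<in> N \<Longrightarrow> e i = act g (e j) \<longleftrightarrow> i = perm g j"
  by (metis bij_betw_inv_into_left e e_perm perm_def)

lemma perm_mult: "g \<in> carrier K \<Longrightarrow> h \<in> carrier K \<Longrightarrow> j \<in> N \<Longrightarrow> perm (g \<otimes> h) j = perm g (perm h j)"
  unfolding perm_def[of "g \<otimes> h"] perm_def[of g]
  using act_mult[OF _ _ e_mem, of g h j] e_perm[of h j] by simp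

lemma perm_one: "j \<in> N \<Longrightarrow> perm \<one> j = j"
  using eq_perm_iff[of \<one> j j] act_one[OF e_mem, of j] by simp

lemma the_perm: "h \<in> carrier K \<Longrightarrow> k \<in> N \<Longrightarrow> (THE j. j \<in> N \<and> e j = act h (e k)) = perm h k"
  by (rule the_equality) (auto simp: perm_mem e_perm eq_perm_iff)

lemma e_perm_inv: "g \<in> carrier K \<Longrightarrow> j \<in> N \<Longrightarrow> act (inv g) (e (perm g j)) = e j"
  by (simp only: e_perm act_inv_cancel e_mem)

text \<open>The cocycle identity at \<open>(\<one>, \<one>, g)\<close> with one factor cancelled.
  This and its mirror image force the unit 2-isomorphism to be multiplication by the value of
  \<open>c\<close> at \<open>(\<one>, \<one>)\<close>.\<close>

lemma c_one_left:
  assumes g: "g \<in> carrier K" and s: "s \<in> S"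
  shows "c (\<one>, g) s = c (\<one>, \<one>) s"
  using c_cocycle[of \<one> \<one> g s] c_nonzero[of \<one> g s] act_one[OF s] g s by simp

text \<open>The cocycle identity at \<open>(g, \<one>, \<one>)\<close>. The shift of
  \<open>s\<close> by the inverse of \<open>g\<close> accounts for the unit acting on the column
  index here and on the row index in the left condition.\<close>

lemma c_one_right:
  assumes g: "g \<in> carrier K" and s: "s \<in> S"
  shows "c (g, \<one>) s = c (\<one>, \<one>) (act (inv g) s)"
  using c_cocycle[of g \<one> \<one> s] c_nonzero[of g \<one> s] g s by simp

lemma R_entry: "g \<in> carrier K \<Longrightarrow> i \<in> N \<Longrightarrow> j \<in> N \<Longrightarrow>
    R g i j = (if i = perm g j then ground_space else zero_space)"
  by (simp add: set_rho_def eq_perm_iff)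

lemma R_perm: "g \<in> carrier K \<Longrightarrow> j \<in> N \<Longrightarrow> R g (perm g j) j = ground_space"
  by (simp add: R_entry perm_mem)

lemma R_mono: "g \<in> carrier K \<Longrightarrow> mono_mat (card S) (R g) (perm g) (\<lambda>_. 1)"
  unfolding mono_mat_def
  by (auto simp: R_entry perm_mem line_ground_space null_space_zero_space)

lemma R_thin: "g \<in> carrier K \<Longrightarrow> thin_mat (card S) (R g)"
  by (rule mono_mat_thin[OF R_mono])

text \<open>The pattern is written as a composite so that it is literally the pattern of the
  composite of the two matrices, as \<open>two_isoI\<close> requires.\<close>

lemma R_mult_mono: "g \<in> carrier K \<Longrightarrow> h \<in> carrier K \<Longrightarrow>
    mono_mat (card S) (R (g \<otimes> h)) (perm g \<circ> perm h) (\<lambda>_. 1)"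
  by (rule mono_mat_cong[OF R_mono]) (simp_all add: perm_mult)

lemma R_mem: "R \<in> carrier K \<rightarrow>\<^sub>E two_mats (card S)"
  by (auto simp: set_rho_def two_mats_def vec_space_ground_space vec_space_zero_space)

lemmas comp_mono = mono_mat_comp[OF R_mono R_mono]
lemmas comp_thin = mono_mat_thin[OF comp_mono]

section \<open>Multiplication by the cocycle as a 2-isomorphism\<close>

lemma \<Phi>_entry:
  assumes g: "g \<in> carrier K" and h: "h \<in> carrier K" and ik: "i \<in> N" "k \<in> N"
  shows "\<Phi> g h i k = (\<lambda>x\<in>carrier (R2 g h i k).
      if i = perm g (perm h k)
      then c (g, h) (e i) * tensor_lift ground_space ground_space ground_space (*) (x (perm h k))
      else \<zero>\<^bsub>R (g \<otimes> h) i k\<^esub>)"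
proof -
  have "e i = act (g \<otimes> h) (e k) \<longleftrightarrow> i = perm g (perm h k)"
    using eq_perm_iff[OF m_closed[OF g h] ik] perm_mult[OF g h ik(2)] by simp
  then show ?thesis
    using assms by (simp only: set_two_rep_def two_rep.simps restrict_apply' the_perm)
qed

lemma \<Phi>_ext: "\<Phi> = (\<lambda>g\<in>carrier K. \<lambda>h\<in>carrier K. \<Phi> g h)"
  by (auto simp: set_two_rep_def fun_eq_iff)

lemma \<Phi>_mem:
  assumes g: "g \<in> carrier K" and h: "h \<in> carrier K"
  shows "\<Phi> g h \<in> two_mors (card S) (R2 g h) (R (g \<otimes> h))"
proof -
  have "\<Phi> g h i k \<in> lin (R2 g h i k) (R (g \<otimes> h) i k)"
    if ik: "i \<in> N" "k \<in> N" for i k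
  proof (cases "i = perm g (perm h k)")
    case False
    then show ?thesis
      unfolding \<Phi>_entry[OF g h ik]
      using lin_zero_map[OF thin_matD[OF comp_thin[OF g h] ik] thin_matD[OF R_thin[OF m_closed[OF g h]] ik]]
      by simp
  next
    case True
    \<comment> \<open>Only this summand of the composite can be nonzero, so the entry is the
      projection to it, followed by multiplication of the two scalars and by the cocycle
      value.\<close>
    define j where "j = perm h k"
    have j: "j \<in> N" unfolding j_def by (rule perm_mem[OF h ik(2)])
    have ent: "R g i j = ground_space" "R h j k = ground_space" "R (g \<otimes> h) i k = ground_space"
      using R_perm[OF g j] R_perm[OF h ik(2)] R_entry[OF m_closed[OF g h] ik] True
      by (simp_all add: j_def perm_mult[OF g h ik(2)])
    let ?T = "tensor ground_space ground_space"
    let ?m = "tensor_lift ground_space ground_space ground_space (*)"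
    define f where "f = (\<lambda>x\<in>carrier ?T. c (g, h) (e i) * ?m x)"
    have tT: "thin ?T" by (intro thin_tensor line_thin[OF line_ground_space])
    have "f \<in> lin ?T ground_space"
      unfolding f_def using lin_add[OF mult_lift_lin] lin_smult[OF mult_lift_lin] tT
      by (intro linI) (auto simp: thin_add_closed thin_smult_closed algebra_simps)
    then have "(\<lambda>x\<in>carrier (R2 g h i k). f (x j))
        \<in> lin (R2 g h i k) ground_space"
      unfolding comp_mat_entry[OF ik]
      by (intro lin_direct_sum_proj[OF thin_mat_tensor[OF R_thin[OF g] R_thin[OF h] ik(1) _ ik(2)] j])
        (auto simp: ent)
    moreover have "x j \<in> carrier ?T" if "x \<in> carrier (R2 g h i k)" for x
      using that j ent by (auto simp: comp_mat_entry[OF ik] direct_sum_simps PiE_def Pi_def)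
    then have "\<Phi> g h i k = (\<lambda>x\<in>carrier (R2 g h i k). f (x j))"
      unfolding \<Phi>_entry[OF g h ik] f_def j_def using True by (auto simp: fun_eq_iff)
    ultimately show ?thesis by (simp add: ent)
  qed
  moreover have "\<Phi> g h = (\<lambda>i\<in>N. \<lambda>k\<in>N. \<Phi> g h i k)"
    using g h by (auto simp: set_two_rep_def fun_eq_iff)
  ultimately show ?thesis
    by (rule two_morsI[rotated])
qed

lemma \<Phi>_apply:
  assumes g: "g \<in> carrier K" and h: "h \<in> carrier K" and k: "k \<in> N"
    and j: "j = perm h k" and i: "i = perm g j"
  shows "\<Phi> g h i k (gen g h i j k z w) = c (g, h) (e i) * (z * w)"
proof -
  have jN: "j \<in> N" and iN: "i \<in> N" using perm_mem g h k by (simp_all only: i j)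
  have ent: "R g i j = ground_space" "R h j k = ground_space"
    using R_perm[OF g jN] R_perm[OF h k] by (simp_all add: i j)
  have "gen g h i j k z w \<in> carrier (R2 g h i k)"
    by (rule comp_gen_mem[OF R_thin[OF g] R_thin[OF h] iN jN k]) (simp_all add: ent)
  moreover have "gen g h i j k z w j = tens ground_space ground_space z w"
    using jN ent by (simp add: comp_gen_def summand_inj_def)
  ultimately show ?thesis
    unfolding \<Phi>_entry[OF g h iN k] by (simp add: i j mult_lift_tens)
qed

lemma \<Phi>_iso:
  assumes g: "g \<in> carrier K" and h: "h \<in> carrier K"
  shows "two_iso (card S) (R2 g h) (R (g \<otimes> h)) (\<Phi> g h)"
proof (rule two_isoI[OF comp_mono[OF g h] R_mult_mono[OF g h] \<Phi>_mem[OF g h]])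
  fix k assume k: "k \<in> N"
  note pk = perm_mem[OF h k]
  show "c (g, h) (e (perm g (perm h k))) \<noteq> 0"
    by (intro c_nonzero g h e_mem perm_mem[OF g pk])
  show "\<Phi> g h ((perm g \<circ> perm h) k) k
      (gen g h (perm g (perm h k)) (perm h k) k 1 1) =
    c (g, h) (e (perm g (perm h k))) \<odot>\<^bsub>R (g \<otimes> h) ((perm g \<circ> perm h) k) k\<^esub> 1"
    using \<Phi>_apply[OF g h k refl refl, of 1 1] R_perm[OF m_closed[OF g h] k]
    by (simp add: perm_mult[OF g h k])
qed

section \<open>The unit 2-isomorphism\<close>

lemma U_mem: "U \<in> two_mors (card S) (R \<one>) (id_mat (card S))"
proof -
  have "U i j \<in> lin (R \<one> i j) (id_mat (card S) i j)" if ij: "i \<in> N" "j \<in> N" for i j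
  proof (cases "i = j")
    case True
    then have "R \<one> i j = ground_space" "id_mat (card S) i j = ground_space"
      using R_perm[of \<one> j] ij perm_one[of j] by (simp_all add: id_mat_diag)
    then show ?thesis
      using ij True by (intro linI) (auto simp: set_two_rep_def algebra_simps)
  next
    case False
    then show ?thesis
      using lin_zero_map[OF thin_matD[OF R_thin ij] thin_matD[OF mono_mat_thin[OF mono_mat_id_mat] ij], of \<one>] ij
      by (simp add: set_two_rep_def)
  qed
  moreover have "U = (\<lambda>i\<in>N. \<lambda>j\<in>N. U i j)"
    by (auto simp: set_two_rep_def fun_eq_iff)
  ultimately show ?thesis
    by (rule two_morsI[rotated])
qed

lemma U_apply: "i \<in> N \<Longrightarrow> U i i z = c (\<one>, \<one>) (e i) * z"
  using R_perm[of \<one> i] perm_one[of i] by (simp add: set_two_rep_def)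

lemma U_iso: "two_iso (card S) (R \<one>) (id_mat (card S)) U"
proof (rule two_isoI[OF _ mono_mat_id_mat U_mem])
  show "mono_mat (card S) (R \<one>) id (\<lambda>_. 1)"
    by (rule mono_mat_cong[OF R_mono]) (simp_all add: perm_one)
  fix i assume i: "i \<in> N"
  show "c (\<one>, \<one>) (e i) \<noteq> 0" by (intro c_nonzero e_mem i one_closed)
  show "U (id i) i 1 = c (\<one>, \<one>) (e i) \<odot>\<^bsub>id_mat (card S) (id i) i\<^esub> 1"
    using U_apply[OF i] id_mat_diag[OF i] by simp
qed

text \<open>On the generator of column \<open>q\<close>, with \<open>k\<close>, \<open>j\<close>,
  \<open>i\<close> its successive images under \<open>l\<close>, \<open>h\<close>, \<open>g\<close>,
  the left side is \<open>c (g \<otimes> h, l) (e i) * c (g, h) (e i)\<close> and the right side is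
  \<open>c (h, l) (e j) * c (g, h \<otimes> l) (e i)\<close>. Since \<open>e j\<close> is the
  translate of \<open>e i\<close> by the inverse of \<open>g\<close>, their equality is the cocycle
  identity at \<open>e i\<close>.\<close>

lemma pentagon:
  fixes g h l
  defines "T \<equiv> comp_mat (card S) (R2 g h) (R l)"
  assumes g: "g \<in> carrier K" and h: "h \<in> carrier K" and l: "l \<in> carrier K"
  shows "vcomp (card S) T (\<Phi> (g \<otimes> h) l)
      (hcomp (card S) (R2 g h) (R l) (R (g \<otimes> h)) (R l)
         (\<Phi> g h) (id_mor (card S) (R l)))
    = vcomp (card S) T (\<Phi> g (h \<otimes> l))
        (vcomp (card S) T
           (hcomp (card S) (R g) (R2 h l) (R g) (R (h \<otimes> l))
              (id_mor (card S) (R g)) (\<Phi> h l))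
           (assoc_mor (card S) (R g) (R h) (R l)))"
    (is "vcomp ?n T ?a1 ?a2 = vcomp ?n T ?b1 (vcomp ?n T ?b2 ?b3)")
proof -
  note gh = m_closed[OF g h] and hl = m_closed[OF h l]
  note tg = R_thin[OF g] and th = R_thin[OF h] and tl = R_thin[OF l] and tgh = R_thin[OF gh] and thl = R_thin[OF hl]
  note cgh = comp_thin[OF g h] and chl = comp_thin[OF h l]
  have T: "mono_mat ?n T ((perm g \<circ> perm h) \<circ> perm l) (\<lambda>k. comp_gen ?n (R2 g h) (R l)
      ((perm g \<circ> perm h) (perm l k)) (perm l k) k
      (comp_gen ?n (R g) (R h) (perm g (perm h (perm l k))) (perm h (perm l k)) (perm l k) 1 1) 1)"
    (is "mono_mat _ _ _ ?gen")
    unfolding T_def by (rule mono_mat_comp[OF comp_mono[OF g h] R_mono[OF l]])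
  note tT = mono_mat_thin[OF T]
  note a2 = hcomp_mem[OF cgh tl tgh tl \<Phi>_mem[OF g h] id_mor_mem[OF tl], folded T_def]
  note b3 = assoc_mor_mem[OF R_mono[OF g] R_mono[OF h] R_mono[OF l], folded T_def]
  note b2 = hcomp_mem[OF tg chl tg thl id_mor_mem[OF tg] \<Phi>_mem[OF h l]]
  show ?thesis
  proof (rule two_mors_eqI[OF T R_thin[OF m_closed[OF gh l]]])
    show "vcomp ?n T ?a1 ?a2 \<in> two_mors ?n T (R (g \<otimes> h \<otimes> l))"
      by (rule vcomp_mem[OF tT a2 \<Phi>_mem[OF gh l]])
    show "vcomp ?n T ?b1 (vcomp ?n T ?b2 ?b3) \<in> two_mors ?n T (R (g \<otimes> h \<otimes> l))"
      using vcomp_mem[OF tT vcomp_mem[OF tT b3 b2] \<Phi>_mem[OF g hl]] by (simp add: m_assoc g h l)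
    fix q assume q: "q \<in> N"
    define k where "k = perm l q"
    define j where "j = perm h k"
    define i where "i = perm g j"
    have k: "k \<in> N" unfolding k_def by (rule perm_mem[OF l q])
    have j: "j \<in> N" unfolding j_def by (rule perm_mem[OF h k])
    have i: "i \<in> N" unfolding i_def by (rule perm_mem[OF g j])
    have gr: "R g i j = ground_space" "R h j k = ground_space" "R l k q = ground_space"
      using R_perm g h l j k q by (simp_all only: i_def j_def k_def)
    have un: "1 \<in> carrier (R g i j)" "1 \<in> carrier (R h j k)" "1 \<in> carrier (R l k q)"
      by (simp_all add: gr)
    let ?x = "comp_gen ?n (R g) (R h) i j k 1 1"
    let ?y = "comp_gen ?n (R h) (R l) j k q 1 1"
    let ?X = "comp_gen ?n (R2 g h) (R l) i k q ?x 1"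
    have x: "?x \<in> carrier (R2 g h i k)"
      by (rule comp_gen_mem[OF tg th i j k un(1,2)])
    have y: "?y \<in> carrier (R2 h l j q)"
      by (rule comp_gen_mem[OF th tl j k q un(2,3)])
    have X: "?X \<in> carrier (T i q)"
      unfolding T_def by (rule comp_gen_mem[OF cgh tl i k q x un(3)])
    have "vcomp ?n T ?a1 ?a2 i q ?X = \<Phi> (g \<otimes> h) l i q
        (comp_gen ?n (R (g \<otimes> h)) (R l) i k q (\<Phi> g h i k ?x) 1)"
      unfolding vcomp_apply[where A = T, OF i q X]
        hcomp_apply[OF cgh tl tgh tl \<Phi>_mem[OF g h] id_mor_mem[OF tl] i k q x un(3)]
        id_mor_apply[where A = "R l", OF k q un(3)] ..
    also have "\<dots> = c (g \<otimes> h, l) (e i) * c (g, h) (e i)"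
      using \<Phi>_apply[OF gh l q k_def, of i] \<Phi>_apply[OF g h k j_def i_def] perm_mult[OF g h k]
      by (simp add: i_def j_def)
    also have "\<dots> = c (h, l) (e j) * c (g, h \<otimes> l) (e i)"
      using c_cocycle[OF g h l e_mem[OF i]] e_perm_inv[OF g j] by (simp add: i_def)
    also have "\<dots> = \<Phi> g (h \<otimes> l) i q (comp_gen ?n (R g) (R (h \<otimes> l)) i j q 1 (\<Phi> h l j q ?y))"
      using \<Phi>_apply[OF g hl q _ i_def] \<Phi>_apply[OF h l q k_def j_def] perm_mult[OF h l q]
      by (simp add: j_def k_def)
    also have "\<dots> = vcomp ?n T ?b1 (vcomp ?n T ?b2 ?b3) i q ?X"
      unfolding vcomp_apply[where A = T, OF i q X]
        assoc_mor_apply[OF R_mono[OF g] R_mono[OF h] R_mono[OF l] i j k q un]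
        hcomp_apply[OF tg chl tg thl id_mor_mem[OF tg] \<Phi>_mem[OF h l] i j q un(1) y]
        id_mor_apply[where A = "R g", OF i j un(1)] ..
    finally show "vcomp ?n T ?a1 ?a2 (((perm g \<circ> perm h) \<circ> perm l) q) q (?gen q)
      = vcomp ?n T ?b1 (vcomp ?n T ?b2 ?b3) (((perm g \<circ> perm h) \<circ> perm l) q) q (?gen q)"
      by (simp add: i_def j_def k_def)
  qed
qed

text \<open>The left unitor composite reads \<open>u\<close> at the row index of the entry, whereas
  the right one reads it at the column index. Both are computed for arbitrary \<open>u\<close>,
  since uniqueness of the unit needs this too.\<close>

lemma left_unit_apply:
  assumes u: "u \<in> two_mors (card S) (R \<one>) (id_mat (card S))" and g: "g \<in> carrier K" and j: "j \<in> N"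
    and i: "i = perm g j"
  shows "lunit g u i j (gen \<one> g i i j 1 1) = u i i 1"
proof -
  have iN: "i \<in> N" unfolding i by (rule perm_mem[OF g j])
  note t1 = R_thin[OF one_closed] and tg = R_thin[OF g] and tid = mono_mat_thin[OF mono_mat_id_mat]
  have gr: "R \<one> i i = ground_space" "R g i j = ground_space"
    using R_perm[OF one_closed iN] R_perm[OF g j] perm_one[OF iN] by (simp_all add: i)
  have un: "1 \<in> carrier (R \<one> i i)" "1 \<in> carrier (R g i j)" by (simp_all add: gr)
  show ?thesis
    unfolding vcomp_apply[where A = "R2 \<one> g", OF iN j comp_gen_mem[OF t1 tg iN iN j un]]
      hcomp_apply[OF t1 tg tid tg u id_mor_mem[OF tg] iN iN j un] id_mor_apply[where A = "R g", OF iN j un(2)]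
      lunit_mor_apply[OF tg iN j un(2)]
    by (simp add: gr)
qed

lemma right_unit_apply:
  assumes u: "u \<in> two_mors (card S) (R \<one>) (id_mat (card S))" and g: "g \<in> carrier K" and j: "j \<in> N"
    and i: "i = perm g j"
  shows "runit g u i j (gen g \<one> i j j 1 1) = u j j 1"
proof -
  have iN: "i \<in> N" unfolding i by (rule perm_mem[OF g j])
  note t1 = R_thin[OF one_closed] and tg = R_thin[OF g] and tid = mono_mat_thin[OF mono_mat_id_mat]
  have gr: "R \<one> j j = ground_space" "R g i j = ground_space"
    using R_perm[OF one_closed j] R_perm[OF g j] perm_one[OF j] by (simp_all add: i)
  have un: "1 \<in> carrier (R g i j)" "1 \<in> carrier (R \<one> j j)" by (simp_all add: gr)
  show ?thesis
    unfolding vcomp_apply[where A = "R2 g \<one>", OF iN j comp_gen_mem[OF tg t1 iN j j un]]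
      hcomp_apply[OF tg t1 tg tid id_mor_mem[OF tg] u iN j j un] id_mor_apply[where A = "R g", OF iN j un(1)]
      runit_mor_apply[OF tg iN j un(1)]
    by (simp add: gr)
qed

text \<open>On generators the two conditions become the normalisation identities for
  \<open>c (\<one>, g)\<close> and \<open>c (g, \<one>)\<close>.\<close>

lemma U_unit_conditions: "unit_conditions K (card S) R \<Phi> U"
  unfolding unit_conditions_def
proof (intro ballI conjI)
  fix g assume g: "g \<in> carrier K"
  note t1 = R_thin[OF one_closed] and tg = R_thin[OF g] and tid = mono_mat_thin[OF mono_mat_id_mat]
  note m1g = comp_mono[OF one_closed g] and mg1 = comp_mono[OF g one_closed]
  show "\<Phi> \<one> g = lunit g U"
  proof (rule two_mors_eqI[OF m1g tg])
    show "\<Phi> \<one> g \<in> two_mors (card S) (R2 \<one> g) (R g)"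
      using \<Phi>_mem[OF one_closed g] g by simp
    show "lunit g U \<in> two_mors (card S) (R2 \<one> g) (R g)"
      by (rule vcomp_mem[OF mono_mat_thin[OF m1g] hcomp_mem[OF t1 tg tid tg U_mem id_mor_mem[OF tg]]
            lunit_mor_mem[OF tg]])
    fix j assume j: "j \<in> N"
    note p = perm_mem[OF g j]
    show "\<Phi> \<one> g ((perm \<one> \<circ> perm g) j) j
        (gen \<one> g (perm \<one> (perm g j)) (perm g j) j 1 1) =
      lunit g U ((perm \<one> \<circ> perm g) j) j
        (gen \<one> g (perm \<one> (perm g j)) (perm g j) j 1 1)"
      using \<Phi>_apply[OF one_closed g j refl refl, of 1 1] left_unit_apply[OF U_mem g j refl] U_apply[OF p, of 1]
        c_one_left[OF g e_mem[OF p]] perm_one[OF p] by simp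
  qed
  show "\<Phi> g \<one> = runit g U"
  proof (rule two_mors_eqI[OF mg1 tg])
    show "\<Phi> g \<one> \<in> two_mors (card S) (R2 g \<one>) (R g)"
      using \<Phi>_mem[OF g one_closed] g by simp
    show "runit g U \<in> two_mors (card S) (R2 g \<one>) (R g)"
      by (rule vcomp_mem[OF mono_mat_thin[OF mg1] hcomp_mem[OF tg t1 tg tid id_mor_mem[OF tg] U_mem]
            runit_mor_mem[OF tg]])
    fix j assume j: "j \<in> N"
    note p = perm_mem[OF g j]
    show "\<Phi> g \<one> ((perm g \<circ> perm \<one>) j) j
        (gen g \<one> (perm g (perm \<one> j)) (perm \<one> j) j 1 1) =
      runit g U ((perm g \<circ> perm \<one>) j) j
        (gen g \<one> (perm g (perm \<one> j)) (perm \<one> j) j 1 1)"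
      using \<Phi>_apply[OF g one_closed j refl refl, of 1 1] right_unit_apply[OF U_mem g j refl] U_apply[OF j, of 1]
        c_one_right[OF g e_mem[OF p]] e_perm_inv[OF g j] perm_one[OF j] by simp
  qed
qed

text \<open>The left condition at \<open>g = \<one>\<close> alone determines \<open>u\<close> on
  each diagonal generator. This uniqueness evaluates the unit of the induced 2-representation, which
  is specified only through its unit conditions.\<close>

lemma unit_conditions_unique:
  assumes u: "u \<in> two_mors (card S) (R \<one>) (id_mat (card S))" and "unit_conditions K (card S) R \<Phi> u"
  shows "u = U"
proof (rule two_mors_eqI[OF R_mono[OF one_closed] mono_mat_thin[OF mono_mat_id_mat] u U_mem])
  fix j assume j: "j \<in> N"
  have "\<Phi> \<one> \<one> = lunit \<one> u"
    using assms(2) one_closed unfolding unit_conditions_def by blast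
  then have "u j j 1 = c (\<one>, \<one>) (e j)"
    using left_unit_apply[OF u one_closed j refl] perm_one[OF j]
      \<Phi>_apply[OF one_closed one_closed j refl refl, of 1 1] by simp
  then show "u (perm \<one> j) j 1 = U (perm \<one> j) j 1"
    using perm_one[OF j] U_apply[OF j, of 1] by simp
qed

theorem set_two_rep_is_two_rep: "is_two_rep K (set_two_rep K S e act c)"
proof -
  have sel: "dim (set_two_rep K S e act c) = card S" "rho (set_two_rep K S e act c) = R"
    by (simp_all add: set_two_rep_def)
  have "\<Phi> \<in> (\<Pi>\<^sub>E g\<in>carrier K. \<Pi>\<^sub>E h\<in>carrier K.
      {\<alpha>. two_iso (card S) (R2 g h) (R (g \<otimes> h)) \<alpha>})"
    by (subst \<Phi>_ext) (simp add: \<Phi>_iso)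
  then show ?thesis
    unfolding is_two_rep_def sel Let_def
    by (intro conjI ballI is_group R_mem U_iso U_unit_conditions pentagon)
qed

lemma the_unit: "(THE u. two_iso (card S) (R \<one>) (id_mat (card S)) u \<and> unit_conditions K (card S) R \<Phi> u) = U"
  using U_iso U_unit_conditions unit_conditions_unique
  by (intro the_equality) (auto simp: two_iso_def)

end

end

section \<open>Second cohomology groups\<close>

lemma (in comm_group) comm_group_subgroup:
  assumes "subgroup H G"
  shows "comm_group (G\<lparr>carrier := H\<rparr>)"
proof (rule group.group_comm_groupI[OF subgroup_imp_group[OF assms]])
  show "x \<otimes>\<^bsub>G\<lparr>carrier := H\<rparr>\<^esub> y = y \<otimes>\<^bsub>G\<lparr>carrier := H\<rparr>\<^esub> x"
    if "x \<in> carrier (G\<lparr>carrier := H\<rparr>)" "y \<in> carrier (G\<lparr>carrier := H\<rparr>)" for x y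
    using that subgroup.mem_carrier[OF assms] by (simp add: m_comm)
qed

lemma (in comm_group) comm_group_product: "comm_group (product_group I (\<lambda>_. G))"
  by (rule group.group_comm_groupI) (auto simp: is_group PiE_iff intro!: restrict_ext m_comm)

text \<open>Cocycle groups and induced modules are both product groups with the carrier cut down;
  this gives their group structure and componentwise inverses at once.\<close>

lemma (in comm_group) subgroup_product:
  assumes "Z \<subseteq> (I \<rightarrow>\<^sub>E carrier G)"
    and "(\<lambda>i\<in>I. \<one>) \<in> Z"
    and "\<And>x y. x \<in> Z \<Longrightarrow> y \<in> Z \<Longrightarrow> (\<lambda>i\<in>I. x i \<otimes> y i) \<in> Z"
    and "\<And>x. x \<in> Z \<Longrightarrow> (\<lambda>i\<in>I. inv (x i)) \<in> Z"
  shows "comm_group ((product_group I (\<lambda>_. G))\<lparr>carrier := Z\<rparr>)"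
    and "x \<in> Z \<Longrightarrow> inv\<^bsub>(product_group I (\<lambda>_. G))\<lparr>carrier := Z\<rparr>\<^esub> x = (\<lambda>i\<in>I. inv (x i))"
proof -
  interpret P: comm_group "product_group I (\<lambda>_. G)" by (rule comm_group_product)
  have Z: "subgroup Z (product_group I (\<lambda>_. G))"
  proof (rule P.subgroupI)
    show "inv\<^bsub>product_group I (\<lambda>_. G)\<^esub> x \<in> Z" if "x \<in> Z" for x
      using that assms(1,4) by (subst inv_product_group) (auto simp: is_group)
  qed (use assms in auto)
  show "comm_group ((product_group I (\<lambda>_. G))\<lparr>carrier := Z\<rparr>)"
    by (rule P.comm_group_subgroup[OF Z])
  show "inv\<^bsub>(product_group I (\<lambda>_. G))\<lparr>carrier := Z\<rparr>\<^esub> x = (\<lambda>i\<in>I. inv (x i))" if "x \<in> Z"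
    using that assms(1) by (subst P.m_inv_consistent[OF Z that], subst inv_product_group) (auto simp: is_group)
qed

text \<open>The image of a coset of \<open>B\<close> need not be a full coset of \<open>B'\<close>;
  multiplying by \<open>B'\<close> completes it, and since \<phi> maps \<open>B\<close> into
  \<open>B'\<close> the result is a single coset.\<close>

lemma Mod_map_coset:
  assumes Z: "normal B Z" "normal B' Z'" and \<phi>: "\<phi> \<in> hom Z Z'" "\<phi> ` B \<subseteq> B'" and z: "z \<in> carrier Z"
  shows "B' <#>\<^bsub>Z'\<^esub> \<phi> ` (B #>\<^bsub>Z\<^esub> z) = B' #>\<^bsub>Z'\<^esub> \<phi> z"
proof -
  interpret B: normal B Z by fact
  interpret B': normal B' Z' by fact
  have cl: "\<phi> x \<in> carrier Z'" if "x \<in> carrier Z" for x using that \<phi>(1) by (auto simp: hom_def)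
  have eq: "b' \<otimes>\<^bsub>Z'\<^esub> \<phi> (b \<otimes>\<^bsub>Z\<^esub> z) = (b' \<otimes>\<^bsub>Z'\<^esub> \<phi> b) \<otimes>\<^bsub>Z'\<^esub> \<phi> z" if "b' \<in> B'" "b \<in> B" for b b'
    using that z \<phi>(1) by (simp add: hom_mult[OF \<phi>(1)] B'.m_assoc cl)
  show ?thesis
  proof (intro Set.set_eqI iffI)
    fix x assume "x \<in> B' <#>\<^bsub>Z'\<^esub> \<phi> ` (B #>\<^bsub>Z\<^esub> z)"
    then obtain b' b where b: "b' \<in> B'" "b \<in> B" "x = b' \<otimes>\<^bsub>Z'\<^esub> \<phi> (b \<otimes>\<^bsub>Z\<^esub> z)"
      by (auto simp: set_mult_def r_coset_def)
    moreover have "b' \<otimes>\<^bsub>Z'\<^esub> \<phi> b \<in> B'" using b \<phi>(2) by auto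
    ultimately show "x \<in> B' #>\<^bsub>Z'\<^esub> \<phi> z"
      by (auto simp: r_coset_def eq)
  next
    fix x assume "x \<in> B' #>\<^bsub>Z'\<^esub> \<phi> z"
    then obtain b' where b': "b' \<in> B'" "x = b' \<otimes>\<^bsub>Z'\<^esub> \<phi> z" by (auto simp: r_coset_def)
    have "z \<in> B #>\<^bsub>Z\<^esub> z" by (rule B.rcos_self[OF z B.subgroup_axioms])
    then show "x \<in> B' <#>\<^bsub>Z'\<^esub> \<phi> ` (B #>\<^bsub>Z\<^esub> z)" using b' by (auto simp: set_mult_def)
  qed
qed

text \<open>Bijectivity on quotients is reduced to two statements about representatives: only
  elements of \<open>B\<close> are sent into \<open>B'\<close>, and every coset of \<open>B'\<close>
  meets the image of \<phi>. The comparison maps on cohomology are shown to be isomorphisms in this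
  form.\<close>

lemma Mod_map_iso:
  assumes Z: "normal B Z" "normal B' Z'" and \<phi>: "\<phi> \<in> hom Z Z'" "\<phi> ` B \<subseteq> B'"
    and inj: "\<And>z. z \<in> carrier Z \<Longrightarrow> \<phi> z \<in> B' \<Longrightarrow> z \<in> B"
    and surj: "\<And>z'. z' \<in> carrier Z' \<Longrightarrow> \<exists>z\<in>carrier Z. B' #>\<^bsub>Z'\<^esub> \<phi> z = B' #>\<^bsub>Z'\<^esub> z'"
  shows "(\<lambda>u\<in>carrier (Z Mod B). B' <#>\<^bsub>Z'\<^esub> \<phi> ` u) \<in> iso (Z Mod B) (Z' Mod B')"
proof -
  interpret B: normal B Z by fact
  interpret B': normal B' Z' by fact
  interpret f: group_hom Z Z' \<phi> using \<phi>(1) by unfold_locales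
  let ?f = "\<lambda>u\<in>carrier (Z Mod B). B' <#>\<^bsub>Z'\<^esub> \<phi> ` u"
  have f: "?f (B #>\<^bsub>Z\<^esub> z) = B' #>\<^bsub>Z'\<^esub> \<phi> z" if "z \<in> carrier Z" for z
    using Mod_map_coset[OF Z \<phi> that] that by (auto simp: carrier_FactGroup)
  have "?f \<in> hom (Z Mod B) (Z' Mod B')"
  proof (rule homI)
    show "?f u \<in> carrier (Z' Mod B')" if "u \<in> carrier (Z Mod B)" for u
      using that f by (auto simp: carrier_FactGroup simp del: restrict_apply)
    show "?f (u \<otimes>\<^bsub>Z Mod B\<^esub> v) = ?f u \<otimes>\<^bsub>Z' Mod B'\<^esub> ?f v"
      if uv: "u \<in> carrier (Z Mod B)" "v \<in> carrier (Z Mod B)" for u v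
    proof -
      obtain x y where "x \<in> carrier Z" "u = B #>\<^bsub>Z\<^esub> x" "y \<in> carrier Z" "v = B #>\<^bsub>Z\<^esub> y"
        using uv by (auto simp: carrier_FactGroup)
      then show ?thesis
        by (simp add: f B.rcos_sum B'.rcos_sum del: restrict_apply)
    qed
  qed
  moreover have "inj_on ?f (carrier (Z Mod B))"
  proof (rule inj_onI)
    fix u v assume u: "u \<in> carrier (Z Mod B)" and v: "v \<in> carrier (Z Mod B)" and eq: "?f u = ?f v"
    obtain x y where x: "x \<in> carrier Z" "u = B #>\<^bsub>Z\<^esub> x" and y: "y \<in> carrier Z" "v = B #>\<^bsub>Z\<^esub> y"
      using u v by (auto simp: carrier_FactGroup)
    have "B' #>\<^bsub>Z'\<^esub> \<phi> x = B' #>\<^bsub>Z'\<^esub> \<phi> y" using eq unfolding x(2) y(2) f[OF x(1)] f[OF y(1)] .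
    then have "\<phi> x \<in> B' #>\<^bsub>Z'\<^esub> \<phi> y"
      using B'.rcos_self[OF f.hom_closed[OF x(1)] B'.subgroup_axioms] by simp
    then have "\<phi> x \<otimes>\<^bsub>Z'\<^esub> inv\<^bsub>Z'\<^esub> \<phi> y \<in> B'"
      using B'.rcos_module[OF B'.is_group] x y by simp
    then have "x \<otimes>\<^bsub>Z\<^esub> inv\<^bsub>Z\<^esub> y \<in> B" using x y by (intro inj) auto
    then have "x \<in> B #>\<^bsub>Z\<^esub> y" using B.rcos_module[OF B.is_group] x y by simp
    then show "u = v"
      using B.repr_independence[OF _ y(1) B.subgroup_axioms] x y by simp
  qed
  moreover have "carrier (Z' Mod B') \<subseteq> ?f ` carrier (Z Mod B)"
  proof
    fix u assume "u \<in> carrier (Z' Mod B')"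
    then obtain z' where "z' \<in> carrier Z'" "u = B' #>\<^bsub>Z'\<^esub> z'" by (auto simp: carrier_FactGroup)
    then obtain z where z: "z \<in> carrier Z" "u = B' #>\<^bsub>Z'\<^esub> \<phi> z" using surj by metis
    then show "u \<in> ?f ` carrier (Z Mod B)"
      using f[OF z(1)] by (intro image_eqI[of _ _ "B #>\<^bsub>Z\<^esub> z"]) (auto simp: carrier_FactGroup)
  qed
  ultimately show ?thesis
    unfolding iso_def bij_betw_def hom_def by blast
qed

section \<open>Modules, cocycles and coboundaries\<close>

locale group_module = K: group K + A: comm_group A
  for K :: "('g, 'm) monoid_scheme" and A :: "'a monoid" and act :: "'g \<Rightarrow> 'a \<Rightarrow> 'a" +
  assumes act_hom: "g \<in> carrier K \<Longrightarrow> act g \<in> hom A A"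
    and act_one: "a \<in> carrier A \<Longrightarrow> act \<one>\<^bsub>K\<^esub> a = a"
    and act_mult: "g \<in> carrier K \<Longrightarrow> h \<in> carrier K \<Longrightarrow> a \<in> carrier A \<Longrightarrow>
      act (g \<otimes>\<^bsub>K\<^esub> h) a = act g (act h a)"
begin

lemma act_closed [simp, intro]: "g \<in> carrier K \<Longrightarrow> a \<in> carrier A \<Longrightarrow> act g a \<in> carrier A"
  using act_hom by (auto simp: hom_def)

lemma act_mult_distrib: "g \<in> carrier K \<Longrightarrow> a \<in> carrier A \<Longrightarrow> b \<in> carrier A \<Longrightarrow>
    act g (a \<otimes>\<^bsub>A\<^esub> b) = act g a \<otimes>\<^bsub>A\<^esub> act g b"
  using hom_mult[OF act_hom] by blast

lemma act_group_hom: "g \<in> carrier K \<Longrightarrow> group_hom A A (act g)"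
  using act_hom by unfold_locales

lemma act_unit: "g \<in> carrier K \<Longrightarrow> act g \<one>\<^bsub>A\<^esub> = \<one>\<^bsub>A\<^esub>"
  using group_hom.hom_one[OF act_group_hom] .

lemma act_inv: "g \<in> carrier K \<Longrightarrow> a \<in> carrier A \<Longrightarrow> act g (inv\<^bsub>A\<^esub> a) = inv\<^bsub>A\<^esub> (act g a)"
  using group_hom.hom_inv[OF act_group_hom] .

abbreviation "Z \<equiv> cocycles2 K A act"
abbreviation "B \<equiv> coboundaries2 K A act"

definition cobdry :: "('g \<Rightarrow> 'a) \<Rightarrow> 'g \<times> 'g \<Rightarrow> 'a"
  where "cobdry b = (\<lambda>(g, h)\<in>carrier K \<times> carrier K.
    act g (b h) \<otimes>\<^bsub>A\<^esub> inv\<^bsub>A\<^esub> (b (g \<otimes>\<^bsub>K\<^esub> h)) \<otimes>\<^bsub>A\<^esub> b g)"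

lemma coboundaries2_eq: "B = cobdry ` (carrier K \<rightarrow>\<^sub>E carrier A)"
  by (simp add: coboundaries2_def cobdry_def)

lemma cobdry_apply: "g \<in> carrier K \<Longrightarrow> h \<in> carrier K \<Longrightarrow>
    cobdry b (g, h) = act g (b h) \<otimes>\<^bsub>A\<^esub> inv\<^bsub>A\<^esub> (b (g \<otimes>\<^bsub>K\<^esub> h)) \<otimes>\<^bsub>A\<^esub> b g"
  by (simp add: cobdry_def)

lemma cocycle_iff: "c \<in> carrier Z \<longleftrightarrow> c \<in> carrier K \<times> carrier K \<rightarrow>\<^sub>E carrier A \<and>
    (\<forall>g\<in>carrier K. \<forall>h\<in>carrier K. \<forall>l\<in>carrier K.
      act g (c (h, l)) \<otimes>\<^bsub>A\<^esub> c (g, h \<otimes>\<^bsub>K\<^esub> l) = c (g \<otimes>\<^bsub>K\<^esub> h, l) \<otimes>\<^bsub>A\<^esub> c (g, h))"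
  by (simp add: cocycles2_def)

lemma cocycle_closed: "c \<in> carrier Z \<Longrightarrow> g \<in> carrier K \<Longrightarrow> h \<in> carrier K \<Longrightarrow> c (g, h) \<in> carrier A"
  unfolding cocycle_iff by blast

lemma cocycle_eq: "c \<in> carrier Z \<Longrightarrow> g \<in> carrier K \<Longrightarrow> h \<in> carrier K \<Longrightarrow> l \<in> carrier K \<Longrightarrow>
    act g (c (h, l)) \<otimes>\<^bsub>A\<^esub> c (g, h \<otimes>\<^bsub>K\<^esub> l) = c (g \<otimes>\<^bsub>K\<^esub> h, l) \<otimes>\<^bsub>A\<^esub> c (g, h)"
  unfolding cocycle_iff by blast

lemma cocycles_mult: "x \<otimes>\<^bsub>Z\<^esub> y = (\<lambda>p\<in>carrier K \<times> carrier K. x p \<otimes>\<^bsub>A\<^esub> y p)"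
  by (simp add: cocycles2_def)

lemma comm_group_cocycles: "comm_group Z"
proof -
  let ?Z = "carrier Z"
  have 1: "?Z \<subseteq> (carrier K \<times> carrier K \<rightarrow>\<^sub>E carrier A)" by (intro subsetI) (simp only: cocycle_iff)
  have 2: "(\<lambda>p\<in>carrier K \<times> carrier K. \<one>\<^bsub>A\<^esub>) \<in> ?Z"
    by (auto simp: cocycle_iff act_unit)
  have 3: "(\<lambda>p\<in>carrier K \<times> carrier K. x p \<otimes>\<^bsub>A\<^esub> y p) \<in> ?Z" (is "?m \<in> _")
    if x: "x \<in> ?Z" and y: "y \<in> ?Z" for x y
    unfolding cocycle_iff
  proof (intro conjI ballI)
    fix g h l assume g: "g \<in> carrier K" and h: "h \<in> carrier K" and l: "l \<in> carrier K"
    note cl = cocycle_closed[OF x] cocycle_closed[OF y]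
    have "act g (x (h, l) \<otimes>\<^bsub>A\<^esub> y (h, l)) \<otimes>\<^bsub>A\<^esub> (x (g, h \<otimes>\<^bsub>K\<^esub> l) \<otimes>\<^bsub>A\<^esub> y (g, h \<otimes>\<^bsub>K\<^esub> l)) =
        (act g (x (h, l)) \<otimes>\<^bsub>A\<^esub> x (g, h \<otimes>\<^bsub>K\<^esub> l)) \<otimes>\<^bsub>A\<^esub> (act g (y (h, l)) \<otimes>\<^bsub>A\<^esub> y (g, h \<otimes>\<^bsub>K\<^esub> l))"
      using g h l by (simp add: act_mult_distrib cl A.m_ac)
    also have "\<dots> = (x (g \<otimes>\<^bsub>K\<^esub> h, l) \<otimes>\<^bsub>A\<^esub> y (g \<otimes>\<^bsub>K\<^esub> h, l)) \<otimes>\<^bsub>A\<^esub> (x (g, h) \<otimes>\<^bsub>A\<^esub> y (g, h))"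
      unfolding cocycle_eq[OF x g h l] cocycle_eq[OF y g h l]
      using g h l by (simp add: cl A.m_ac)
    finally show "act g (?m (h, l)) \<otimes>\<^bsub>A\<^esub> ?m (g, h \<otimes>\<^bsub>K\<^esub> l) = ?m (g \<otimes>\<^bsub>K\<^esub> h, l) \<otimes>\<^bsub>A\<^esub> ?m (g, h)"
      using g h l by simp
  qed (use cocycle_closed[OF x] cocycle_closed[OF y] in auto)
  have 4: "(\<lambda>p\<in>carrier K \<times> carrier K. inv\<^bsub>A\<^esub> (x p)) \<in> ?Z" (is "?m \<in> _")
    if x: "x \<in> ?Z" for x
    unfolding cocycle_iff
  proof (intro conjI ballI)
    fix g h l assume g: "g \<in> carrier K" and h: "h \<in> carrier K" and l: "l \<in> carrier K"
    note cl = cocycle_closed[OF x]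
    have "inv\<^bsub>A\<^esub> (act g (x (h, l)) \<otimes>\<^bsub>A\<^esub> x (g, h \<otimes>\<^bsub>K\<^esub> l)) = inv\<^bsub>A\<^esub> (x (g \<otimes>\<^bsub>K\<^esub> h, l) \<otimes>\<^bsub>A\<^esub> x (g, h))"
      using cocycle_eq[OF x g h l] by simp
    then show "act g (?m (h, l)) \<otimes>\<^bsub>A\<^esub> ?m (g, h \<otimes>\<^bsub>K\<^esub> l) = ?m (g \<otimes>\<^bsub>K\<^esub> h, l) \<otimes>\<^bsub>A\<^esub> ?m (g, h)"
      using g h l by (simp add: act_inv cl A.inv_mult)
  qed (use cocycle_closed[OF x] in auto)
  have eq: "Z = (product_group (carrier K \<times> carrier K) (\<lambda>_. A))\<lparr>carrier := ?Z\<rparr>"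
    by (simp add: cocycles2_def)
  show ?thesis
    by (subst eq) (rule A.subgroup_product(1)[OF 1 2 3 4])
qed

lemma cobdry_cocycle:
  assumes b: "b \<in> carrier K \<rightarrow> carrier A"
  shows "cobdry b \<in> carrier Z"
  unfolding cocycle_iff
proof (intro conjI ballI)
  have bc: "b g \<in> carrier A" if "g \<in> carrier K" for g using b that by blast
  show "cobdry b \<in> carrier K \<times> carrier K \<rightarrow>\<^sub>E carrier A"
    by (auto simp: cobdry_def bc)
  \<comment> \<open>In the application \<open>x\<close>, \<open>y\<close>, \<open>p\<close> are the
    images of \<open>b l\<close>, \<open>b (h \<otimes> l)\<close>, \<open>b h\<close> under
    \<open>g \<otimes> h\<close>, \<open>g\<close>, \<open>g\<close> respectively, \<open>q\<close>
    is the inverse of \<open>b (g \<otimes> h \<otimes> l)\<close>,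
    \<open>r = b (g \<otimes> h)\<close> and \<open>s = b g\<close>. Thus \<open>y\<close> cancels
    on the left and \<open>r\<close> on the right.\<close>
  have cancel: "(x \<otimes>\<^bsub>A\<^esub> inv\<^bsub>A\<^esub> y \<otimes>\<^bsub>A\<^esub> p) \<otimes>\<^bsub>A\<^esub> (y \<otimes>\<^bsub>A\<^esub> q \<otimes>\<^bsub>A\<^esub> s) = (x \<otimes>\<^bsub>A\<^esub> q \<otimes>\<^bsub>A\<^esub> r) \<otimes>\<^bsub>A\<^esub> (p \<otimes>\<^bsub>A\<^esub> inv\<^bsub>A\<^esub> r \<otimes>\<^bsub>A\<^esub> s)"
    if "x \<in> carrier A" "y \<in> carrier A" "p \<in> carrier A" "q \<in> carrier A" "r \<in> carrier A" "s \<in> carrier A"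
    for x y p q r s
  proof -
    have "(x \<otimes>\<^bsub>A\<^esub> inv\<^bsub>A\<^esub> y \<otimes>\<^bsub>A\<^esub> p) \<otimes>\<^bsub>A\<^esub> (y \<otimes>\<^bsub>A\<^esub> q \<otimes>\<^bsub>A\<^esub> s) = (x \<otimes>\<^bsub>A\<^esub> p \<otimes>\<^bsub>A\<^esub> q \<otimes>\<^bsub>A\<^esub> s) \<otimes>\<^bsub>A\<^esub> (y \<otimes>\<^bsub>A\<^esub> inv\<^bsub>A\<^esub> y)"
      using that by (simp only: A.m_ac A.inv_closed A.m_closed)
    also have "\<dots> = (x \<otimes>\<^bsub>A\<^esub> p \<otimes>\<^bsub>A\<^esub> q \<otimes>\<^bsub>A\<^esub> s) \<otimes>\<^bsub>A\<^esub> (r \<otimes>\<^bsub>A\<^esub> inv\<^bsub>A\<^esub> r)"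
      using that by simp
    also have "\<dots> = (x \<otimes>\<^bsub>A\<^esub> q \<otimes>\<^bsub>A\<^esub> r) \<otimes>\<^bsub>A\<^esub> (p \<otimes>\<^bsub>A\<^esub> inv\<^bsub>A\<^esub> r \<otimes>\<^bsub>A\<^esub> s)"
      using that by (simp only: A.m_ac A.inv_closed A.m_closed)
    finally show ?thesis .
  qed
  fix g h l assume g: "g \<in> carrier K" and h: "h \<in> carrier K" and l: "l \<in> carrier K"
  show "act g (cobdry b (h, l)) \<otimes>\<^bsub>A\<^esub> cobdry b (g, h \<otimes>\<^bsub>K\<^esub> l) =
      cobdry b (g \<otimes>\<^bsub>K\<^esub> h, l) \<otimes>\<^bsub>A\<^esub> cobdry b (g, h)"
    using g h l
    by (simp add: cobdry_apply act_mult_distrib act_inv act_mult bc K.m_assoc cancel)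
qed

text \<open>Coboundaries are the image of a homomorphism from the product group of all
  1-cochains.\<close>

lemma subgroup_coboundaries: "subgroup B Z"
proof -
  interpret Z: comm_group Z by (rule comm_group_cocycles)
  let ?C = "product_group (carrier K) (\<lambda>_. A)"
  interpret C: comm_group ?C by (rule A.comm_group_product)
  have "cobdry \<in> hom ?C Z"
  proof (rule homI)
    fix b b' assume "b \<in> carrier ?C" "b' \<in> carrier ?C"
    then have bc: "b g \<in> carrier A" "b' g \<in> carrier A" if "g \<in> carrier K" for g using that by auto
    have "cobdry (b \<otimes>\<^bsub>?C\<^esub> b') (g, h) = (cobdry b \<otimes>\<^bsub>Z\<^esub> cobdry b') (g, h)"
      if "g \<in> carrier K" "h \<in> carrier K" for g h
      using that by (simp add: cobdry_apply cocycles_mult act_mult_distrib bc A.inv_mult)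
        (simp only: A.m_ac A.inv_closed A.m_closed bc act_closed K.m_closed)
    then show "cobdry (b \<otimes>\<^bsub>?C\<^esub> b') = cobdry b \<otimes>\<^bsub>Z\<^esub> cobdry b'"
      by (intro ext) (auto simp: cobdry_def cocycles_mult)
  qed (auto intro!: cobdry_cocycle)
  then interpret d: group_hom ?C Z cobdry by unfold_locales
  show ?thesis
    using d.img_is_subgroup by (simp add: coboundaries2_eq)
qed

lemma normal_coboundaries: "normal B Z"
  using comm_group.normal_iff_subgroup[OF comm_group_cocycles] subgroup_coboundaries by blast

lemma carrier_H2: "carrier (H2 K A act) = H2_class K A act ` carrier Z"
  by (simp add: H2_def carrier_FactGroup H2_class_def)

lemma H2_class_mult_coboundary:
  assumes "z \<in> carrier Z" "b \<in> B"
  shows "H2_class K A act (b \<otimes>\<^bsub>Z\<^esub> z) = H2_class K A act z"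
proof -
  interpret Z: comm_group Z by (rule comm_group_cocycles)
  show ?thesis
    unfolding H2_class_def using assms subgroup.mem_carrier[OF subgroup_coboundaries]
    by (intro Z.repr_independence[symmetric] subgroup_coboundaries) (auto simp: r_coset_def)
qed

end

text \<open>Restriction to a subgroup and a change of coefficients are treated as one map, with
  \<open>f\<close> equivariant only under the subgroup. Taking \<open>H\<close> to be the whole
  carrier gives pure changes of coefficients.\<close>

locale module_map = M: group_module K A act + M': group_module "K\<lparr>carrier := H\<rparr>" A' act'
  for K :: "('g, 'm) monoid_scheme" and A :: "'a monoid" and act
    and H and A' :: "'b monoid" and act' +
  fixes f :: "'a \<Rightarrow> 'b"
  assumes H: "subgroup H K" and f: "f \<in> hom A A'"
    and equivariant: "g \<in> H \<Longrightarrow> a \<in> carrier A \<Longrightarrow> f (act g a) = act' g (f a)"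
begin

definition res :: "('g \<times> 'g \<Rightarrow> 'a) \<Rightarrow> 'g \<times> 'g \<Rightarrow> 'b"
  where "res c = (\<lambda>p\<in>H \<times> H. f (c p))"

lemma res_hom: "res \<in> hom M.Z M'.Z"
  and res_coboundary: "res ` M.B \<subseteq> M'.B"
proof -
  note HK = subgroup.mem_carrier[OF H]
  interpret f: group_hom A A' f using f by unfold_locales
  note cl = subgroup.m_closed[OF H]
  show "res \<in> hom M.Z M'.Z"
  proof (rule homI)
    fix x assume x: "x \<in> carrier M.Z"
    show "res x \<in> carrier M'.Z"
      unfolding M'.cocycle_iff
    proof (intro conjI ballI)
      fix g h l assume "g \<in> carrier (K\<lparr>carrier := H\<rparr>)" "h \<in> carrier (K\<lparr>carrier := H\<rparr>)" "l \<in> carrier (K\<lparr>carrier := H\<rparr>)"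
      then have ghl: "g \<in> H" "h \<in> H" "l \<in> H" by auto
      have "f (act g (x (h, l)) \<otimes>\<^bsub>A\<^esub> x (g, h \<otimes>\<^bsub>K\<^esub> l)) = f (x (g \<otimes>\<^bsub>K\<^esub> h, l) \<otimes>\<^bsub>A\<^esub> x (g, h))"
        using M.cocycle_eq[OF x] ghl HK by simp
      then show "act' g (res x (h, l)) \<otimes>\<^bsub>A'\<^esub> res x (g, h \<otimes>\<^bsub>K\<lparr>carrier := H\<rparr>\<^esub> l) =
          res x (g \<otimes>\<^bsub>K\<lparr>carrier := H\<rparr>\<^esub> h, l) \<otimes>\<^bsub>A'\<^esub> res x (g, h)"
        using ghl M.cocycle_closed[OF x] HK by (simp add: res_def cl equivariant)
    qed (use M.cocycle_closed[OF x] HK in \<open>auto simp: res_def\<close>)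
  next
    fix x y assume "x \<in> carrier M.Z" "y \<in> carrier M.Z"
    then show "res (x \<otimes>\<^bsub>M.Z\<^esub> y) = res x \<otimes>\<^bsub>M'.Z\<^esub> res y"
      using M.cocycle_closed HK by (auto simp: res_def M.cocycles_mult M'.cocycles_mult fun_eq_iff)
  qed
  show "res ` M.B \<subseteq> M'.B"
  proof
    fix z assume "z \<in> res ` M.B"
    then obtain b where b: "b \<in> carrier K \<rightarrow>\<^sub>E carrier A" "z = res (M.cobdry b)"
      by (auto simp: M.coboundaries2_eq)
    have "z = M'.cobdry (\<lambda>h\<in>H. f (b h))"
      using b HK PiE_mem[OF b(1)]
      by (auto simp: res_def M.cobdry_def M'.cobdry_def fun_eq_iff cl equivariant)
    moreover have "(\<lambda>h\<in>H. f (b h)) \<in> carrier (K\<lparr>carrier := H\<rparr>) \<rightarrow>\<^sub>E carrier A'"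
      using PiE_mem[OF b(1)] HK by auto
    ultimately show "z \<in> M'.B" by (auto simp: M'.coboundaries2_eq)
  qed
qed

abbreviation "h2map \<equiv> H2_map K A act (K\<lparr>carrier := H\<rparr>) A' act' f"
abbreviation "cls' \<equiv> H2_class (K\<lparr>carrier := H\<rparr>) A' act'"

lemma h2map_eq: "h2map = (\<lambda>u\<in>carrier (H2 K A act). M'.B <#>\<^bsub>M'.Z\<^esub> res ` u)"
  by (simp add: H2_map_def res_def[abs_def])

lemma map_class:
  assumes c: "c \<in> carrier M.Z"
  shows "h2map (H2_class K A act c) = cls' (res c)"
proof -
  have cls: "H2_class K A act c \<in> carrier (H2 K A act)"
    using M.carrier_H2 c by blast
  show ?thesis
    unfolding h2map_eq restrict_apply'[OF cls] unfolding H2_class_def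
    by (rule Mod_map_coset[OF M.normal_coboundaries M'.normal_coboundaries res_hom res_coboundary c])
qed

lemma map_iso:
  assumes "\<And>c. c \<in> carrier M.Z \<Longrightarrow> res c \<in> M'.B \<Longrightarrow> c \<in> M.B"
    and "\<And>c'. c' \<in> carrier M'.Z \<Longrightarrow> \<exists>c\<in>carrier M.Z. cls' (res c) = cls' c'"
  shows "h2map \<in> iso (H2 K A act) (H2 (K\<lparr>carrier := H\<rparr>) A' act')"
  unfolding h2map_eq unfolding H2_def
  by (rule Mod_map_iso[OF M.normal_coboundaries M'.normal_coboundaries res_hom res_coboundary])
    (use assms in \<open>auto simp: H2_class_def\<close>)

end

section \<open>Shapiro's lemma in degree two\<close>

text \<open>The hypotheses are cocycle identities on the three tetrahedra
  \<open>(x, \<pi> x, \<pi> y, \<pi> z)\<close>, \<open>(x, y, \<pi> y, \<pi> z)\<close> and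
  \<open>(x, y, z, \<pi> z)\<close> that fill the prism over the triangle \<open>(x, y, z)\<close>.
  The shared interior faces \<open>r = f x (\<pi> y) (\<pi> z)\<close> and
  \<open>u = f x y (\<pi> z)\<close> are eliminated; the bottom face \<open>y\<close>, the top face
  \<open>p\<close> and the triangles of the side walls remain.\<close>

lemma (in comm_group) prism_identity:
  assumes car: "p \<in> carrier G" "q \<in> carrier G" "r \<in> carrier G" "s \<in> carrier G" "t \<in> carrier G"
      "u \<in> carrier G" "v \<in> carrier G" "w \<in> carrier G" "x \<in> carrier G" "y \<in> carrier G"
    and eq: "p \<otimes> q = r \<otimes> s" "t \<otimes> u = r \<otimes> v" "w \<otimes> u = x \<otimes> y"
  shows "p = y \<otimes> ((t \<otimes> inv w) \<otimes> inv (q \<otimes> inv x) \<otimes> (s \<otimes> inv v))"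
proof -
  have "r = (t \<otimes> u) \<otimes> inv v" using car eq(2) by (metis inv_solve_right m_closed)
  moreover have "u = (x \<otimes> y) \<otimes> inv w" using car eq(3) by (metis inv_solve_right m_closed m_comm)
  moreover have "p = (r \<otimes> s) \<otimes> inv q" using car eq(1) by (metis inv_solve_right m_closed)
  ultimately have "p = ((t \<otimes> ((x \<otimes> y) \<otimes> inv w)) \<otimes> inv v \<otimes> s) \<otimes> inv q" by simp
  also have "\<dots> = y \<otimes> ((t \<otimes> inv w) \<otimes> (inv q \<otimes> x) \<otimes> (s \<otimes> inv v))"
    using car by (simp only: m_ac m_closed inv_closed)
  also have "inv q \<otimes> x = inv (q \<otimes> inv x)" using car by (simp add: inv_mult)
  finally show ?thesis .
qed

locale group_with_subgroup = group G
  for G :: "('g, 'm) monoid_scheme" (structure) +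
  fixes H :: "'g set"
  assumes H: "subgroup H G"
begin

lemma H_mem [simp]: "h \<in> H \<Longrightarrow> h \<in> carrier G"
  by (rule subgroup.mem_carrier[OF H])

lemma H_closed [simp]: "h \<in> H \<Longrightarrow> k \<in> H \<Longrightarrow> h \<otimes> k \<in> H" "h \<in> H \<Longrightarrow> inv h \<in> H" "\<one> \<in> H"
  using H by (auto simp: subgroup.m_closed subgroup.m_inv_closed subgroup.one_closed)

lemma inv_cancel [simp]:
  "x \<in> carrier G \<Longrightarrow> y \<in> carrier G \<Longrightarrow> inv x \<otimes> (x \<otimes> y) = y"
  "x \<in> carrier G \<Longrightarrow> y \<in> carrier G \<Longrightarrow> x \<otimes> (inv x \<otimes> y) = y"
  by (simp_all flip: m_assoc)

end

text \<open>An equivariant \<pi> exists because left translation by \<open>H\<close> on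
  \<open>G\<close> is free; it compares the homogeneous cochains on the two sets. It need not fix
  \<open>H\<close> pointwise: if the coset \<open>H\<close> is represented by an element other than
  \<one>, then \<open>\<pi> \<one> \<noteq> \<one>\<close>.\<close>

locale coinduction = group_with_subgroup G H + M: group_module "G\<lparr>carrier := H\<rparr>" A act
  for G :: "('g, 'm) monoid_scheme" (structure) and H :: "'g set" and A :: "'a monoid"
    and act :: "'g \<Rightarrow> 'a \<Rightarrow> 'a" +
  fixes \<pi> :: "'g \<Rightarrow> 'g"
  assumes \<pi>_mem: "y \<in> carrier G \<Longrightarrow> \<pi> y \<in> H"
    and \<pi>_equiv: "h \<in> H \<Longrightarrow> y \<in> carrier G \<Longrightarrow> \<pi> (h \<otimes> y) = h \<otimes> \<pi> y"
begin

abbreviation "I \<equiv> ind_module G H A act"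
abbreviation "\<iota> \<equiv> ind_module_act G"

lemma act_simps [simp]:
  "h \<in> H \<Longrightarrow> a \<in> carrier A \<Longrightarrow> act h a \<in> carrier A"
  "h \<in> H \<Longrightarrow> a \<in> carrier A \<Longrightarrow> b \<in> carrier A \<Longrightarrow> act h (a \<otimes>\<^bsub>A\<^esub> b) = act h a \<otimes>\<^bsub>A\<^esub> act h b"
  "h \<in> H \<Longrightarrow> a \<in> carrier A \<Longrightarrow> act h (inv\<^bsub>A\<^esub> a) = inv\<^bsub>A\<^esub> (act h a)"
  "h \<in> H \<Longrightarrow> act h \<one>\<^bsub>A\<^esub> = \<one>\<^bsub>A\<^esub>"
  "a \<in> carrier A \<Longrightarrow> act \<one> a = a"
  using M.act_closed M.act_mult_distrib M.act_inv M.act_unit M.act_one by auto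

lemma act_act: "h \<in> H \<Longrightarrow> k \<in> H \<Longrightarrow> a \<in> carrier A \<Longrightarrow> act (h \<otimes> k) a = act h (act k a)"
  using M.act_mult by simp

lemma ind_mem_iff: "F \<in> carrier I \<longleftrightarrow> F \<in> carrier G \<rightarrow>\<^sub>E carrier A \<and>
    (\<forall>x\<in>carrier G. \<forall>h\<in>H. F (x \<otimes> h) = act (inv h) (F x))"
  by (simp add: ind_module_def)

lemma ind_closed: "F \<in> carrier I \<Longrightarrow> x \<in> carrier G \<Longrightarrow> F x \<in> carrier A"
  unfolding ind_mem_iff by blast

lemma ind_equiv: "F \<in> carrier I \<Longrightarrow> x \<in> carrier G \<Longrightarrow> h \<in> H \<Longrightarrow> F (x \<otimes> h) = act (inv h) (F x)"
  unfolding ind_mem_iff by blast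

lemma ind_mult: "F \<otimes>\<^bsub>I\<^esub> F' = (\<lambda>x\<in>carrier G. F x \<otimes>\<^bsub>A\<^esub> F' x)"
  by (simp add: ind_module_def)

lemma
  shows comm_group_ind: "comm_group I"
    and ind_inv: "F \<in> carrier I \<Longrightarrow> inv\<^bsub>I\<^esub> F = (\<lambda>x\<in>carrier G. inv\<^bsub>A\<^esub> (F x))"
proof -
  let ?I = "carrier I"
  have 1: "?I \<subseteq> (carrier G \<rightarrow>\<^sub>E carrier A)" by (intro subsetI) (simp only: ind_mem_iff)
  have 2: "(\<lambda>x\<in>carrier G. \<one>\<^bsub>A\<^esub>) \<in> ?I"
    by (simp add: ind_mem_iff)
  have 3: "(\<lambda>x\<in>carrier G. F x \<otimes>\<^bsub>A\<^esub> F' x) \<in> ?I" if "F \<in> ?I" "F' \<in> ?I" for F F'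
    using that by (auto simp: ind_mem_iff PiE_iff)
  have 4: "(\<lambda>x\<in>carrier G. inv\<^bsub>A\<^esub> (F x)) \<in> ?I" if "F \<in> ?I" for F
    using that by (auto simp: ind_mem_iff PiE_iff)
  have eq: "I = (product_group (carrier G) (\<lambda>_. A))\<lparr>carrier := ?I\<rparr>"
    by (simp add: ind_module_def)
  show "comm_group I"
    by (subst eq) (rule M.A.subgroup_product(1)[OF 1 2 3 4])
  show "inv\<^bsub>I\<^esub> F = (\<lambda>x\<in>carrier G. inv\<^bsub>A\<^esub> (F x))" if "F \<in> ?I"
    by (subst eq) (rule M.A.subgroup_product(2)[OF 1 2 3 4 that])
qed

lemma group_module_ind: "group_module G I \<iota>"
proof -
  interpret I: comm_group I by (rule comm_group_ind)
  show ?thesis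
  proof unfold_locales
    fix g assume g: "g \<in> carrier G"
    show "\<iota> g \<in> hom I I"
      using g by (intro homI) (auto simp: ind_module_act_def ind_mem_iff ind_mult PiE_iff fun_eq_iff
          simp flip: m_assoc)
  next
    fix F assume "F \<in> carrier I"
    then have F: "F \<in> carrier G \<rightarrow>\<^sub>E carrier A" by (simp add: ind_mem_iff)
    then show "\<iota> \<one> F = F"
      by (auto simp: ind_module_act_def fun_eq_iff PiE_iff extensional_def)
    fix g h assume "g \<in> carrier G" "h \<in> carrier G"
    then show "\<iota> (g \<otimes> h) F = \<iota> g (\<iota> h F)"
      by (auto simp: ind_module_act_def fun_eq_iff inv_mult_group m_assoc)
  qed
qed

sublocale ind: group_module G I \<iota>
  by (rule group_module_ind)

text \<open>
  Homogeneous cochains: \<open>F(g\<^sub>1, g\<^sub>2)(x)\<close> corresponds to \<open>f(x\<^sup>-\<^sup>1, x\<^sup>-\<^sup>1 g\<^sub>1, x\<^sup>-\<^sup>1 g\<^sub>1 g\<^sub>2)\<close>, so that the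
  cochains of \<open>G\<close> with values in the induced module and those of \<open>H\<close> with values in \<open>A\<close> are the
  \<open>H\<close>-equivariant functions on tuples from \<open>G\<close> and from \<open>H\<close>, respectively.
\<close>

definition homog :: "'g set \<Rightarrow> ('g \<Rightarrow> 'g \<Rightarrow> 'g \<Rightarrow> 'a) \<Rightarrow> bool"
  where "homog E f \<longleftrightarrow>
    (\<forall>x\<in>E. \<forall>y\<in>E. \<forall>z\<in>E. f x y z \<in> carrier A) \<and>
    (\<forall>h\<in>H. \<forall>x\<in>E. \<forall>y\<in>E. \<forall>z\<in>E. f (h \<otimes> x) (h \<otimes> y) (h \<otimes> z) = act h (f x y z)) \<and>
    (\<forall>x\<in>E. \<forall>y\<in>E. \<forall>z\<in>E. \<forall>w\<in>E. f y z w \<otimes>\<^bsub>A\<^esub> f x y w = f x z w \<otimes>\<^bsub>A\<^esub> f x y z)"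

definition equivar :: "'g set \<Rightarrow> ('g \<Rightarrow> 'g \<Rightarrow> 'a) \<Rightarrow> bool"
  where "equivar E b \<longleftrightarrow>
    (\<forall>x\<in>E. \<forall>y\<in>E. b x y \<in> carrier A) \<and>
    (\<forall>h\<in>H. \<forall>x\<in>E. \<forall>y\<in>E. b (h \<otimes> x) (h \<otimes> y) = act h (b x y))"

definition delta :: "('g \<Rightarrow> 'g \<Rightarrow> 'a) \<Rightarrow> 'g \<Rightarrow> 'g \<Rightarrow> 'g \<Rightarrow> 'a"
  where "delta b x y z = b y z \<otimes>\<^bsub>A\<^esub> inv\<^bsub>A\<^esub> (b x z) \<otimes>\<^bsub>A\<^esub> b x y"

definition homG :: "('g \<times> 'g \<Rightarrow> 'g \<Rightarrow> 'a) \<Rightarrow> 'g \<Rightarrow> 'g \<Rightarrow> 'g \<Rightarrow> 'a"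
  where "homG F x y z = F (inv x \<otimes> y, inv y \<otimes> z) (inv x)"

definition homH :: "('g \<times> 'g \<Rightarrow> 'a) \<Rightarrow> 'g \<Rightarrow> 'g \<Rightarrow> 'g \<Rightarrow> 'a"
  where "homH c x y z = act x (c (inv x \<otimes> y, inv y \<otimes> z))"

text \<open>The square with vertices \<open>x\<close>, \<open>y\<close>, \<open>\<pi> x\<close>,
  \<open>\<pi> y\<close> is cut along the diagonal from \<open>x\<close> to \<open>\<pi> y\<close>,
  and the two triangles enter with opposite signs.\<close>

definition prism :: "('g \<Rightarrow> 'g \<Rightarrow> 'g \<Rightarrow> 'a) \<Rightarrow> 'g \<Rightarrow> 'g \<Rightarrow> 'a"
  where "prism f x y = f x (\<pi> x) (\<pi> y) \<otimes>\<^bsub>A\<^esub> inv\<^bsub>A\<^esub> (f x y (\<pi> y))"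

lemma homog_closed: "homog E f \<Longrightarrow> x \<in> E \<Longrightarrow> y \<in> E \<Longrightarrow> z \<in> E \<Longrightarrow> f x y z \<in> carrier A"
  and homog_equiv: "homog E f \<Longrightarrow> h \<in> H \<Longrightarrow> x \<in> E \<Longrightarrow> y \<in> E \<Longrightarrow> z \<in> E \<Longrightarrow>
    f (h \<otimes> x) (h \<otimes> y) (h \<otimes> z) = act h (f x y z)"
  and homog_cocycle: "homog E f \<Longrightarrow> x \<in> E \<Longrightarrow> y \<in> E \<Longrightarrow> z \<in> E \<Longrightarrow> w \<in> E \<Longrightarrow>
    f y z w \<otimes>\<^bsub>A\<^esub> f x y w = f x z w \<otimes>\<^bsub>A\<^esub> f x y z"
  unfolding homog_def by blast+

lemma equivar_closed: "equivar E b \<Longrightarrow> x \<in> E \<Longrightarrow> y \<in> E \<Longrightarrow> b x y \<in> carrier A"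
  and equivar_equiv: "equivar E b \<Longrightarrow> h \<in> H \<Longrightarrow> x \<in> E \<Longrightarrow> y \<in> E \<Longrightarrow>
    b (h \<otimes> x) (h \<otimes> y) = act h (b x y)"
  unfolding equivar_def by blast+

text \<open>Equivariance under \<open>H\<close> is the condition defining the induced module, read
  at \<open>inv x\<close>. For the cocycle identity the translation action of
  \<open>inv x \<otimes> y\<close> moves the evaluation point from \<open>inv x\<close> to
  \<open>inv y\<close>.\<close>

lemma homG_homog:
  assumes F: "F \<in> carrier ind.Z"
  shows "homog (carrier G) (homG F)"
  unfolding homog_def
proof (intro conjI ballI)
  fix x y z assume xyz: "x \<in> carrier G" "y \<in> carrier G" "z \<in> carrier G"
  then have F1: "F (inv x \<otimes> y, inv y \<otimes> z) \<in> carrier I" by (simp add: ind.cocycle_closed[OF F])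
  then show "homG F x y z \<in> carrier A" using xyz by (simp add: homG_def ind_closed)
  show "homG F (h \<otimes> x) (h \<otimes> y) (h \<otimes> z) = act h (homG F x y z)" if h: "h \<in> H" for h
    using xyz h ind_equiv[OF F1, of "inv x" "inv h"]
    by (simp add: homG_def inv_mult_group m_assoc)
  fix w assume w: "w \<in> carrier G"
  let ?g = "inv x \<otimes> y" and ?h = "inv y \<otimes> z" and ?l = "inv z \<otimes> w"
  have "(\<iota> ?g (F (?h, ?l)) \<otimes>\<^bsub>I\<^esub> F (?g, ?h \<otimes> ?l)) (inv x) = (F (?g \<otimes> ?h, ?l) \<otimes>\<^bsub>I\<^esub> F (?g, ?h)) (inv x)"
    using xyz w by (subst ind.cocycle_eq[OF F]) auto
  then show "homG F y z w \<otimes>\<^bsub>A\<^esub> homG F x y w = homG F x z w \<otimes>\<^bsub>A\<^esub> homG F x y z"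
    using xyz w by (simp add: homG_def ind_mult ind_module_act_def inv_mult_group m_assoc)
qed

text \<open>The cocycle identity for \<open>inv x \<otimes> y\<close>,
  \<open>inv y \<otimes> z\<close>, \<open>inv z \<otimes> w\<close>, acted on by
  \<open>x\<close>.\<close>

lemma homH_homog:
  assumes c: "c \<in> carrier M.Z"
  shows "homog H (homH c)"
  unfolding homog_def
proof (intro conjI ballI)
  have cl: "c (g, h) \<in> carrier A" if "g \<in> H" "h \<in> H" for g h
    using M.cocycle_closed[OF c] that by simp
  fix x y z assume xyz: "x \<in> H" "y \<in> H" "z \<in> H"
  then show "homH c x y z \<in> carrier A" by (simp add: homH_def cl)
  show "homH c (h \<otimes> x) (h \<otimes> y) (h \<otimes> z) = act h (homH c x y z)" if h: "h \<in> H" for h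
    using xyz h by (simp add: homH_def inv_mult_group m_assoc act_act cl)
  fix w assume w: "w \<in> H"
  let ?g = "inv x \<otimes> y" and ?h = "inv y \<otimes> z" and ?l = "inv z \<otimes> w"
  have "act ?g (c (?h, ?l)) \<otimes>\<^bsub>A\<^esub> c (?g, ?h \<otimes> ?l) = c (?g \<otimes> ?h, ?l) \<otimes>\<^bsub>A\<^esub> c (?g, ?h)"
    using M.cocycle_eq[OF c, of ?g ?h ?l] xyz w by simp
  then have "act x (act ?g (c (?h, ?l)) \<otimes>\<^bsub>A\<^esub> c (?g, ?h \<otimes> ?l)) = act x (c (?g \<otimes> ?h, ?l) \<otimes>\<^bsub>A\<^esub> c (?g, ?h))"
    by simp
  then show "homH c y z w \<otimes>\<^bsub>A\<^esub> homH c x y w = homH c x z w \<otimes>\<^bsub>A\<^esub> homH c x y z"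
    using xyz w by (simp add: homH_def cl m_assoc flip: act_act)
qed

lemma homog_pullback: "homog H f \<Longrightarrow> homog (carrier G) (\<lambda>x y z. f (\<pi> x) (\<pi> y) (\<pi> z))"
  unfolding homog_def by (simp add: \<pi>_mem \<pi>_equiv)

text \<open>The prism operator is a homotopy between the identity and the pullback along \<open>\<pi>\<close>.\<close>

lemma prism:
  assumes E: "E \<subseteq> carrier G" "H \<subseteq> E" and f: "homog E f" and xyz: "x \<in> E" "y \<in> E" "z \<in> E"
  shows "f (\<pi> x) (\<pi> y) (\<pi> z) = f x y z \<otimes>\<^bsub>A\<^esub> delta (prism f) x y z"
proof -
  have p: "\<pi> x \<in> E" "\<pi> y \<in> E" "\<pi> z \<in> E" using E xyz \<pi>_mem by blast+
  note cl = homog_closed[OF f] and eq = homog_cocycle[OF f]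
  show ?thesis
    unfolding delta_def prism_def
    by (rule M.A.prism_identity[OF cl[OF p] cl[OF xyz(1) p(1) p(3)] cl[OF xyz(1) p(2) p(3)]
          cl[OF xyz(1) p(1) p(2)] cl[OF xyz(2) p(2) p(3)] cl[OF xyz(1,2) p(3)] cl[OF xyz(1,2) p(2)]
          cl[OF xyz(2,3) p(3)] cl[OF xyz(1,3) p(3)] cl[OF xyz]
          eq[OF xyz(1) p] eq[OF xyz(1,2) p(2,3)] eq[OF xyz p(3)]])
qed

lemma prism_equivar:
  assumes E: "E \<subseteq> carrier G" "H \<subseteq> E" "\<And>h x. h \<in> H \<Longrightarrow> x \<in> E \<Longrightarrow> h \<otimes> x \<in> E" and f: "homog E f"
  shows "equivar E (prism f)"
  unfolding equivar_def
proof (intro conjI ballI)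
  fix x y assume xy: "x \<in> E" "y \<in> E"
  then have G: "x \<in> carrier G" "y \<in> carrier G" using E by blast+
  have p: "\<pi> x \<in> E" "\<pi> y \<in> E" using E xy \<pi>_mem by blast+
  note cl = homog_closed[OF f]
  show "prism f x y \<in> carrier A" using xy p by (simp add: prism_def cl)
  fix h assume h: "h \<in> H"
  show "prism f (h \<otimes> x) (h \<otimes> y) = act h (prism f x y)"
    unfolding prism_def \<pi>_equiv[OF h G(1)] \<pi>_equiv[OF h G(2)]
      homog_equiv[OF f h xy(1) p] homog_equiv[OF f h xy p(2)]
    using h xy p by (simp add: cl)
qed

section \<open>From homogeneous cochains back to cochains with values in the induced module\<close>

definition dehom :: "('g \<Rightarrow> 'g \<Rightarrow> 'g \<Rightarrow> 'a) \<Rightarrow> 'g \<times> 'g \<Rightarrow> 'g \<Rightarrow> 'a"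
  where "dehom f = (\<lambda>(g, h)\<in>carrier G \<times> carrier G. \<lambda>x\<in>carrier G. f (inv x) (inv x \<otimes> g) (inv x \<otimes> g \<otimes> h))"

lemma dehom_apply: "g \<in> carrier G \<Longrightarrow> h \<in> carrier G \<Longrightarrow> x \<in> carrier G \<Longrightarrow>
    dehom f (g, h) x = f (inv x) (inv x \<otimes> g) (inv x \<otimes> g \<otimes> h)"
  by (simp add: dehom_def)

lemma dehom_closed:
  assumes f: "homog (carrier G) f" and gh: "g \<in> carrier G" "h \<in> carrier G"
  shows "dehom f (g, h) \<in> carrier I"
  unfolding ind_mem_iff
proof (intro conjI ballI)
  show "dehom f (g, h) \<in> carrier G \<rightarrow>\<^sub>E carrier A"
    using gh homog_closed[OF f] by (auto simp: dehom_def)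
  fix x k assume x: "x \<in> carrier G" and k: "k \<in> H"
  show "dehom f (g, h) (x \<otimes> k) = act (inv k) (dehom f (g, h) x)"
    using homog_equiv[OF f, of "inv k" "inv x" "inv x \<otimes> g" "inv x \<otimes> g \<otimes> h"] gh x k
    by (simp add: dehom_apply inv_mult_group m_assoc)
qed

lemma dehom_cocycle:
  assumes f: "homog (carrier G) f"
  shows "dehom f \<in> carrier ind.Z"
  unfolding ind.cocycle_iff
proof (intro conjI ballI)
  show "dehom f \<in> carrier G \<times> carrier G \<rightarrow>\<^sub>E carrier I"
    using dehom_closed[OF f] by (auto simp: PiE_iff extensional_def dehom_def)
  fix g h l assume ghl: "g \<in> carrier G" "h \<in> carrier G" "l \<in> carrier G"
  have "(\<iota> g (dehom f (h, l)) \<otimes>\<^bsub>I\<^esub> dehom f (g, h \<otimes> l)) x = (dehom f (g \<otimes> h, l) \<otimes>\<^bsub>I\<^esub> dehom f (g, h)) x"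
    if x: "x \<in> carrier G" for x
    using homog_cocycle[OF f, of "inv x" "inv x \<otimes> g" "inv x \<otimes> g \<otimes> h" "inv x \<otimes> g \<otimes> h \<otimes> l"] x ghl
    by (simp add: ind_mult ind_module_act_def dehom_apply inv_mult_group m_assoc)
  then show "\<iota> g (dehom f (h, l)) \<otimes>\<^bsub>I\<^esub> dehom f (g, h \<otimes> l) = dehom f (g \<otimes> h, l) \<otimes>\<^bsub>I\<^esub> dehom f (g, h)"
    by (auto simp: ind_mult fun_eq_iff)
qed

text \<open>An equivariant function on pairs gives the 1-cochain \<beta> with
  \<open>\<beta> g x = b (inv x) (inv x \<otimes> g)\<close>, and the homogeneous coboundary
  \<open>delta\<close> turns into \<open>cobdry\<close>.\<close>

lemma coboundary_of_delta:
  assumes F: "F \<in> carrier ind.Z" and b: "equivar (carrier G) b"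
    and eq: "\<And>x y z. x \<in> carrier G \<Longrightarrow> y \<in> carrier G \<Longrightarrow> z \<in> carrier G \<Longrightarrow> homG F x y z = delta b x y z"
  shows "F \<in> ind.B"
proof -
  define \<beta> where "\<beta> = (\<lambda>g\<in>carrier G. \<lambda>x\<in>carrier G. b (inv x) (inv x \<otimes> g))"
  have \<beta>: "\<beta> g \<in> carrier I" if g: "g \<in> carrier G" for g
    unfolding ind_mem_iff
  proof (intro conjI ballI)
    show "\<beta> g \<in> carrier G \<rightarrow>\<^sub>E carrier A"
      using g equivar_closed[OF b] by (auto simp: \<beta>_def)
    fix x k assume "x \<in> carrier G" "k \<in> H"
    then show "\<beta> g (x \<otimes> k) = act (inv k) (\<beta> g x)"
      using equivar_equiv[OF b, of "inv k" "inv x" "inv x \<otimes> g"] g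
      by (simp add: \<beta>_def inv_mult_group m_assoc)
  qed
  have "F (g, h) = ind.cobdry \<beta> (g, h)" if gh: "g \<in> carrier G" "h \<in> carrier G" for g h
  proof
    fix x show "F (g, h) x = ind.cobdry \<beta> (g, h) x"
    proof (cases "x \<in> carrier G")
      case True
      have "F (g, h) x = homG F (inv x) (inv x \<otimes> g) (inv x \<otimes> g \<otimes> h)"
        using gh True by (simp add: homG_def inv_mult_group m_assoc)
      also have "\<dots> = delta b (inv x) (inv x \<otimes> g) (inv x \<otimes> g \<otimes> h)"
        using gh True by (intro eq) auto
      also have "\<dots> = ind.cobdry \<beta> (g, h) x"
        using gh True by (simp add: ind.cobdry_apply ind_mult ind_inv[OF \<beta>] delta_def ind_module_act_def)
          (simp add: \<beta>_def inv_mult_group m_assoc)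
      finally show ?thesis .
    next
      case False
      then show ?thesis
        using ind.cocycle_closed[OF F gh] gh
        by (simp add: ind.cobdry_apply ind_mult ind_mem_iff PiE_iff extensional_def)
    qed
  qed
  then have "F = ind.cobdry \<beta>"
    using F unfolding ind.cocycle_iff
    by (intro extensionalityI[of _ "carrier G \<times> carrier G"]) (auto simp: PiE_iff ind.cobdry_def)
  moreover have "\<beta> \<in> carrier G \<rightarrow>\<^sub>E carrier I"
    using \<beta> by (auto simp: PiE_iff \<beta>_def)
  ultimately show ?thesis by (auto simp: ind.coboundaries2_eq)
qed

abbreviation "eval_one \<equiv> \<lambda>F :: 'g \<Rightarrow> 'a. F \<one>"

text \<open>Evaluation at \<one> is equivariant under \<open>H\<close>: translating by
  \<open>g\<close> evaluates at the inverse of \<open>g\<close>, and the defining condition of the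
  induced module turns this into the action of \<open>g\<close> on the value.\<close>

sublocale E: module_map G I \<iota> H A act eval_one
proof unfold_locales
  show "eval_one \<in> hom I A"
    by (rule homI) (auto simp: ind_closed ind_mult)
  show "eval_one (\<iota> g F) = act g (eval_one F)" if "g \<in> H" "F \<in> carrier I" for g F
    using ind_equiv[of F \<one> "inv g"] that by (simp add: ind_module_act_def)
qed (use subgroup.subset[OF H] in simp_all)

text \<open>In homogeneous form the map of Shapiro's lemma merely restricts a function to tuples
  from \<open>H\<close>; this is again the defining condition of the induced module.\<close>

lemma homG_eq_homH:
  assumes F: "F \<in> carrier ind.Z" and xyz: "x \<in> H" "y \<in> H" "z \<in> H"
  shows "homG F x y z = homH (E.res F) x y z"
proof -
  have "F (inv x \<otimes> y, inv y \<otimes> z) \<in> carrier I" using xyz by (simp add: ind.cocycle_closed[OF F])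
  from ind_equiv[OF this, of \<one> "inv x"] show ?thesis
    using xyz by (simp add: homG_def homH_def E.res_def)
qed

text \<open>If the homogeneous cochain of \<open>F\<close> is \<open>delta a\<close> on
  \<open>H\<close>, then its pullback along \<pi> is \<open>delta\<close> of the pullback of
  \<open>a\<close> on all of \<open>G\<close>. The prism identity compares that pullback with the
  cochain itself, so dividing by the prism gives a primitive \<open>d\<close> on
  \<open>G\<close>.\<close>

lemma coboundary_of_res:
  assumes F: "F \<in> carrier ind.Z" and r: "E.res F \<in> M.B"
  shows "F \<in> ind.B"
proof -
  obtain \<beta> where \<beta>: "\<beta> \<in> H \<rightarrow>\<^sub>E carrier A" "E.res F = M.cobdry \<beta>"
    using r by (auto simp: M.coboundaries2_eq)
  have \<beta>c: "\<beta> h \<in> carrier A" if "h \<in> H" for h using \<beta>(1) that by blast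
  \<comment> \<open>The 1-cochain \<beta> in homogeneous form, on pairs from
    \<open>H\<close>.\<close>
  define a where "a x y = act x (\<beta> (inv x \<otimes> y))" for x y
  have ac: "a x y \<in> carrier A" if "x \<in> H" "y \<in> H" for x y
    using that by (simp add: a_def \<beta>c)
  have a_equiv: "a (h \<otimes> x) (h \<otimes> y) = act h (a x y)" if "h \<in> H" "x \<in> H" "y \<in> H" for h x y
    using that by (simp add: a_def \<beta>c inv_mult_group m_assoc act_act)
  have hom: "homG F x y z = delta a x y z" if "x \<in> H" "y \<in> H" "z \<in> H" for x y z
  proof -
    have "homG F x y z = act x (M.cobdry \<beta> (inv x \<otimes> y, inv y \<otimes> z))"
      using homG_eq_homH[OF F that] by (simp add: homH_def \<beta>(2))
    also have "\<dots> = delta a x y z"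
      using that by (simp add: M.cobdry_apply delta_def a_def \<beta>c m_assoc flip: act_act)
    finally show ?thesis .
  qed
  let ?f = "homG F"
  note f = homG_homog[OF F]
  have b: "equivar (carrier G) (prism ?f)"
    by (rule prism_equivar[OF _ _ _ f]) auto
  define d where "d x y = a (\<pi> x) (\<pi> y) \<otimes>\<^bsub>A\<^esub> inv\<^bsub>A\<^esub> (prism ?f x y)" for x y
  note bc = equivar_closed[OF b]
  have "equivar (carrier G) d"
    unfolding equivar_def d_def
    by (simp add: ac bc \<pi>_mem \<pi>_equiv a_equiv equivar_equiv[OF b])
  moreover have "homG F x y z = delta d x y z" if xyz: "x \<in> carrier G" "y \<in> carrier G" "z \<in> carrier G" for x y z
  proof -
    note p = \<pi>_mem[OF xyz(1)] \<pi>_mem[OF xyz(2)] \<pi>_mem[OF xyz(3)]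
    have dc: "delta (prism ?f) x y z \<in> carrier A" by (simp add: delta_def bc xyz)
    have "delta a (\<pi> x) (\<pi> y) (\<pi> z) = homG F x y z \<otimes>\<^bsub>A\<^esub> delta (prism ?f) x y z"
      using prism[OF _ subgroup.subset[OF H] f xyz] hom[OF p] by auto
    then have "homG F x y z = delta a (\<pi> x) (\<pi> y) (\<pi> z) \<otimes>\<^bsub>A\<^esub> inv\<^bsub>A\<^esub> (delta (prism ?f) x y z)"
      using dc homog_closed[OF f xyz] by (simp add: M.A.m_assoc)
    also have "\<dots> = delta d x y z"
      using xyz p by (simp add: delta_def d_def ac bc M.A.inv_mult)
        (simp only: M.A.m_ac M.A.m_closed M.A.inv_closed ac bc)
    finally show ?thesis .
  qed
  ultimately show ?thesis by (rule coboundary_of_delta[OF F])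
qed

definition ind_coc :: "('g \<times> 'g \<Rightarrow> 'a) \<Rightarrow> 'g \<times> 'g \<Rightarrow> 'g \<Rightarrow> 'a"
  where "ind_coc c = dehom (\<lambda>x y z. homH c (\<pi> x) (\<pi> y) (\<pi> z))"

lemma ind_coc_cocycle: "c \<in> carrier M.Z \<Longrightarrow> ind_coc c \<in> carrier ind.Z"
  unfolding ind_coc_def by (intro dehom_cocycle homog_pullback homH_homog)

text \<open>Since \<pi> may move points of \<open>H\<close>, the restricted pullback differs from
  \<open>c\<close> by a coboundary. The prism identity on tuples from \<open>H\<close> alone
  computes it, with primitive \<open>prism (homH c) \<one> h\<close>.\<close>

lemma res_ind_coc:
  assumes c: "c \<in> carrier M.Z"
  shows "E.cls' (E.res (ind_coc c)) = H2_class (G\<lparr>carrier := H\<rparr>) A act c"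
proof -
  note f = homH_homog[OF c]
  have b: "equivar H (prism (homH c))"
    by (rule prism_equivar[OF _ _ _ f]) auto
  define \<beta> where "\<beta> = (\<lambda>h\<in>H. prism (homH c) \<one> h)"
  have \<beta>: "\<beta> \<in> H \<rightarrow>\<^sub>E carrier A" using equivar_closed[OF b] by (auto simp: \<beta>_def)
  have cl: "c (g, h) \<in> carrier A" if "g \<in> H" "h \<in> H" for g h
    using M.cocycle_closed[OF c] that by simp
  have "E.res (ind_coc c) (g, h) = (M.cobdry \<beta> \<otimes>\<^bsub>M.Z\<^esub> c) (g, h)" if gh: "g \<in> H" "h \<in> H" for g h
  proof -
    have "E.res (ind_coc c) (g, h) = homH c (\<pi> \<one>) (\<pi> g) (\<pi> (g \<otimes> h))"
      using gh by (simp add: E.res_def ind_coc_def dehom_apply)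
    also have "\<dots> = homH c \<one> g (g \<otimes> h) \<otimes>\<^bsub>A\<^esub> delta (prism (homH c)) \<one> g (g \<otimes> h)"
      using gh by (intro prism[OF _ _ f]) auto
    also have "homH c \<one> g (g \<otimes> h) = c (g, h)"
      using gh by (simp add: homH_def cl)
    \<comment> \<open>The edge from \<open>g\<close> to \<open>g \<otimes> h\<close> is the
      translate by \<open>g\<close> of the edge from \<one> to \<open>h\<close>; equivariance
      supplies the action of \<open>g\<close> in the inhomogeneous coboundary.\<close>
    also have "delta (prism (homH c)) \<one> g (g \<otimes> h) = M.cobdry \<beta> (g, h)"
      using gh equivar_equiv[OF b, of g \<one> h] by (simp add: delta_def M.cobdry_apply \<beta>_def)
    also have "c (g, h) \<otimes>\<^bsub>A\<^esub> M.cobdry \<beta> (g, h) = (M.cobdry \<beta> \<otimes>\<^bsub>M.Z\<^esub> c) (g, h)"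
      using gh PiE_mem[OF \<beta>] by (simp add: M.cocycles_mult M.cobdry_apply cl M.A.m_comm)
    finally show ?thesis .
  qed
  then have "E.res (ind_coc c) = M.cobdry \<beta> \<otimes>\<^bsub>M.Z\<^esub> c"
    by (auto simp: fun_eq_iff E.res_def M.cocycles_mult)
  then show ?thesis
    using M.H2_class_mult_coboundary[OF c, of "M.cobdry \<beta>"] \<beta> by (simp add: M.coboundaries2_eq)
qed

lemma shapiro_res_iso: "E.h2map \<in> iso (H2 G I \<iota>) (H2 (G\<lparr>carrier := H\<rparr>) A act)"
  using coboundary_of_res res_ind_coc ind_coc_cocycle by (intro E.map_iso) blast+

lemma shapiro_ind_iso:
  "shapiro_ind G H A act \<in> iso (H2 (G\<lparr>carrier := H\<rparr>) A act) (H2 G I \<iota>)"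
  unfolding shapiro_ind_def
  by (rule group.iso_set_sym[OF _ shapiro_res_iso])
    (simp add: H2_def normal.factorgroup_is_group[OF ind.normal_coboundaries])

lemma shapiro_ind_class:
  assumes c: "c \<in> carrier M.Z"
  shows "shapiro_ind G H A act (H2_class (G\<lparr>carrier := H\<rparr>) A act c) = H2_class G I \<iota> (ind_coc c)"
proof -
  note F = ind_coc_cocycle[OF c]
  have "H2_class G I \<iota> (ind_coc c) \<in> carrier (H2 G I \<iota>)"
    using F by (auto simp: ind.carrier_H2)
  moreover have "inj_on E.h2map (carrier (H2 G I \<iota>))"
    using shapiro_res_iso by (auto simp: iso_def bij_betw_def)
  ultimately show ?thesis
    unfolding shapiro_ind_def using E.map_class[OF F] res_ind_coc[OF c]
    by (intro inv_into_f_eq) auto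
qed

end

section \<open>The module of unit-valued functions\<close>

lemma Units_CC: "Units CC = {z. z \<noteq> 0}"
proof -
  have "\<exists>w. z * w = 1 \<and> w * z = 1" if "z \<noteq> 0" for z :: complex
    using that by (intro exI[of _ "inverse z"]) simp
  then show ?thesis by (auto simp: Units_def ring_of_type_algebra_def)
qed

lemma units_of_CC_simps:
  "carrier (units_of CC) = {z. z \<noteq> 0}" "z \<otimes>\<^bsub>units_of CC\<^esub> w = z * w"
  by (simp_all add: units_of_carrier Units_CC units_of_mult) (simp add: ring_of_type_algebra_def)

lemma comm_group_unit_funs: "comm_group (unit_funs S)"
  unfolding unit_funs_def
  by (intro comm_group.comm_group_product comm_monoid.units_comm_group cring.axioms(2) cring_from_type_algebra)

lemma unit_funs_mem: "a \<in> carrier (unit_funs S) \<longleftrightarrow> a \<in> S \<rightarrow>\<^sub>E {z. z \<noteq> 0}"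
  by (simp add: unit_funs_def units_of_CC_simps)

lemma unit_funs_mult: "a \<otimes>\<^bsub>unit_funs S\<^esub> b = (\<lambda>s\<in>S. a s * b s)"
  by (simp add: unit_funs_def units_of_CC_simps)

lemma (in set_action) group_module_unit_funs: "group_module K (unit_funs S) (unit_funs_act K S act)"
proof -
  interpret U: comm_group "unit_funs S" by (rule comm_group_unit_funs)
  show ?thesis
  proof unfold_locales
    fix g assume g: "g \<in> carrier K"
    show "unit_funs_act K S act g \<in> hom (unit_funs S) (unit_funs S)"
      using g by (intro homI) (auto simp: unit_funs_act_def unit_funs_mem unit_funs_mult PiE_iff act_closed)
  next
    fix a assume a: "a \<in> carrier (unit_funs S)"
    then show "unit_funs_act K S act \<one> a = a"
      by (auto simp: unit_funs_act_def unit_funs_mem PiE_iff extensional_def act_one fun_eq_iff)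
    fix g h assume "g \<in> carrier K" "h \<in> carrier K"
    then show "unit_funs_act K S act (g \<otimes> h) a = unit_funs_act K S act g (unit_funs_act K S act h a)"
      by (auto simp: unit_funs_act_def fun_eq_iff inv_mult_group act_mult act_closed)
  qed
qed

lemma unit_cocycle_nonzero:
  assumes "c \<in> carrier (cocycles2 K (unit_funs S) (unit_funs_act K S act))"
    and "g \<in> carrier K" "h \<in> carrier K" "s \<in> S"
  shows "c (g, h) s \<noteq> 0"
proof -
  have "c (g, h) \<in> carrier (unit_funs S)" using assms by (auto simp: cocycles2_def)
  then show ?thesis using assms(4) by (auto simp: unit_funs_mem)
qed

lemma unit_cocycle_eq:
  assumes "c \<in> carrier (cocycles2 K (unit_funs S) (unit_funs_act K S act))"
    and "g \<in> carrier K" "h \<in> carrier K" "l \<in> carrier K" "s \<in> S"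
  shows "c (h, l) (act (inv\<^bsub>K\<^esub> g) s) * c (g, h \<otimes>\<^bsub>K\<^esub> l) s = c (g \<otimes>\<^bsub>K\<^esub> h, l) s * c (g, h) s"
proof -
  have "(unit_funs_act K S act g (c (h, l)) \<otimes>\<^bsub>unit_funs S\<^esub> c (g, h \<otimes>\<^bsub>K\<^esub> l)) s
      = (c (g \<otimes>\<^bsub>K\<^esub> h, l) \<otimes>\<^bsub>unit_funs S\<^esub> c (g, h)) s"
    using assms by (simp add: cocycles2_def)
  then show ?thesis using assms(5) by (simp add: unit_funs_mult unit_funs_act_def)
qed

section \<open>Change of coefficients along an isomorphism of modules\<close>

locale module_iso = M: group_module K A act + M': group_module K A' act'
  for K :: "('g, 'm) monoid_scheme" and A :: "'a monoid" and act
    and A' :: "'b monoid" and act' +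
  fixes f :: "'a \<Rightarrow> 'b"
  assumes f: "f \<in> iso A A'"
    and equivariant: "g \<in> carrier K \<Longrightarrow> a \<in> carrier A \<Longrightarrow> f (act g a) = act' g (f a)"
begin

abbreviation "f' \<equiv> inv_into (carrier A) f"

lemma bij: "bij_betw f (carrier A) (carrier A')"
  using f by (simp add: iso_def)

lemmas inv_left = bij_betw_inv_into_left[OF bij]
lemmas inv_right = bij_betw_inv_into_right[OF bij]

lemma carrier_self: "K\<lparr>carrier := carrier K\<rparr> = K"
  by simp

sublocale F: module_map K A act "carrier K" A' act' f
  by (intro module_map.intro module_map_axioms.intro)
    (use f equivariant M.group_module_axioms M'.group_module_axioms M.K.subgroup_self in \<open>simp_all add: iso_def\<close>)

sublocale F': module_map K A' act' "carrier K" A act f'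
proof (intro module_map.intro module_map_axioms.intro)
  show "f' \<in> hom A' A" using M.A.iso_set_sym[OF f] by (auto simp: iso_def)
  then have f': "f' a \<in> carrier A" if "a \<in> carrier A'" for a using that by (rule hom_in_carrier)
  show "f' (act' k a) = act k (f' a)" if "k \<in> carrier K" "a \<in> carrier A'" for k a
  proof -
    have "f' (act' k a) = f' (f (act k (f' a)))" by (simp add: equivariant f' inv_right that)
    then show ?thesis using f' that by (simp add: inv_left)
  qed
qed (simp_all add: M.group_module_axioms M'.group_module_axioms M.K.subgroup_self)

lemma res_res: "c \<in> carrier M.Z \<Longrightarrow> F'.res (F.res c) = c" "c' \<in> carrier M'.Z \<Longrightarrow> F.res (F'.res c') = c'"
  by (auto simp: F.res_def F'.res_def M.cocycle_iff M'.cocycle_iff fun_eq_iff inv_left inv_right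
      PiE_iff extensional_def)

lemmas class_map = F.map_class[unfolded carrier_self]
lemmas inv_cocycle = hom_in_carrier[OF F'.res_hom[unfolded carrier_self]]

lemma map_iso: "H2_map K A act K A' act' f \<in> iso (H2 K A act) (H2 K A' act')"
proof -
  have "F'.res c \<in> M.B" if "c \<in> M'.B" for c
    using F'.res_coboundary that unfolding carrier_self by blast
  then show ?thesis
    by (intro F.map_iso[unfolded carrier_self]) (metis res_res inv_cocycle)+
qed

end

section \<open>The balanced product\<close>

declare One_nat_def [simp del] atLeastAtMost_iff [simp del]

locale balanced_product = group_with_subgroup G H + S: set_action "G\<lparr>carrier := H\<rparr>" S act
  for G :: "('g, 'm) monoid_scheme" (structure) and H :: "'g set" and S :: "'s set"
    and act :: "'g \<Rightarrow> 's \<Rightarrow> 's" +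
  fixes m :: nat and r :: "nat \<Rightarrow> 'g"
  assumes reps: "coset_reps G H m r"
begin

abbreviation "T \<equiv> balanced G H S act"
abbreviation "cls \<equiv> balanced_class G H S act"
abbreviation "bact \<equiv> balanced_act G H S act"
abbreviation "indc \<equiv> ind_cocycle G H m r S act"

lemma act_simps [simp]:
  "h \<in> H \<Longrightarrow> s \<in> S \<Longrightarrow> act h s \<in> S" "s \<in> S \<Longrightarrow> act \<one> s = s"
  using S.act_closed S.act_one by auto

lemma act_act: "h \<in> H \<Longrightarrow> k \<in> H \<Longrightarrow> s \<in> S \<Longrightarrow> act (h \<otimes> k) s = act h (act k s)"
  using S.act_mult by simp

lemma swap_sides:
  assumes "x \<in> carrier G" "y \<in> carrier G" "a \<in> carrier G" "b \<in> carrier G" "x \<otimes> a = y \<otimes> b"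
  shows "inv y \<otimes> x = b \<otimes> inv a" "inv x \<otimes> y = a \<otimes> inv b"
proof -
  have "x = y \<otimes> b \<otimes> inv a" "y = x \<otimes> a \<otimes> inv b" using assms by (metis inv_solve_right m_closed)+
  then show "inv y \<otimes> x = b \<otimes> inv a" "inv x \<otimes> y = a \<otimes> inv b"
    using assms(1-4) by (metis inv_cancel(1) inv_closed m_assoc m_closed)+
qed

text \<open>A single step of the relation already yields the whole class: the relation is the orbit
  relation of \<open>H\<close> acting on pairs, \<open>h\<close> sending \<open>(x, s)\<close> to
  \<open>(x \<otimes> inv h, act h s)\<close>.\<close>

lemma cls_mem:
  assumes x: "x \<in> carrier G" and s: "s \<in> S"
  shows "(y, t) \<in> cls x s \<longleftrightarrow> (\<exists>h\<in>H. y = x \<otimes> inv h \<and> t = act h s)"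
proof
  assume "(y, t) \<in> cls x s"
  then obtain h where "x = y \<otimes> h" "t = act h s" "y \<in> carrier G" "h \<in> H"
    by (auto simp: balanced_class_def balanced_rel_def)
  then show "\<exists>h\<in>H. y = x \<otimes> inv h \<and> t = act h s"
    by (intro bexI[of _ h]) (simp_all add: m_assoc)
next
  assume "\<exists>h\<in>H. y = x \<otimes> inv h \<and> t = act h s"
  then obtain h where h: "h \<in> H" "y = x \<otimes> inv h" "t = act h s" by blast
  then have "((x, s), (y, t)) \<in> balanced_rel G H S act"
    unfolding balanced_rel_def using x s
    by (auto intro!: exI[of _ "x \<otimes> inv h"] exI[of _ h] simp: m_assoc)
  then show "(y, t) \<in> cls x s" by (simp add: balanced_class_def)
qed

lemma cls_shift:
  assumes x: "x \<in> carrier G" and h: "h \<in> H" and s: "s \<in> S"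
  shows "cls (x \<otimes> h) s = cls x (act h s)"
proof -
  have "(y, t) \<in> cls (x \<otimes> h) s \<longleftrightarrow> (y, t) \<in> cls x (act h s)" for y t
  proof
    assume "(y, t) \<in> cls (x \<otimes> h) s"
    then obtain k where k: "k \<in> H" "y = x \<otimes> h \<otimes> inv k" "t = act k s"
      using x h s by (auto simp: cls_mem)
    then have "y = x \<otimes> inv (k \<otimes> inv h)" "t = act (k \<otimes> inv h) (act h s)"
      using x h s by (simp_all add: inv_mult_group m_assoc flip: act_act)
    then show "(y, t) \<in> cls x (act h s)" using x h s k(1) unfolding cls_mem[OF x act_simps(1)[OF h s]] by (intro bexI[of _ "k \<otimes> inv h"]) auto
  next
    assume "(y, t) \<in> cls x (act h s)"
    then obtain k where k: "k \<in> H" "y = x \<otimes> inv k" "t = act k (act h s)"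
      using x h s by (auto simp: cls_mem)
    then have "y = x \<otimes> h \<otimes> inv (k \<otimes> h)" "t = act (k \<otimes> h) s"
      using x h s by (simp_all add: inv_mult_group m_assoc act_act)
    moreover have "k \<otimes> h \<in> H" using k h by simp
    ultimately show "(y, t) \<in> cls (x \<otimes> h) s" using x h s by (auto simp: cls_mem)
  qed
  then show ?thesis by auto
qed

lemma cls_eq_iff:
  assumes x: "x \<in> carrier G" and s: "s \<in> S" and y: "y \<in> carrier G" and t: "t \<in> S"
  shows "cls x s = cls y t \<longleftrightarrow> (\<exists>h\<in>H. x = y \<otimes> h \<and> t = act h s)"
proof
  assume eq: "cls x s = cls y t"
  have "(y, t) \<in> cls y t" using y t by (auto simp: cls_mem intro!: bexI[of _ \<one>])
  then obtain h where h: "h \<in> H" "y = x \<otimes> inv h" "t = act h s"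
    using x s unfolding eq[symmetric] by (auto simp: cls_mem)
  then show "\<exists>h\<in>H. x = y \<otimes> h \<and> t = act h s"
    using x by (intro bexI[of _ h]) (simp_all add: m_assoc)
qed (auto simp: cls_shift y s)

lemma T_eq: "T = (\<lambda>(x, s). cls x s) ` (carrier G \<times> S)"
  by (auto simp: balanced_def quotient_def balanced_class_def)

lemma cls_T: "x \<in> carrier G \<Longrightarrow> s \<in> S \<Longrightarrow> cls x s \<in> T"
  by (auto simp: T_eq)

lemma T_cases:
  assumes "t \<in> T"
  obtains x s where "x \<in> carrier G" "s \<in> S" "t = cls x s"
  using assms by (auto simp: T_eq)

lemma bact_cls:
  assumes g: "g \<in> carrier G" and x: "x \<in> carrier G" and s: "s \<in> S"
  shows "bact g (cls x s) = cls (g \<otimes> x) s"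
proof -
  have "(\<lambda>(x, s). (g \<otimes> x, s)) ` cls x s = cls (g \<otimes> x) s"
  proof (intro Set.set_eqI iffI)
    fix p assume "p \<in> (\<lambda>(x, s). (g \<otimes> x, s)) ` cls x s"
    then obtain y t where "(y, t) \<in> cls x s" "p = (g \<otimes> y, t)" by auto
    then show "p \<in> cls (g \<otimes> x) s" using g x s by (auto simp: cls_mem m_assoc)
  next
    fix p assume "p \<in> cls (g \<otimes> x) s"
    then obtain h where h: "h \<in> H" "p = (g \<otimes> x \<otimes> inv h, act h s)"
      using g x s by (cases p) (auto simp: cls_mem)
    then have "(x \<otimes> inv h, act h s) \<in> cls x s" using x s by (auto simp: cls_mem)
    then show "p \<in> (\<lambda>(x, s). (g \<otimes> x, s)) ` cls x s"
      using h g x by (intro image_eqI[of _ _ "(x \<otimes> inv h, act h s)"]) (auto simp: m_assoc)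
  qed
  then show ?thesis by (simp add: balanced_act_def cls_T x s)
qed

sublocale T: set_action G T bact
proof unfold_locales
  show "bact g t \<in> T" if "g \<in> carrier G" "t \<in> T" for g t
    using that by (elim T_cases) (simp add: bact_cls cls_T)
  show "bact \<one> t = t" if "t \<in> T" for t
    using that by (elim T_cases) (simp add: bact_cls)
  show "bact (g \<otimes> h) t = bact g (bact h t)" if "g \<in> carrier G" "h \<in> carrier G" "t \<in> T" for g h t
    using that by (elim T_cases) (simp add: bact_cls m_assoc)
qed

text \<open>\<open>balanced_act\<close> is cut down to \<open>T\<close>, so each group element gives
  an extensional bijection, inverted by the action of the inverse element.\<close>

lemma group_action_T: "group_action G T bact"
proof -
  have Bij: "bact g \<in> Bij T" if g: "g \<in> carrier G" for g
  proof -
    have "bij_betw (bact g) T T"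
      by (rule bij_betw_byWitness[of _ "bact (inv g)"])
        (use g in \<open>auto simp: T.act_inv_cancel T.act_cancel_inv T.act_closed\<close>)
    then show ?thesis by (simp add: Bij_def balanced_act_def)
  qed
  have "bact \<in> hom G (BijGroup T)"
  proof (rule homI)
    fix g h assume gh: "g \<in> carrier G" "h \<in> carrier G"
    have "bact (g \<otimes> h) = compose T (bact g) (bact h)"
    proof
      show "bact (g \<otimes> h) t = compose T (bact g) (bact h) t" for t
      proof (cases "t \<in> T")
        case True
        then show ?thesis using gh by (simp add: compose_def T.act_mult)
      next
        case False
        then show ?thesis by (simp add: compose_def balanced_act_def)
      qed
    qed
    then show "bact (g \<otimes> h) = bact g \<otimes>\<^bsub>BijGroup T\<^esub> bact h"
      using gh Bij by (simp add: BijGroup_def)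
  qed (use Bij in \<open>simp add: BijGroup_def\<close>)
  then show ?thesis
    unfolding group_action_def group_hom_def group_hom_axioms_def
    using group_axioms group_BijGroup by blast
qed

subsection \<open>Coset representatives\<close>

lemma r_mem [simp]: "i \<in> {1..m} \<Longrightarrow> r i \<in> carrier G"
  using reps by (auto simp: coset_reps_def)

lemma rep_ex:
  assumes "x \<in> carrier G"
  shows "\<exists>i\<in>{1..m}. \<exists>h\<in>H. x = r i \<otimes> h"
proof -
  have "x <# H \<in> lcosets H" using assms by (auto simp: LCOSETS_def)
  then have "x <# H \<in> (\<lambda>i. r i <# H) ` {1..m}"
    using reps by (simp add: coset_reps_def bij_betw_def)
  then obtain i where i: "i \<in> {1..m}" "x <# H = r i <# H" by blast
  have "x \<in> x <# H" using assms by (auto simp: l_coset_def intro!: bexI[of _ \<one>])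
  then have "x \<in> r i <# H" unfolding i(2) .
  then show ?thesis using i(1) by (auto simp: l_coset_def)
qed

lemma rep_unique:
  assumes ij: "i \<in> {1..m}" "j \<in> {1..m}" and hk: "h \<in> H" "k \<in> H" and eq: "r i \<otimes> h = r j \<otimes> k"
  shows "i = j" "h = k"
proof -
  have "r i \<in> r j <# H"
  proof -
    have "r i = r j \<otimes> (k \<otimes> inv h)"
      using ij hk eq by (metis H_mem inv_solve_right m_assoc inv_closed m_closed r_mem)
    then show ?thesis using hk by (auto simp: l_coset_def)
  qed
  then have "r i <# H = r j <# H"
    using l_repr_independence[OF _ _ H] ij by simp
  then show ij': "i = j"
    using reps ij by (auto simp: coset_reps_def bij_betw_def inj_on_def)
  show "h = k" using eq hk ij unfolding ij' by simp
qed

text \<open>The inverses of the representatives form a basis of \<open>G\<close> as a free left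
  \<open>H\<close>-set; this is the coordinate in \<open>H\<close> with respect to that
  basis.\<close>

definition pr :: "'g \<Rightarrow> 'g"
  where "pr y = (THE p. \<exists>i\<in>{1..m}. p \<in> H \<and> y = p \<otimes> inv (r i))"

lemma pr_eq:
  assumes i: "i \<in> {1..m}" and h: "h \<in> H"
  shows "pr (h \<otimes> inv (r i)) = h"
  unfolding pr_def
proof (rule the_equality)
  fix p assume "\<exists>j\<in>{1..m}. p \<in> H \<and> h \<otimes> inv (r i) = p \<otimes> inv (r j)"
  then obtain j where j: "j \<in> {1..m}" "p \<in> H" "h \<otimes> inv (r i) = p \<otimes> inv (r j)" by blast
  \<comment> \<open>Inverting both expressions turns right cosets into left cosets, where uniqueness
    of representatives is known.\<close>
  have "r i \<otimes> inv h = inv (h \<otimes> inv (r i))" using i h by (simp add: inv_mult_group)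
  also have "\<dots> = inv (p \<otimes> inv (r j))" unfolding j(3) ..
  also have "\<dots> = r j \<otimes> inv p" using j(1,2) by (simp add: inv_mult_group)
  finally have "r i \<otimes> inv h = r j \<otimes> inv p" .
  then have "inv h = inv p" using rep_unique i h j by (meson H_closed(2))
  then show "p = h" using h j by (metis H_mem inv_inv)
qed (use i h in blast)

lemma pr_cases:
  assumes "y \<in> carrier G"
  obtains i h where "i \<in> {1..m}" "h \<in> H" "y = h \<otimes> inv (r i)"
proof -
  obtain i h where "i \<in> {1..m}" "h \<in> H" "inv y = r i \<otimes> h" using rep_ex[of "inv y"] assms by blast
  then show thesis using that[of i "inv h"] assms by (metis H_closed(2) H_mem inv_inv inv_mult_group r_mem)
qed

lemma pr_mem: "y \<in> carrier G \<Longrightarrow> pr y \<in> H"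
  by (elim pr_cases) (simp add: pr_eq)

lemma pr_equiv: "h \<in> H \<Longrightarrow> y \<in> carrier G \<Longrightarrow> pr (h \<otimes> y) = h \<otimes> pr y"
proof (elim pr_cases)
  fix i k assume "h \<in> H" "i \<in> {1..m}" "k \<in> H" "y = k \<otimes> inv (r i)"
  then show "pr (h \<otimes> y) = h \<otimes> pr y"
    using pr_eq[of i "h \<otimes> k"] pr_eq[of i k] by (simp add: m_assoc)
qed

text \<open>Writing \<open>x\<close> as \<open>r i \<otimes> h\<close> and moving \<open>h\<close>
  across gives surjectivity. Two equal classes give \<open>r i = r j \<otimes> h\<close>, which
  forces \<open>i = j\<close> and \<open>h = \<one>\<close>.\<close>

lemma bij_reps: "bij_betw (\<lambda>(i, s). cls (r i) s) ({1..m} \<times> S) T"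
proof (rule bij_betw_imageI)
  show "inj_on (\<lambda>(i, s). cls (r i) s) ({1..m} \<times> S)"
  proof (rule inj_onI, clarify)
    fix i s j t assume ij: "i \<in> {1..m}" "j \<in> {1..m}" and st: "s \<in> S" "t \<in> S" and "cls (r i) s = cls (r j) t"
    then obtain h where h: "h \<in> H" "r i = r j \<otimes> h" "t = act h s" by (auto simp: cls_eq_iff)
    then have "r i \<otimes> \<one> = r j \<otimes> h" using ij by simp
    from rep_unique[OF ij _ h(1) this] show "i = j \<and> s = t" using h st by auto
  qed
  show "(\<lambda>(i, s). cls (r i) s) ` ({1..m} \<times> S) = T"
  proof (intro equalityI subsetI)
    fix t assume "t \<in> T"
    then obtain x s where x: "x \<in> carrier G" "s \<in> S" "t = cls x s" by (rule T_cases)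
    obtain i h where i: "i \<in> {1..m}" "h \<in> H" "x = r i \<otimes> h" using rep_ex[OF x(1)] by blast
    then have "t = cls (r i) (act h s)" using x by (simp add: cls_shift)
    then show "t \<in> (\<lambda>(i, s). cls (r i) s) ` ({1..m} \<times> S)" using i x by force
  qed (auto intro: cls_T)
qed

lemma bij_rep_pairs: "bij_betw (\<lambda>(x, s). cls x s) (r ` {1..m} \<times> S) T"
proof (rule bij_betw_imageI)
  show "inj_on (\<lambda>(x, s). cls x s) (r ` {1..m} \<times> S)"
  proof (rule inj_onI, clarify)
    fix i s j t assume ij: "i \<in> {1..m}" "j \<in> {1..m}" "s \<in> S" "t \<in> S" and "cls (r i) s = cls (r j) t"
    then have "(i, s) = (j, t)"
      by (intro inj_onD[OF bij_betw_imp_inj_on[OF bij_reps]]) auto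
    then show "r i = r j \<and> s = t" by simp
  qed
  have "(\<lambda>(x, s). cls x s) ` (r ` {1..m} \<times> S) = (\<lambda>(i, s). cls (r i) s) ` ({1..m} \<times> S)" by force
  then show "(\<lambda>(x, s). cls x s) ` (r ` {1..m} \<times> S) = T"
    using bij_betw_imp_surj_on[OF bij_reps] by simp
qed

lemma transfer_iff:
  assumes "g \<in> carrier G" "i \<in> {1..m}" "j \<in> {1..m}" "h \<in> carrier G"
  shows "g \<otimes> r j = r i \<otimes> h \<longleftrightarrow> h = transfer_elt G r g i j"
  using assms unfolding transfer_elt_def
  by (metis inv_cancel(1) inv_cancel(2) inv_closed m_assoc m_closed r_mem)

text \<open>The row \<open>i\<close> is given and the column is sought, so the coset decomposition
  is applied to \<open>inv g \<otimes> r i\<close>. A value of the induced cocycle is attached to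
  its row, whence the chain from \<open>i\<close> to \<open>j\<close> to \<open>k\<close> runs
  against the action.\<close>

lemma row_ex:
  assumes g: "g \<in> carrier G" and i: "i \<in> {1..m}"
  shows "\<exists>j\<in>{1..m}. \<exists>h\<in>H. g \<otimes> r j = r i \<otimes> h"
proof -
  obtain j h where j: "j \<in> {1..m}" "h \<in> H" "inv g \<otimes> r i = r j \<otimes> h"
    using rep_ex[of "inv g \<otimes> r i"] g i by auto
  then have "g \<otimes> r j = r i \<otimes> inv h"
    using swap_sides(2)[of "inv g" "r j" "r i" h] g i by simp
  then show ?thesis using j by (metis H_closed(2))
qed

lemma row_unique:
  assumes g: "g \<in> carrier G" and ij: "i \<in> {1..m}" "j \<in> {1..m}" "j' \<in> {1..m}" and h: "h \<in> H" "h' \<in> H"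
    and eq: "g \<otimes> r j = r i \<otimes> h" "g \<otimes> r j' = r i \<otimes> h'"
  shows "j = j'" "h = h'"
proof -
  have "r j \<otimes> inv h = inv g \<otimes> r i"
    using swap_sides(2)[OF _ _ _ _ eq(1)] g ij h by simp
  moreover have "r j' \<otimes> inv h' = inv g \<otimes> r i"
    using swap_sides(2)[OF _ _ _ _ eq(2)] g ij h by simp
  ultimately show j: "j = j'" using rep_unique(1) ij h by (metis H_closed(2))
  show "h = h'" using eq ij h unfolding j by (simp)
qed

lemma column_ex:
  assumes g: "g \<in> carrier G" and k: "k \<in> {1..m}"
  shows "\<exists>j\<in>{1..m}. \<exists>h\<in>H. g \<otimes> r k = r j \<otimes> h"
  using rep_ex[of "g \<otimes> r k"] g k by simp

text \<open>The description is single-valued because the class determines \<open>i\<close> and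
  \<open>s\<close>, then \<open>i\<close> determines \<open>j\<close> and \<open>h1\<close>, and
  \<open>j\<close> determines \<open>k\<close> and \<open>h2\<close>.\<close>

lemma ind_cocycle_apply:
  assumes g: "g1 \<in> carrier G" "g2 \<in> carrier G" and ijk: "i \<in> {1..m}" "j \<in> {1..m}" "k \<in> {1..m}"
    and s: "s \<in> S" and h: "h1 \<in> H" "h2 \<in> H"
    and eq: "g1 \<otimes> r j = r i \<otimes> h1" "g2 \<otimes> r k = r j \<otimes> h2"
  shows "indc c (g1, g2) (cls (r i) s) = c (h1, h2) s"
proof -
  let ?Q = "\<lambda>z. \<exists>i'\<in>{1..m}. \<exists>j\<in>{1..m}. \<exists>k\<in>{1..m}. \<exists>s'\<in>S. \<exists>h1\<in>H. \<exists>h2\<in>H.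
    cls (r i) s = cls (r i') s' \<and> g1 \<otimes> r j = r i' \<otimes> h1 \<and> g2 \<otimes> r k = r j \<otimes> h2 \<and> z = c (h1, h2) s'"
  have "(THE z. ?Q z) = c (h1, h2) s"
  proof (rule the_equality)
    show "?Q (c (h1, h2) s)"
      by (rule bexI[OF _ ijk(1)], rule bexI[OF _ ijk(2)], rule bexI[OF _ ijk(3)], rule bexI[OF _ s],
          rule bexI[OF _ h(1)], rule bexI[OF _ h(2)], intro conjI refl eq)
    fix z assume "?Q z"
    then show "z = c (h1, h2) s"
    proof (elim bexE conjE)
      fix i' j' k' s' h1' h2' assume z: "i' \<in> {1..m}" "j' \<in> {1..m}" "k' \<in> {1..m}" "s' \<in> S"
        "h1' \<in> H" "h2' \<in> H" "cls (r i) s = cls (r i') s'"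
        "g1 \<otimes> r j' = r i' \<otimes> h1'" "g2 \<otimes> r k' = r j' \<otimes> h2'" "z = c (h1', h2') s'"
    have "(i, s) = (i', s')"
      by (rule inj_onD[OF bij_betw_imp_inj_on[OF bij_reps]]) (use z ijk s in simp_all)
    then have is': "i' = i" "s' = s" by auto
    have 1: "j' = j" "h1' = h1"
      using row_unique[OF g(1) ijk(1) z(2) ijk(2) z(5) h(1) z(8)[unfolded is'] eq(1)] by auto
    have "h2' = h2"
      using row_unique[OF g(2) ijk(2) z(3) ijk(3) z(6) h(2) z(9)[unfolded 1] eq(2)] by auto
    then show "z = c (h1, h2) s" using z(10) is' 1 by simp
    qed
  qed
  then show ?thesis
    using g s ijk by (simp add: ind_cocycle_def cls_T)
qed

subsection \<open>Functions on the balanced product\<close>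

abbreviation "US \<equiv> unit_funs S"
abbreviation "UT \<equiv> unit_funs T"
abbreviation "\<mu> \<equiv> unit_funs_act (G\<lparr>carrier := H\<rparr>) S act"
abbreviation "\<nu> \<equiv> unit_funs_act G T bact"
abbreviation "\<theta> \<equiv> fun_to_ind G H S act"

sublocale C: coinduction G H US \<mu> pr
  by (rule coinduction.intro[OF group_with_subgroup_axioms S.group_module_unit_funs])
    (unfold_locales, auto simp: pr_mem pr_equiv)

sublocale UT: group_module G UT \<nu>
  by (rule T.group_module_unit_funs)

lemma \<mu>_apply: "h \<in> H \<Longrightarrow> s \<in> S \<Longrightarrow> \<mu> h a s = a (act (inv h) s)"
  using m_inv_consistent[OF H] by (simp add: unit_funs_act_def)

lemma UT_closed: "a \<in> carrier UT \<Longrightarrow> x \<in> carrier G \<Longrightarrow> s \<in> S \<Longrightarrow> a (cls x s) \<noteq> 0"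
  using cls_T by (auto simp: unit_funs_mem)

lemma \<theta>_mem:
  assumes a: "a \<in> carrier UT"
  shows "\<theta> a \<in> carrier C.I"
  unfolding C.ind_mem_iff
proof (intro conjI ballI)
  show "\<theta> a \<in> carrier G \<rightarrow>\<^sub>E carrier US"
    using UT_closed[OF a] by (auto simp: fun_to_ind_def unit_funs_mem)
  fix x h assume x: "x \<in> carrier G" and h: "h \<in> H"
  have "\<theta> a (x \<otimes> h) s = \<mu> (inv h) (\<theta> a x) s" for s
    using x h by (cases "s \<in> S") (auto simp: fun_to_ind_def cls_shift \<mu>_apply, simp add: unit_funs_act_def)
  then show "\<theta> a (x \<otimes> h) = \<mu> (inv h) (\<theta> a x)" by blast
qed

text \<open>A function on \<open>T\<close> is a function on pairs that is constant on classes, and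
  for a function with values in functions on \<open>S\<close> this constancy is exactly the
  condition defining the induced module.\<close>

lemma \<theta>_iso: "\<theta> \<in> iso UT C.I"
proof (rule isoI)
  show "\<theta> \<in> hom UT C.I"
    by (rule homI[OF \<theta>_mem])
      (auto simp: fun_to_ind_def unit_funs_mult C.ind_mult fun_eq_iff cls_T)
  show "bij_betw \<theta> (carrier UT) (carrier C.I)"
  proof (rule bij_betw_imageI)
    show "inj_on \<theta> (carrier UT)"
    proof (rule inj_onI)
      fix a b assume a: "a \<in> carrier UT" and b: "b \<in> carrier UT" and eq: "\<theta> a = \<theta> b"
      have "a t = b t" if "t \<in> T" for t
        using that
      proof (rule T_cases)
        fix x s assume "x \<in> carrier G" "s \<in> S" "t = cls x s"
        then show "a t = b t" using fun_cong[OF fun_cong[OF eq, of x], of s] by (simp add: fun_to_ind_def)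
      qed
      then show "a = b" using a b unfolding unit_funs_mem by (intro PiE_ext) auto
    qed
    show "\<theta> ` carrier UT = carrier C.I"
    proof (intro equalityI subsetI)
      fix F assume F: "F \<in> carrier C.I"
      \<comment> \<open>Any representative of the class may be used; the choice disappears because
        \<open>F (x \<otimes> inv h)\<close> at \<open>act h s\<close> equals \<open>F x\<close> at
        \<open>s\<close>.\<close>
      define a where "a = (\<lambda>t\<in>T. F (fst (SOME p. p \<in> t)) (snd (SOME p. p \<in> t)))"
      have a: "a (cls x s) = F x s" if x: "x \<in> carrier G" and s: "s \<in> S" for x s
      proof -
        define p where "p = (SOME p. p \<in> cls x s)"
        have "(x, s) \<in> cls x s" using x s by (auto simp: cls_mem intro!: bexI[of _ \<one>])
        then have "p \<in> cls x s" unfolding p_def by (rule someI)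
        then obtain h where h: "h \<in> H" "p = (x \<otimes> inv h, act h s)"
          using x s by (cases p) (auto simp: cls_mem)
        have "a (cls x s) = F (x \<otimes> inv h) (act h s)"
          using h(2) x s by (simp add: a_def cls_T flip: p_def)
        also have "\<dots> = \<mu> h (F x) (act h s)"
          using C.ind_equiv[OF F x, of "inv h"] h by simp
        also have "\<dots> = F x s"
          using h s by (simp add: \<mu>_apply flip: act_act)
        finally show ?thesis .
      qed
      have nonzero: "a t \<noteq> 0" if "t \<in> T" for t
        using that
      proof (rule T_cases)
        fix x s assume "x \<in> carrier G" "s \<in> S" "t = cls x s"
        then show "a t \<noteq> 0" using C.ind_closed[OF F] by (auto simp: a unit_funs_mem)
      qed
      have "a \<in> extensional T" by (simp add: a_def)
      then have "a \<in> carrier UT"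
        using nonzero by (simp add: unit_funs_mem PiE_iff)
      moreover have "\<theta> a = F"
      proof
        fix x show "\<theta> a x = F x"
        proof (cases "x \<in> carrier G")
          case True
          then show ?thesis
            using C.ind_closed[OF F True]
            by (auto simp: fun_to_ind_def a unit_funs_mem fun_eq_iff PiE_iff extensional_def)
        next
          case False
          then show ?thesis using F by (auto simp: fun_to_ind_def C.ind_mem_iff PiE_iff extensional_def)
        qed
      qed
      ultimately show "F \<in> \<theta> ` carrier UT" by blast
    qed (auto intro: \<theta>_mem)
  qed
qed

lemma \<theta>_equiv: "g \<in> carrier G \<Longrightarrow> \<theta> (\<nu> g a) = C.\<iota> g (\<theta> a)"
  by (auto simp: fun_to_ind_def unit_funs_act_def ind_module_act_def fun_eq_iff cls_T bact_cls)

sublocale \<Theta>: module_iso G UT \<nu> C.I C.\<iota> \<theta>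
  by unfold_locales (rule \<theta>_iso, rule \<theta>_equiv)

abbreviation "\<Theta> \<equiv> H2_map G UT \<nu> G C.I C.\<iota> \<theta>"

lemmas \<Theta>_iso = \<Theta>.map_iso

lemma H2_identification_eq: "H2_identification G H S act = inv_into (carrier (H2 G UT \<nu>)) \<Theta>"
  by (simp add: H2_identification_def Let_def)

lemma H2_identification_iso: "H2_identification G H S act \<in> iso (H2 G C.I C.\<iota>) (H2 G UT \<nu>)"
  unfolding H2_identification_eq
  by (rule group.iso_set_sym[OF _ \<Theta>_iso])
    (simp add: H2_def normal.factorgroup_is_group[OF UT.normal_coboundaries])

text \<open>For \<open>x = r i \<otimes> h\<close> the three vertices \<open>inv x\<close>,
  \<open>inv x \<otimes> g1\<close>, \<open>inv x \<otimes> g1 \<otimes> g2\<close> are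
  \<open>inv h\<close>, \<open>inv h \<otimes> h1\<close>,
  \<open>inv h \<otimes> h1 \<otimes> h2\<close> times the inverses of \<open>r i\<close>,
  \<open>r j\<close>, \<open>r k\<close>. So \<open>pr\<close> returns these \<open>H\<close>-parts,
  and the pullback of \<open>c\<close> at \<open>s\<close> is \<open>c (h1, h2)\<close> at
  \<open>act h s\<close>; the class of \<open>(x, s)\<close> is that of
  \<open>(r i, act h s)\<close>.\<close>

lemma \<theta>_ind_cocycle:
  assumes c: "c \<in> carrier C.M.Z" and g: "g1 \<in> carrier G" "g2 \<in> carrier G"
  shows "\<theta> (indc c (g1, g2)) = C.ind_coc c (g1, g2)"
proof -
  have "\<theta> (indc c (g1, g2)) x s = C.ind_coc c (g1, g2) x s"
    if x: "x \<in> carrier G" and s: "s \<in> S" for x s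
  proof -
    obtain i h where i: "i \<in> {1..m}" "h \<in> H" "x = r i \<otimes> h" using rep_ex[OF x] by blast
    obtain j h1 where j: "j \<in> {1..m}" "h1 \<in> H" "g1 \<otimes> r j = r i \<otimes> h1" using row_ex[OF g(1) i(1)] by blast
    obtain k h2 where k: "k \<in> {1..m}" "h2 \<in> H" "g2 \<otimes> r k = r j \<otimes> h2" using row_ex[OF g(2) j(1)] by blast
    have G: "r i \<in> carrier G" "r j \<in> carrier G" "r k \<in> carrier G" using i j k by auto
    have "inv (r i) \<otimes> g1 = h1 \<otimes> inv (r j)"
      using swap_sides(1)[OF _ _ _ _ j(3)] j(2) G g by simp
    then have e1: "inv x \<otimes> g1 = (inv h \<otimes> h1) \<otimes> inv (r j)"
      using i j G g by (simp add: inv_mult_group m_assoc)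
    have "inv (r j) \<otimes> g2 = h2 \<otimes> inv (r k)"
      using swap_sides(1)[OF _ _ _ _ k(3)] k(2) G g by simp
    then have e2: "inv x \<otimes> g1 \<otimes> g2 = (inv h \<otimes> h1 \<otimes> h2) \<otimes> inv (r k)"
      unfolding e1 using i j k G g by (simp add: m_assoc)
    have e0: "inv x = inv h \<otimes> inv (r i)" using i G by (simp add: inv_mult_group)
    have p: "pr (inv x) = inv h" "pr (inv x \<otimes> g1) = inv h \<otimes> h1" "pr (inv x \<otimes> g1 \<otimes> g2) = inv h \<otimes> h1 \<otimes> h2"
      unfolding e2 unfolding e1 unfolding e0 using i j k by (simp_all add: pr_eq)
    have "C.ind_coc c (g1, g2) x s = \<mu> (inv h) (c (h1, h2)) s"
      unfolding C.ind_coc_def C.dehom_apply[OF g x] p using i j k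
      by (simp add: C.homH_def m_assoc inv_mult_group)
    also have "\<dots> = c (h1, h2) (act h s)" using i s by (simp add: \<mu>_apply)
    also have "\<dots> = indc c (g1, g2) (cls (r i) (act h s))"
      using ind_cocycle_apply[OF g i(1) j(1) k(1) _ j(2) k(2) j(3) k(3)] i s by simp
    also have "\<dots> = \<theta> (indc c (g1, g2)) x s"
      using x s i by (simp add: fun_to_ind_def cls_shift)
    finally show ?thesis by simp
  qed
  moreover have "C.ind_coc c (g1, g2) \<in> carrier C.I"
    using C.ind.cocycle_closed[OF C.ind_coc_cocycle[OF c] g] .
  ultimately show ?thesis
    by (auto simp: fun_to_ind_def fun_eq_iff C.ind_mem_iff unit_funs_mem PiE_iff extensional_def)
qed

lemma ind_cocycle_nonzero:
  assumes c: "c \<in> carrier C.M.Z" and g: "g1 \<in> carrier G" "g2 \<in> carrier G"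
  shows "indc c (g1, g2) \<in> carrier UT"
  unfolding unit_funs_mem
proof (rule PiE_I)
  fix t assume "t \<in> T"
  then have "t \<in> (\<lambda>(i, s). cls (r i) s) ` ({1..m} \<times> S)"
    using bij_betw_imp_surj_on[OF bij_reps] by simp
  then obtain i s where i: "i \<in> {1..m}" "s \<in> S" "t = cls (r i) s" by auto
  obtain j h1 where j: "j \<in> {1..m}" "h1 \<in> H" "g1 \<otimes> r j = r i \<otimes> h1" using row_ex[OF g(1) i(1)] by blast
  obtain k h2 where k: "k \<in> {1..m}" "h2 \<in> H" "g2 \<otimes> r k = r j \<otimes> h2" using row_ex[OF g(2) j(1)] by blast
  show "indc c (g1, g2) t \<in> {z. z \<noteq> 0}"
    using ind_cocycle_apply[OF g i(1) j(1) k(1) i(2) j(2) k(2) j(3) k(3)] unit_cocycle_nonzero[OF c] i j k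
    by simp
qed (use g in \<open>simp add: ind_cocycle_def\<close>)

text \<open>No cocycle identity is checked on \<open>T\<close>: the induced cocycle is the transport
  of the pulled-back cocycle along the inverse of \<theta>, and transport preserves
  cocycles.\<close>

lemma ind_cocycle_cocycle:
  assumes c: "c \<in> carrier C.M.Z"
  shows "indc c \<in> carrier UT.Z"
proof -
  let ?h = "\<Theta>.F'.res (C.ind_coc c)"
  have inj: "inj_on \<theta> (carrier UT)" using \<theta>_iso by (auto simp: iso_def bij_betw_def)
  have "indc c = ?h"
  proof (rule extensionalityI[of _ "carrier G \<times> carrier G"])
    show "indc c \<in> extensional (carrier G \<times> carrier G)"
      unfolding ind_cocycle_def by (rule restrict_extensional)
    fix p assume "p \<in> carrier G \<times> carrier G"
    then obtain g1 g2 where g: "g1 \<in> carrier G" "g2 \<in> carrier G" "p = (g1, g2)" by auto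
    then show "indc c p = ?h p"
      using inv_into_f_f[OF inj ind_cocycle_nonzero[OF c g(1,2)]] \<theta>_ind_cocycle[OF c g(1,2)]
      by (simp add: \<Theta>.F'.res_def)
  qed (simp add: \<Theta>.F'.res_def)
  then show ?thesis using \<Theta>.inv_cocycle[OF C.ind_coc_cocycle[OF c]] by simp
qed

lemma \<Theta>_ind_cocycle:
  assumes c: "c \<in> carrier C.M.Z"
  shows "\<Theta> (H2_class G UT \<nu> (indc c)) = H2_class G C.I C.\<iota> (C.ind_coc c)"
proof -
  have "\<Theta>.F.res (indc c) = C.ind_coc c"
    unfolding \<Theta>.F.res_def
    using \<theta>_ind_cocycle[OF c]
    by (intro extensionalityI[of _ "carrier G \<times> carrier G"])
      (auto simp: C.ind_coc_def C.dehom_def)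
  then show ?thesis using \<Theta>.class_map[OF ind_cocycle_cocycle[OF c]] by simp
qed

lemma H2_identification_shapiro:
  assumes c: "c \<in> carrier C.M.Z"
  shows "H2_identification G H S act (shapiro_ind G H US \<mu> (H2_class (G\<lparr>carrier := H\<rparr>) US \<mu> c))
    = H2_class G UT \<nu> (indc c)"
proof -
  have "inj_on \<Theta> (carrier (H2 G UT \<nu>))" using \<Theta>_iso by (auto simp: iso_def bij_betw_def)
  moreover have "H2_class G UT \<nu> (indc c) \<in> carrier (H2 G UT \<nu>)"
    using ind_cocycle_cocycle[OF c] by (auto simp: UT.carrier_H2)
  ultimately show ?thesis
    unfolding C.shapiro_ind_class[OF c] H2_identification_eq \<Theta>_ind_cocycle[OF c, symmetric]
    by (rule inv_into_f_f)
qed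

section \<open>Comparison with restriction to \<open>H\<close> and pullback along
  \<open>s \<mapsto> [1, s]\<close>\<close>

sublocale \<kappa>: module_map G UT \<nu> H US \<mu> "\<lambda>a. \<lambda>s\<in>S. a (cls \<one> s)"
proof (intro module_map.intro module_map_axioms.intro)
  let ?\<kappa> = "\<lambda>a. \<lambda>s\<in>S. a (cls \<one> s)"
  show "?\<kappa> \<in> hom UT US"
    by (rule homI) (auto simp: unit_funs_mem unit_funs_mult cls_T fun_eq_iff)
  show "?\<kappa> (\<nu> g a) = \<mu> g (?\<kappa> a)" if g: "g \<in> H" for g a
  proof
    fix s show "?\<kappa> (\<nu> g a) s = \<mu> g (?\<kappa> a) s"
      using g cls_shift[of \<one> "inv g" s]
      by (cases "s \<in> S") (simp_all add: \<mu>_apply, simp_all add: unit_funs_act_def cls_T bact_cls)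
  qed
qed (rule T.group_module_unit_funs S.group_module_unit_funs H)+

text \<open>Evaluating \<open>\<theta> a\<close> at \<one> gives the function sending
  \<open>s\<close> to \<open>a\<close> at the class of \<open>(\<one>, s)\<close>. Hence the direct
  restriction factors, already on cocycles, through the identification of coefficients.\<close>

lemma restrict_to_S_eq:
  assumes w: "w \<in> carrier (H2 G UT \<nu>)"
  shows "restrict_to_S G H S act w = C.E.h2map (\<Theta> w)"
proof -
  obtain z where z: "z \<in> carrier UT.Z" "w = H2_class G UT \<nu> z" using w by (auto simp: UT.carrier_H2)
  have "C.E.res (\<Theta>.F.res z) = \<kappa>.res z"
    by (auto simp: C.E.res_def \<Theta>.F.res_def \<kappa>.res_def fun_to_ind_def fun_eq_iff)
  then show ?thesis
    using \<kappa>.map_class[OF z(1)] \<Theta>.class_map[OF z(1)]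
      C.E.map_class[OF hom_in_carrier[OF \<Theta>.F.res_hom[unfolded \<Theta>.carrier_self] z(1)]]
    by (simp add: restrict_to_S_def Let_def z(2))
qed

text \<open>The composite of the two isomorphisms is a preimage of \<open>u\<close> under
  restriction, and restriction is injective because both of its factors are bijective; so
  \<open>inv_into\<close> has to return this preimage.\<close>

lemma H2_identification_shapiro_inverse:
  assumes u: "u \<in> carrier (H2 (G\<lparr>carrier := H\<rparr>) US \<mu>)"
  shows "H2_identification G H S act (shapiro_ind G H US \<mu> u)
    = inv_into (carrier (H2 G UT \<nu>)) (restrict_to_S G H S act) u"
proof -
  let ?v = "shapiro_ind G H US \<mu> u"
  let ?w = "H2_identification G H S act ?v"
  have bij: "bij_betw \<Theta> (carrier (H2 G UT \<nu>)) (carrier (H2 G C.I C.\<iota>))"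
    "bij_betw C.E.h2map (carrier (H2 G C.I C.\<iota>)) (carrier (H2 (G\<lparr>carrier := H\<rparr>) US \<mu>))"
    using \<Theta>_iso C.shapiro_res_iso by (auto simp: iso_def)
  have v: "?v \<in> carrier (H2 G C.I C.\<iota>)"
    using C.shapiro_ind_iso u by (auto simp: iso_def bij_betw_def)
  have w: "?w \<in> carrier (H2 G UT \<nu>)"
    using H2_identification_iso v by (auto simp: iso_def bij_betw_def)
  have "\<Theta> ?w = ?v"
    unfolding H2_identification_eq by (rule bij_betw_inv_into_right[OF bij(1) v])
  moreover have "C.E.h2map ?v = u"
    unfolding shapiro_ind_def by (rule bij_betw_inv_into_right[OF bij(2) u])
  ultimately have eq: "restrict_to_S G H S act ?w = u" by (simp only: restrict_to_S_eq[OF w])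
  have inj: "inj_on (restrict_to_S G H S act) (carrier (H2 G UT \<nu>))"
    using bij_betw_trans[OF bij] restrict_to_S_eq by (auto simp: bij_betw_def inj_on_def)
  show ?thesis using inv_into_f_f[OF inj w] unfolding eq by (rule sym)
qed

end

section \<open>The induced 2-representation\<close>

text \<open>Indices start at 1, so division with remainder is applied to \<open>I - 1\<close>, with
  quotient \<open>block n I - 1\<close> and remainder \<open>inner n I - 1\<close>. That
  \<open>n\<close> is positive follows from \<open>I\<close> lying in
  \<open>{1..n * m}\<close>.\<close>

lemma
  assumes "I \<in> {1..n * m}"
  shows block_mem: "block n I \<in> {1..m}" and inner_mem: "inner n I \<in> {1..n}"
    and index_block_inner: "index n (block n I) (inner n I) = I"
proof -
  have I: "1 \<le> I" "I - 1 < m * n" and n: "0 < n"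
    using assms by (auto simp: atLeastAtMost_iff mult.commute intro: gr0I)
  have "(I - 1) div n < m" using I(2) by (rule less_mult_imp_div_less)
  then show "block n I \<in> {1..m}" by (simp add: block_def atLeastAtMost_iff)
  have "(I - 1) mod n < n" using n by simp
  then show "inner n I \<in> {1..n}" by (simp add: inner_def atLeastAtMost_iff)
  show "index n (block n I) (inner n I) = I"
    using I(1) div_mult_mod_eq[of "I - 1" n] by (simp add: index_def block_def inner_def)
qed

lemma
  assumes "i \<in> {1..m}" "s \<in> {1..n}"
  shows index_mem: "index n i s \<in> {1..n * m}"
    and block_index: "block n (index n i s) = i" and inner_index: "inner n (index n i s) = s"
proof -
  obtain i' where i: "i = Suc i'" "i' < m" using assms(1) by (cases i) (auto simp: atLeastAtMost_iff)
  obtain s' where s: "s = Suc s'" "s' < n" using assms(2) by (cases s) (auto simp: atLeastAtMost_iff)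
  have "i' * n + s' < Suc i' * n" using s by simp
  also have "\<dots> \<le> m * n" using i(2) by (intro mult_le_mono1) simp
  finally show "index n i s \<in> {1..n * m}"
    by (simp add: index_def i s atLeastAtMost_iff mult.commute)
  show "block n (index n i s) = i" "inner n (index n i s) = s"
    using s by (simp_all add: index_def block_def inner_def i)
qed

locale induced_rep = balanced_product G H "{1..n}" act m r
  for G :: "('g, 'm) monoid_scheme" (structure) and H :: "'g set" and n :: nat
    and act :: "'g \<Rightarrow> nat \<Rightarrow> nat" and m :: nat and r :: "nat \<Rightarrow> 'g" +
  fixes c :: "'g \<times> 'g \<Rightarrow> nat \<Rightarrow> complex"
  assumes c: "c \<in> carrier C.M.Z"
begin

text \<open>The order on \<open>T\<close> is dictated by the block layout of the induced matrices;
  any other enumeration would give only conjugate matrices.\<close>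

definition enum :: "nat \<Rightarrow> ('g \<times> nat) set"
  where "enum I = cls (r (block n I)) (inner n I)"

abbreviation "GH \<equiv> G\<lparr>carrier := H\<rparr>"
abbreviation "\<R> \<equiv> set_two_rep GH {1..n} id act c"

lemma enum_bij: "bij_betw enum {1..n * m} T"
proof -
  have "bij_betw (\<lambda>I. (block n I, inner n I)) {1..n * m} ({1..m} \<times> {1..n})"
    by (rule bij_betw_byWitness[of _ "\<lambda>(i, s). index n i s"])
      (auto simp: block_mem inner_mem index_mem block_index inner_index index_block_inner)
  from bij_betw_trans[OF this bij_reps] show ?thesis
    by (simp add: enum_def[abs_def] o_def)
qed

lemma card_T: "card T = n * m"
  using bij_betw_same_card[OF enum_bij] by simp

text \<open>The general theory is used twice: here for \<open>G\<close> acting on \<open>T\<close>,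
  and as \<open>Q\<close> for \<open>H\<close> acting on \<open>{1..n}\<close>. The induced data are
  assembled from \<open>Q\<close> and compared with \<open>P\<close>.\<close>

sublocale P: set_cocycle G T bact enum "indc c"
proof unfold_locales
  show "bij_betw enum {1..card T} T" unfolding card_T by (rule enum_bij)
next
  fix g h t assume "g \<in> carrier G" "h \<in> carrier G" "t \<in> T"
  then show "indc c (g, h) t \<noteq> 0" by (rule unit_cocycle_nonzero[OF ind_cocycle_cocycle[OF c]])
next
  fix g h l t assume "g \<in> carrier G" "h \<in> carrier G" "l \<in> carrier G" "t \<in> T"
  then show "indc c (h, l) (bact (inv g) t) * indc c (g, h \<otimes> l) t = indc c (g \<otimes> h, l) t * indc c (g, h) t"
    by (rule unit_cocycle_eq[OF ind_cocycle_cocycle[OF c]])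
qed

sublocale Q: set_cocycle GH "{1..n}" act id c
proof unfold_locales
  show "bij_betw id {1..card {1..n}} {1..n}" by simp
next
  fix g h s assume "g \<in> carrier GH" "h \<in> carrier GH" "s \<in> {1..n}"
  then show "c (g, h) s \<noteq> 0" by (rule unit_cocycle_nonzero[OF c])
next
  fix g h l s assume "g \<in> carrier GH" "h \<in> carrier GH" "l \<in> carrier GH" "s \<in> {1..n}"
  then show "c (h, l) (act (inv\<^bsub>GH\<^esub> g) s) * c (g, h \<otimes>\<^bsub>GH\<^esub> l) s = c (g \<otimes>\<^bsub>GH\<^esub> h, l) s * c (g, h) s"
    by (rule unit_cocycle_eq[OF c])
qed

section \<open>Entrywise comparison of the induced data with those of \<open>T\<close>\<close>

lemma enum_eq_iff:
  assumes g: "g \<in> carrier G" and I: "I \<in> {1..n * m}" and J: "J \<in> {1..n * m}"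
  defines "h \<equiv> transfer_elt G r g (block n I) (block n J)"
  shows "enum I = bact g (enum J) \<longleftrightarrow> h \<in> H \<and> inner n I = act h (inner n J)"
proof -
  note b = block_mem[OF I] block_mem[OF J] and i = inner_mem[OF I] inner_mem[OF J]
  have "enum I = bact g (enum J) \<longleftrightarrow> cls (g \<otimes> r (block n J)) (inner n J) = cls (r (block n I)) (inner n I)"
    using g b i by (auto simp: enum_def bact_cls)
  also have "\<dots> \<longleftrightarrow> (\<exists>k\<in>H. g \<otimes> r (block n J) = r (block n I) \<otimes> k \<and> inner n I = act k (inner n J))"
    using g b i by (simp add: cls_eq_iff)
  also have "\<dots> \<longleftrightarrow> (\<exists>k\<in>H. k = h \<and> inner n I = act k (inner n J))"
    using transfer_iff[OF g b] unfolding h_def by (metis H_mem)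
  also have "\<dots> \<longleftrightarrow> h \<in> H \<and> inner n I = act h (inner n J)" by auto
  finally show ?thesis .
qed

lemma sel: "dim \<R> = n" "rho \<R> = Q.R"
  by (simp_all add: set_two_rep_def)

lemma ind_rho_entry:
  assumes "g \<in> carrier G" "I \<in> {1..n * m}" "J \<in> {1..n * m}"
  shows "ind_rho G H m r \<R> g I J =
    (if transfer_elt G r g (block n I) (block n J) \<in> H
     then Q.R (transfer_elt G r g (block n I) (block n J)) (inner n I) (inner n J) else zero_space)"
  using assms by (simp add: ind_rho_def sel Let_def)

lemma ind_rho_eq: "ind_rho G H m r \<R> = P.R"
proof -
  have "ind_rho G H m r \<R> g I J = P.R g I J"
    if g: "g \<in> carrier G" and I: "I \<in> {1..n * m}" and J: "J \<in> {1..n * m}" for g I J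
    unfolding ind_rho_entry[OF that]
    using inner_mem[OF I] inner_mem[OF J] enum_eq_iff[OF that] that
    by (auto simp: set_rho_def card_T)
  then show ?thesis
    by (auto simp: fun_eq_iff ind_rho_def set_rho_def sel card_T)
qed

lemma Q_perm: "h \<in> H \<Longrightarrow> s \<in> {1..n} \<Longrightarrow> Q.perm h s = act h s"
  using Q.e_perm[of h s] by simp

lemma perm_index:
  assumes g: "g \<in> carrier G" and J: "J \<in> {1..n * m}" and i: "i \<in> {1..m}" and h: "h \<in> H"
    and eq: "g \<otimes> r (block n J) = r i \<otimes> h"
  shows "P.perm g J = index n i (act h (inner n J))"
proof -
  have s: "act h (inner n J) \<in> {1..n}" using act_simps(1)[OF h inner_mem[OF J]] .
  note idx = index_mem[OF i s] block_index[OF i s] inner_index[OF i s]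
  have "transfer_elt G r g i (block n J) = h"
    using transfer_iff[OF g i block_mem[OF J] H_mem[OF h]] eq by simp
  then have "enum (index n i (act h (inner n J))) = bact g (enum J)"
    using h by (simp add: enum_eq_iff[OF g idx(1) J] idx)
  then show ?thesis
    using P.eq_perm_iff[of g "index n i (act h (inner n J))" J] g J idx(1) by (simp add: card_T)
qed

text \<open>This lets a vector of a composite for \<open>G\<close> be read, within one block, as a
  vector of a composite for \<open>H\<close>.\<close>

lemma block_entry:
  assumes g: "g \<in> carrier G" and ij: "i \<in> {1..m}" "j \<in> {1..m}" and h: "h \<in> H" and eq: "g \<otimes> r j = r i \<otimes> h"
    and st: "s \<in> {1..n}" "t \<in> {1..n}"
  shows "P.R g (index n i s) (index n j t) = Q.R h s t"
proof -
  have "transfer_elt G r g i j = h" using transfer_iff[OF g ij H_mem[OF h]] eq by simp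
  then show ?thesis
    using ind_rho_entry[OF g index_mem[OF ij(1) st(1)] index_mem[OF ij(2) st(2)]] h ij st
    by (simp add: ind_rho_eq block_index inner_index)
qed

text \<open>Here the column \<open>K\<close> is given, so the chain runs from \<open>k\<close> to
  \<open>j\<close> to \<open>i0\<close>. If the row is not in block \<open>i0\<close>, both maps are
  zero. Otherwise the 2-isomorphism of \<open>H\<close> reads the component
  \<open>t = act h2 u\<close> of block \<open>j\<close>, which is the component \<open>J\<close>
  that the 2-isomorphism for \<open>T\<close> reads, and both multiply by
  \<open>c (h1, h2) s\<close>.\<close>

lemma ind_phi_entry:
  assumes g: "g1 \<in> carrier G" "g2 \<in> carrier G" and I: "I \<in> {1..n * m}" and K: "K \<in> {1..n * m}"
  shows "ind_phi G H m r \<R> g1 g2 I K = P.\<Phi> g1 g2 I K"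
proof -
  define i k where "i = block n I" and "k = block n K"
  define s u where "s = inner n I" and "u = inner n K"
  have ik: "i \<in> {1..m}" "k \<in> {1..m}" and su: "s \<in> {1..n}" "u \<in> {1..n}"
    unfolding i_def k_def s_def u_def using I K by (auto intro: block_mem inner_mem)
  have I_eq: "I = index n i s" and K_eq: "K = index n k u"
    using index_block_inner[OF I] index_block_inner[OF K] by (simp_all add: i_def k_def s_def u_def)
  obtain j h2 where j: "j \<in> {1..m}" and h2: "h2 \<in> H" and eq2: "g2 \<otimes> r k = r j \<otimes> h2"
    using column_ex[OF g(2) ik(2)] by blast
  obtain i0 h1 where i0: "i0 \<in> {1..m}" and h1: "h1 \<in> H" and eq1: "g1 \<otimes> r j = r i0 \<otimes> h1"
    using column_ex[OF g(1) j] by blast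
  define t where "t = act h2 u"
  have t: "t \<in> {1..n}" unfolding t_def by (rule act_simps(1)[OF h2 su(2)])
  define J where "J = index n j t"
  have J: "J \<in> {1..n * m}" unfolding J_def by (rule index_mem[OF j t])
  have p2: "P.perm g2 K = J"
    unfolding J_def t_def u_def by (rule perm_index[OF g(2) K j h2]) (use eq2 in \<open>simp add: k_def\<close>)
  have "block n J = j" "inner n J = t" unfolding J_def by (rule block_index[OF j t] inner_index[OF j t])+
  then have p1: "P.perm g1 J = index n i0 (act h1 t)"
    using perm_index[OF g(1) J i0 h1] eq1 by simp
  have h1t: "act h1 t \<in> {1..n}" by (rule act_simps(1)[OF h1 t])
  have cond: "I = P.perm g1 (P.perm g2 K) \<longleftrightarrow> i = i0 \<and> s = act h1 t"
    unfolding p2 p1 i_def s_def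
    using block_index[OF i0 h1t] inner_index[OF i0 h1t] index_block_inner[OF I] by auto
  \<comment> \<open>The product of \<open>g2\<close> with \<open>r k\<close> lies in exactly one
    left coset, so a single block \<open>j\<close> contributes and the description of
    \<open>j\<close> in \<open>ind_phi\<close> is resolved.\<close>
  have tr2: "transfer_elt G r g2 j' k \<in> H \<longleftrightarrow> j' = j" if "j' \<in> {1..m}" for j'
  proof
    assume "transfer_elt G r g2 j' k \<in> H"
    then have "g2 \<otimes> r k = r j' \<otimes> transfer_elt G r g2 j' k"
      using transfer_iff[OF g(2) that ik(2)] H_mem by blast
    then show "j' = j" using rep_unique(1)[OF that j] h2 eq2 \<open>transfer_elt G r g2 j' k \<in> H\<close> by metis
  next
    assume "j' = j"
    then show "transfer_elt G r g2 j' k \<in> H"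
      using transfer_iff[OF g(2) j ik(2) H_mem[OF h2]] eq2 h2 by simp
  qed
  have tr1: "transfer_elt G r g1 i j \<in> H \<longleftrightarrow> i = i0"
  proof
    assume *: "transfer_elt G r g1 i j \<in> H"
    then have "g1 \<otimes> r j = r i \<otimes> transfer_elt G r g1 i j"
      using transfer_iff[OF g(1) ik(1) j] H_mem by blast
    then show "i = i0" using rep_unique(1)[OF ik(1) i0 * h1] eq1 by simp
  next
    assume "i = i0"
    then show "transfer_elt G r g1 i j \<in> H"
      using transfer_iff[OF g(1) i0 j H_mem[OF h1]] eq1 h1 by simp
  qed
  let ?P = "\<lambda>j'. j' \<in> {1..m} \<and> transfer_elt G r g1 i j' \<in> H \<and> transfer_elt G r g2 j' k \<in> H"
  have P: "?P j' \<longleftrightarrow> j' = j \<and> i = i0" for j' using tr1 tr2 j by auto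
  let ?C = "carrier (comp_mat (n * m) (P.R g1) (P.R g2) I K)"
  have ind: "ind_phi G H m r \<R> g1 g2 I K = (\<lambda>x\<in>?C. if i = i0
      then Q.\<Phi> (transfer_elt G r g1 i j) (transfer_elt G r g2 j k) s u (\<lambda>t\<in>{1..n}. x (index n j t))
      else \<zero>\<^bsub>P.R (g1 \<otimes> g2) I K\<^esub>)"
  proof -
    have *: "ind_phi G H m r \<R> g1 g2 I K = (\<lambda>x\<in>?C. if \<exists>j'. ?P j'
        then Q.\<Phi> (transfer_elt G r g1 i (THE j'. ?P j')) (transfer_elt G r g2 (THE j'. ?P j') k) s u
          (\<lambda>t\<in>{1..n}. x (index n (THE j'. ?P j') t))
        else \<zero>\<^bsub>P.R (g1 \<otimes> g2) I K\<^esub>)"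
      using g I K by (simp only: ind_phi_def sel Let_def ind_rho_eq restrict_apply' i_def k_def s_def u_def)
    show ?thesis
      unfolding * P by (intro restrict_ext, cases "i = i0") simp_all
  qed
  note Pen = P.\<Phi>_entry[OF g I[folded card_T] K[folded card_T], unfolded card_T]
  show ?thesis
  proof (cases "i = i0")
    case False
    then show ?thesis unfolding ind Pen using cond by (auto simp: fun_eq_iff)
  next
    case True
    have h: "transfer_elt G r g1 i j = h1" "transfer_elt G r g2 j k = h2"
      using transfer_iff[OF g(1) i0 j H_mem[OF h1]] transfer_iff[OF g(2) j ik(2) H_mem[OF h2]] eq1 eq2 True
      by simp_all
    have eI: "indc c (g1, g2) (enum I) = c (h1, h2) s"
      using ind_cocycle_apply[OF g ik(1) j ik(2) su(1) h1 h2 _ eq2] eq1 True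
      by (simp add: enum_def flip: i_def s_def)
    have "Q.\<Phi> h1 h2 s u (\<lambda>t\<in>{1..n}. x (index n j t)) =
        (if s = act h1 t then c (h1, h2) s * tensor_lift ground_space ground_space ground_space (*) (x J)
         else \<zero>\<^bsub>P.R (g1 \<otimes> g2) I K\<^esub>)" if x: "x \<in> ?C" for x
    proof -
      have xt: "x (index n j v) \<in> carrier (tensor (Q.R h1 s v) (Q.R h2 v u))" if v: "v \<in> {1..n}" for v
      proof -
        have "x (index n j v) \<in> carrier (tensor (P.R g1 I (index n j v)) (P.R g2 (index n j v) K))"
          using x index_mem[OF j v] unfolding comp_mat_entry[OF I K] direct_sum_simps by (rule PiE_mem)
        then show ?thesis
          unfolding I_eq K_eq block_entry[OF g(1) ik(1) j h1 eq1[folded True] su(1) v]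
            block_entry[OF g(2) j ik(2) h2 eq2 v su(2)] .
      qed
      have x': "(\<lambda>t\<in>{1..n}. x (index n j t)) \<in> carrier (comp_mat n (Q.R h1) (Q.R h2) s u)"
        unfolding comp_mat_entry[OF su] direct_sum_simps using xt by simp
      have "Q.\<Phi> h1 h2 s u = (\<lambda>x\<in>carrier (comp_mat n (Q.R h1) (Q.R h2) s u). if s = act h1 t
          then c (h1, h2) s * tensor_lift ground_space ground_space ground_space (*) (x t)
          else \<zero>\<^bsub>Q.R (h1 \<otimes> h2) s u\<^esub>)"
        using Q.\<Phi>_entry[of h1 h2 s u] h1 h2 su t Q_perm[OF h2 su(2)] Q_perm[OF h1 t]
        by (simp add: t_def cong: if_cong)
      \<comment> \<open>Inside the right block the row may still be off the permutation pattern. The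
        default values then agree because the target entries coincide, by the block decomposition of
        \<open>g1 \<otimes> g2\<close>.\<close>
      moreover have "\<zero>\<^bsub>Q.R (h1 \<otimes> h2) s u\<^esub> = \<zero>\<^bsub>P.R (g1 \<otimes> g2) I K\<^esub>" 
      proof -
        have "g1 \<otimes> g2 \<otimes> r k = r i \<otimes> (h1 \<otimes> h2)"
        proof -
          have "g1 \<otimes> g2 \<otimes> r k = g1 \<otimes> (r j \<otimes> h2)" using g ik by (simp add: m_assoc eq2)
          also have "\<dots> = r i \<otimes> h1 \<otimes> h2" using g j h2 by (simp add: eq1 True flip: m_assoc)
          finally show ?thesis using ik h1 h2 by (simp add: m_assoc)
        qed
        from block_entry[OF m_closed[OF g] ik H_closed(1)[OF h1 h2] this su]
        show ?thesis by (simp add: I_eq K_eq)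
      qed
      ultimately show ?thesis using x' t by (simp add: J_def)
    qed
    then show ?thesis
      unfolding ind Pen h eI p2 cond[unfolded p2] using True by (intro restrict_ext) simp
  qed
qed

lemma ind_phi_eq: "ind_phi G H m r \<R> = P.\<Phi>"
proof -
  have A: "ind_phi G H m r \<R> = (\<lambda>g1\<in>carrier G. \<lambda>g2\<in>carrier G. \<lambda>I\<in>{1..n * m}. \<lambda>K\<in>{1..n * m}.
      ind_phi G H m r \<R> g1 g2 I K)"
    by (auto simp: ind_phi_def fun_eq_iff sel)
  have B: "P.\<Phi> = (\<lambda>g1\<in>carrier G. \<lambda>g2\<in>carrier G. \<lambda>I\<in>{1..n * m}. \<lambda>K\<in>{1..n * m}. P.\<Phi> g1 g2 I K)"
    by (auto simp: set_two_rep_def fun_eq_iff card_T)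
  have "(\<lambda>g1\<in>carrier G. \<lambda>g2\<in>carrier G. \<lambda>I\<in>{1..n * m}. \<lambda>K\<in>{1..n * m}. ind_phi G H m r \<R> g1 g2 I K)
      = (\<lambda>g1\<in>carrier G. \<lambda>g2\<in>carrier G. \<lambda>I\<in>{1..n * m}. \<lambda>K\<in>{1..n * m}. P.\<Phi> g1 g2 I K)"
    by (intro restrict_ext ind_phi_entry)
  then show ?thesis by (rule trans[OF A trans[OF _ B[symmetric]]])
qed

text \<open>The matrices and composition 2-isomorphisms agree literally, so the induced unit is
  described by the very conditions that \<open>P.U\<close> alone satisfies.\<close>

lemma ind_two_rep_eq: "ind_two_rep G H m r \<R> = set_two_rep G T enum bact (indc c)"
proof -
  have "ind_two_rep G H m r \<R> = \<lparr>dim = card T, rho = P.R, phi1 = P.U, phi = P.\<Phi>\<rparr>"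
    unfolding ind_two_rep_def sel ind_rho_eq ind_phi_eq card_T[symmetric] P.the_unit ..
  also have "\<dots> = set_two_rep G T enum bact (indc c)"
    by (simp add: set_two_rep_def)
  finally show ?thesis .
qed

end

text \<open>The 2-representations are related by equality of records rather than by an equivalence,
  which is possible because \<open>e\<close> lists the classes in block order. The conjunct with
  \<open>restrict_to_S\<close> ties the composite of the two cohomology isomorphisms to the standard
  description of Shapiro's isomorphism through its inverse.\<close>

theorem mainTheorem3:
  fixes G :: "'g monoid" and H :: "'g set" and n m :: nat
    and \<rho> :: "'g \<Rightarrow> nat \<Rightarrow> nat" and c :: "'g \<times> 'g \<Rightarrow> nat \<Rightarrow> complex" and r :: "nat \<Rightarrow> 'g"
  defines "GH \<equiv> G\<lparr>carrier := H\<rparr>"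
  defines "S \<equiv> {1..n}"
  defines "T \<equiv> balanced G H S \<rho>"
  defines "cls \<equiv> balanced_class G H S \<rho>"
  defines "act \<equiv> balanced_act G H S \<rho>"
  defines "M \<equiv> unit_funs_act GH S \<rho>"
  defines "N \<equiv> unit_funs_act G T act"
  defines "indM \<equiv> ind_module G H (unit_funs S) M"
  defines "e \<equiv> \<lambda>I. cls (r (block n I)) (inner n I)"
  defines "indc \<equiv> ind_cocycle G H m r S \<rho> c"
  assumes G: "group G" "finite (carrier G)" and H: "subgroup H G"
    and rho: "\<rho> \<in> hom GH (sym_group n)"
    and c: "c \<in> carrier (cocycles2 GH (unit_funs S) M)"
    and r: "coset_reps G H m r"
  shows "group_action G T act
    \<and> bij_betw (\<lambda>(x, s). cls x s) (r ` {1..m} \<times> S) T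
    \<and> bij_betw e {1..card T} T
    \<and> (\<forall>g1\<in>carrier G. \<forall>g2\<in>carrier G. \<forall>i\<in>{1..m}.
        \<exists>!(j, k, h1, h2). j \<in> {1..m} \<and> k \<in> {1..m} \<and> h1 \<in> H \<and> h2 \<in> H \<and>
          g1 \<otimes>\<^bsub>G\<^esub> r j = r i \<otimes>\<^bsub>G\<^esub> h1 \<and> g2 \<otimes>\<^bsub>G\<^esub> r k = r j \<otimes>\<^bsub>G\<^esub> h2)
    \<and> indc \<in> carrier (cocycles2 G (unit_funs T) N)
    \<and> (\<forall>g1\<in>carrier G. \<forall>g2\<in>carrier G. \<forall>i\<in>{1..m}. \<forall>s\<in>S.
        \<forall>j\<in>{1..m}. \<forall>k\<in>{1..m}. \<forall>h1\<in>H. \<forall>h2\<in>H.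
          g1 \<otimes>\<^bsub>G\<^esub> r j = r i \<otimes>\<^bsub>G\<^esub> h1 \<longrightarrow> g2 \<otimes>\<^bsub>G\<^esub> r k = r j \<otimes>\<^bsub>G\<^esub> h2 \<longrightarrow>
          indc (g1, g2) (cls (r i) s) = c (h1, h2) s)
    \<and> is_two_rep G (ind_two_rep G H m r (set_two_rep GH S id \<rho> c))
    \<and> ind_two_rep G H m r (set_two_rep GH S id \<rho> c) = set_two_rep G T e act indc
    \<and> shapiro_ind G H (unit_funs S) M
        \<in> iso (H2 GH (unit_funs S) M) (H2 G indM (ind_module_act G))
    \<and> H2_identification G H S \<rho>
        \<in> iso (H2 G indM (ind_module_act G)) (H2 G (unit_funs T) N)
    \<and> (\<forall>u\<in>carrier (H2 GH (unit_funs S) M).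
        H2_identification G H S \<rho> (shapiro_ind G H (unit_funs S) M u)
        = inv_into (carrier (H2 G (unit_funs T) N)) (restrict_to_S G H S \<rho>) u)
    \<and> H2_identification G H S \<rho>
        (shapiro_ind G H (unit_funs S) M (H2_class GH (unit_funs S) M c))
      = H2_class G (unit_funs T) N indc"
proof -
  have GH: "group GH" unfolding GH_def by (rule group.subgroup_imp_group[OF G(1) H])
  interpret rho: group_hom GH "sym_group n" \<rho>
    using GH sym_group_is_group rho by (simp add: group_hom_def group_hom_axioms_def)
  have act: "set_action (G\<lparr>carrier := H\<rparr>) {1..n} \<rho>"
  proof (intro set_action.intro set_action_axioms.intro)
    show "group (G\<lparr>carrier := H\<rparr>)" using GH by (simp add: GH_def)
    show "\<rho> g s \<in> {1..n}" if "g \<in> carrier (G\<lparr>carrier := H\<rparr>)" "s \<in> {1..n}" for g s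
      using rho.hom_closed[of g] that permutes_in_image[of "\<rho> g" "{1..n}" s]
      by (simp add: GH_def sym_group_carrier)
    show "\<rho> \<one>\<^bsub>G\<lparr>carrier := H\<rparr>\<^esub> s = s" if "s \<in> {1..n}" for s
      using rho.hom_one by (simp add: GH_def sym_group_one)
    show "\<rho> (g \<otimes>\<^bsub>G\<lparr>carrier := H\<rparr>\<^esub> h) s = \<rho> g (\<rho> h s)"
      if "g \<in> carrier (G\<lparr>carrier := H\<rparr>)" "h \<in> carrier (G\<lparr>carrier := H\<rparr>)" "s \<in> {1..n}" for g h s
      using rho.hom_mult[of g h] that by (simp add: GH_def sym_group_mult)
  qed
  interpret B: balanced_product G H "{1..n}" \<rho> m r
    by (intro balanced_product.intro group_with_subgroup.intro group_with_subgroup_axioms.intro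
        balanced_product_axioms.intro G(1) act H r)
  interpret I: induced_rep G H n \<rho> m r c
    by unfold_locales (use c in \<open>simp add: GH_def S_def M_def\<close>)
  have e: "e = I.enum" by (simp add: e_def cls_def S_def I.enum_def[abs_def])
  have ex1: "\<exists>!(j, k, h1, h2). j \<in> {1..m} \<and> k \<in> {1..m} \<and> h1 \<in> H \<and> h2 \<in> H \<and>
      g1 \<otimes>\<^bsub>G\<^esub> r j = r i \<otimes>\<^bsub>G\<^esub> h1 \<and> g2 \<otimes>\<^bsub>G\<^esub> r k = r j \<otimes>\<^bsub>G\<^esub> h2"
    if g: "g1 \<in> carrier G" "g2 \<in> carrier G" and i: "i \<in> {1..m}" for g1 g2 i
  proof -
    obtain j h1 where j: "j \<in> {1..m}" "h1 \<in> H" "g1 \<otimes>\<^bsub>G\<^esub> r j = r i \<otimes>\<^bsub>G\<^esub> h1" using B.row_ex[OF g(1) i] by blast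
    obtain k h2 where k: "k \<in> {1..m}" "h2 \<in> H" "g2 \<otimes>\<^bsub>G\<^esub> r k = r j \<otimes>\<^bsub>G\<^esub> h2" using B.row_ex[OF g(2) j(1)] by blast
    show ?thesis
    proof (rule ex1I[of _ "(j, k, h1, h2)"])
      fix q assume "case q of (j, k, h1, h2) \<Rightarrow> j \<in> {1..m} \<and> k \<in> {1..m} \<and> h1 \<in> H \<and> h2 \<in> H \<and>
        g1 \<otimes>\<^bsub>G\<^esub> r j = r i \<otimes>\<^bsub>G\<^esub> h1 \<and> g2 \<otimes>\<^bsub>G\<^esub> r k = r j \<otimes>\<^bsub>G\<^esub> h2"
      then obtain j' k' h1' h2' where q: "q = (j', k', h1', h2')" "j' \<in> {1..m}" "k' \<in> {1..m}"
          "h1' \<in> H" "h2' \<in> H" "g1 \<otimes>\<^bsub>G\<^esub> r j' = r i \<otimes>\<^bsub>G\<^esub> h1'" "g2 \<otimes>\<^bsub>G\<^esub> r k' = r j' \<otimes>\<^bsub>G\<^esub> h2'"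
        by (cases q) auto
      have 1: "j' = j" "h1' = h1"
        using B.row_unique[OF g(1) i q(2) j(1) q(4) j(2) q(6) j(3)] by auto
      have "k' = k" "h2' = h2"
        using B.row_unique[OF g(2) j(1) q(3) k(1) q(5) k(2) q(7)[unfolded 1] k(3)] by auto
      with 1 q(1) show "q = (j, k, h1, h2)" by simp
    qed (use j k in simp)
  qed
  show ?thesis
    unfolding GH_def S_def T_def cls_def act_def M_def N_def indM_def indc_def e
  proof (intro conjI ballI impI)
    show "group_action G B.T B.bact" by (rule B.group_action_T)
    show "bij_betw (\<lambda>(x, s). B.cls x s) (r ` {1..m} \<times> {1..n}) B.T" by (rule B.bij_rep_pairs)
    show "bij_betw I.enum {1..card B.T} B.T" by (rule I.P.e)
    show "B.indc c \<in> carrier B.UT.Z" by (rule B.ind_cocycle_cocycle[OF I.c])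
    show "B.indc c (g1, g2) (B.cls (r i) s) = c (h1, h2) s"
      if "g1 \<in> carrier G" "g2 \<in> carrier G" "i \<in> {1..m}" "s \<in> {1..n}" "j \<in> {1..m}" "k \<in> {1..m}"
        "h1 \<in> H" "h2 \<in> H" "g1 \<otimes>\<^bsub>G\<^esub> r j = r i \<otimes>\<^bsub>G\<^esub> h1" "g2 \<otimes>\<^bsub>G\<^esub> r k = r j \<otimes>\<^bsub>G\<^esub> h2"
      for g1 g2 i s j k h1 h2
      by (rule B.ind_cocycle_apply[OF that(1-3,5,6,4,7-10)])
    show "is_two_rep G (ind_two_rep G H m r I.\<R>)"
      unfolding I.ind_two_rep_eq by (rule I.P.set_two_rep_is_two_rep)
    show "ind_two_rep G H m r I.\<R> = set_two_rep G B.T I.enum B.bact (B.indc c)"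
      by (rule I.ind_two_rep_eq)
  qed (rule ex1 B.C.shapiro_ind_iso B.H2_identification_iso B.H2_identification_shapiro_inverse
      B.H2_identification_shapiro[OF I.c]; assumption)+
qed

end
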